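(* Let $q\in(-1,1)$ with $q\neq 0$. Let $\mathcal H_{\mathbb R}=\mathbb R^2$ and let $(U_t)_{t\in\mathbb R}$ be ergodic, i.e. $$U_t=\begin{pmatrix}\cos(t\log\lambda)&-\sin(t\log\lambda)\\ \sin(t\log\lambda)&\cos(t\log\lambda)\end{pmatrix},\qquad \lambda\in(0,1).$$ Let $M_q=\Gamma_q(\mathcal H_{\mathbb R},U_t)''$ be the associated $q$-Araki-Woods von Neumann algebra, and let $M_q^{\varphi}$ be the centralizer of its vacuum state $\varphi$. Suppose that $$\lambda<\Big(1+\frac{C_q}{d_\infty}\Big)^{-2}\ \text{ if } q>0,\qquad \lambda<\Big(1+\frac{(C_q(1-q))^2D(q)}{d_\infty}\Big)^{-2}\ \text{ if } q<0 .$$ Then $(M_q^{\varphi})'\cap M_q=\mathbb C1$ (and hence $M_q^{\varphi}$ and $M_q$ are factors).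
   Context: Constants: $C_q=\prod_{i=1}^\infty\frac1{1-|q|^i}$, $d_0=1$, $d_j=\prod_{i=1}^j(1-q^i)$ for $j\ge1$, $d_\infty=\prod_{i=1}^\infty(1-q^i)$, $D(q)=\sup_n d_n$. Construction of $M_q$ (inner products are linear in the second variable). Let $\mathcal H_{\mathbb R}$ be a separable real Hilbert space with $\dim\mathcal H_{\mathbb R}\ge2$ and $(U_t)_{t\in\mathbb R}$ a strongly continuous orthogonal representation of $\mathbb R$ on it. Extend $U_t$ linearly to the complexification $\mathcal H_{\mathbb C}$ and let $A$ be its analytic generator (positive, nonsingular, self-adjoint, $U_t=A^{it}$). Put $\langle\xi,\eta\rangle_U=\langle\frac{2}{1+A^{-1}}\xi,\eta\rangle_{\mathcal H_{\mathbb C}}$ and let $\mathcal H$ be the completion of $\mathcal H_{\mathbb C}$ for this inner product; $\mathcal H_{\mathbb R}\subset\mathcal H$. The $q$-Fock space $\mathcal F_q(\mathcal H)$ is the completion of $\mathbb C\Omega\oplus\bigoplus_{n\ge1}\mathcal H^{\otimes n}$ (algebraic tensor powers; $\Omega$ is the unit vacuum vector) for $$\langle\xi_1\otimes\cdots\otimes\xi_n,\zeta_1\otimes\cdots\otimes\zeta_m\rangle_q=\delta_{m,n}\sum_{\pi\in S_n}q^{i(\pi)}\prod_{k=1}^n\langle\xi_k,\zeta_{\pi(k)}\rangle_U,$$ with $i(\pi)$ the number of inversions of $\pi$. For $\xi\in\mathcal H$, $c_q(\xi)$ is the bounded operator with $c_q(\xi)\Omega=\xi$, $c_q(\xi)(\xi_1\otimes\cdots\otimes\xi_n)=\xi\otimes\xi_1\otimes\cdots\otimes\xi_n$.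 Set $s_q(\xi)=c_q(\xi)+c_q(\xi)^*$ and $M_q=\Gamma_q(\mathcal H_{\mathbb R},U_t)''=\{s_q(\xi):\xi\in\mathcal H_{\mathbb R}\}''\subset\mathbf B(\mathcal F_q(\mathcal H))$. The vacuum state $\varphi=\langle\Omega,\cdot\,\Omega\rangle_q$ is a faithful normal state on $M_q$, and its centralizer is $M_q^{\varphi}=\{x\in M_q:\sigma_t^{\varphi}(x)=x\ \forall t\in\mathbb R\}$, where $(\sigma^\varphi_t)$ is the modular automorphism group of $\varphi$. Commutants are taken in $\mathbf B(\mathcal F_q(\mathcal H))$. *)

theory Defs
  imports "HOL-Analysis.Analysis" "HOL-Combinatorics.Permutations"
begin

section \<open>Complex Hilbert spaces\<close>

class complex_hilbert = banach +
  fixes scaleC :: "complex \<Rightarrow> 'a \<Rightarrow> 'a" (infixr "*\<^sub>C" 75)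
    and cinner :: "'a \<Rightarrow> 'a \<Rightarrow> complex"
  assumes scaleC_add_right: "c *\<^sub>C (x + y) = c *\<^sub>C x + c *\<^sub>C y"
    and scaleC_add_left: "(c + d) *\<^sub>C x = c *\<^sub>C x + d *\<^sub>C x"
    and scaleC_scaleC: "c *\<^sub>C (d *\<^sub>C x) = (c * d) *\<^sub>C x"
    and scaleC_of_real: "complex_of_real r *\<^sub>C x = r *\<^sub>R x"
    and cinner_commute: "cinner x y = cnj (cinner y x)"
    and cinner_add_right: "cinner x (y + z) = cinner x y + cinner x z"
    and cinner_scaleC_right: "cinner x (c *\<^sub>C y) = c * cinner x y"
    and cinner_self: "cinner x x = complex_of_real ((norm x)\<^sup>2)"

instantiation complex :: complex_hilbert
begin
definition "scaleC_complex (c :: complex) (x :: complex) = c * x"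
definition "cinner_complex (x :: complex) (y :: complex) = cnj x * y"
instance
  by standard
    (auto simp: scaleC_complex_def cinner_complex_def algebra_simps scaleR_conv_of_real
      mult.commute[of "cnj _"] complex_norm_square simp del: of_real_power)
end

global_interpretation complex_vector:
  vector_space "scaleC :: complex \<Rightarrow> 'a \<Rightarrow> 'a :: complex_hilbert"
  defines cspan = "module.span (scaleC :: complex \<Rightarrow> 'a \<Rightarrow> 'a)"
proof
  show "1 *\<^sub>C x = x" for x :: 'a
    using scaleC_of_real[of 1 x] by simp
qed (simp_all add: scaleC_add_right scaleC_add_left scaleC_scaleC)

definition bounded_clinear :: "('h::complex_hilbert \<Rightarrow> 'h) \<Rightarrow> bool" where
  "bounded_clinear f \<longleftrightarrow> bounded_linear f \<and> (\<forall>c x. f (c *\<^sub>C x) = c *\<^sub>C f x)"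

definition cadjoint :: "('h::complex_hilbert \<Rightarrow> 'h) \<Rightarrow> ('h \<Rightarrow> 'h)" where
  "cadjoint f = (THE g. \<forall>x y. cinner (g x) y = cinner x (f y))"


section \<open>Von Neumann algebras\<close>

definition commutant :: "('h::complex_hilbert \<Rightarrow> 'h) set \<Rightarrow> ('h \<Rightarrow> 'h) set" where
  "commutant S = {x. bounded_clinear x \<and> (\<forall>y\<in>S. x \<circ> y = y \<circ> x)}"

definition scalar_operators :: "('h::complex_hilbert \<Rightarrow> 'h) set" where
  "scalar_operators = range (\<lambda>c x. c *\<^sub>C x)"

definition von_neumann_algebra :: "('h::complex_hilbert \<Rightarrow> 'h) set \<Rightarrow> bool" where
  "von_neumann_algebra N \<longleftrightarrow>
     (\<forall>x\<in>N. bounded_clinear x \<and> cadjoint x \<in> N) \<and> commutant (commutant N) = N"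

definition factor :: "('h::complex_hilbert \<Rightarrow> 'h) set \<Rightarrow> bool" where
  "factor N \<longleftrightarrow> von_neumann_algebra N \<and> N \<inter> commutant N = scalar_operators"


section \<open>Spectral integrals\<close>

text \<open>Unbounded operators are represented by their graphs.\<close>

definition orthogonal_projection :: "('h::complex_hilbert \<Rightarrow> 'h) \<Rightarrow> bool" where
  "orthogonal_projection P \<longleftrightarrow>
     bounded_clinear P \<and> P \<circ> P = P \<and> (\<forall>x y. cinner (P x) y = cinner x (P y))"

definition spectral_measure :: "(real set \<Rightarrow> 'h::complex_hilbert \<Rightarrow> 'h) \<Rightarrow> bool" where
  "spectral_measure E \<longleftrightarrow>
     (\<forall>B\<in>sets borel. orthogonal_projection (E B)) \<and> E UNIV = id \<and>
     (\<forall>B::nat \<Rightarrow> real set. range B \<subseteq> sets borel \<longrightarrow> disjoint_family B \<longrightarrow>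
        (\<forall>x. (\<lambda>n. E (B n) x) sums E (\<Union>n. B n) x))"

text \<open>The finite measure $B \mapsto \langle x, E(B)x\rangle = \|E(B)x\|^2$.\<close>

definition scalar_measure :: "(real set \<Rightarrow> 'h::complex_hilbert \<Rightarrow> 'h) \<Rightarrow> 'h \<Rightarrow> real measure" where
  "scalar_measure E x = measure_of UNIV (sets borel) (\<lambda>B. ennreal ((norm (E B x))\<^sup>2))"

definition spectral_domain ::
    "(real set \<Rightarrow> 'h::complex_hilbert \<Rightarrow> 'h) \<Rightarrow> (real \<Rightarrow> complex) \<Rightarrow> 'h set" where
  "spectral_domain E f = {x. integrable (scalar_measure E x) (\<lambda>r. (cmod (f r))\<^sup>2)}"

text \<open>The integral of \<open>f\<close> against the complex measure $B \mapsto \langle z, E(B)x\rangle$,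
  written out by polarization (the inner product is linear in the second variable).\<close>

definition spectral_form ::
    "(real set \<Rightarrow> 'h::complex_hilbert \<Rightarrow> 'h) \<Rightarrow> (real \<Rightarrow> complex) \<Rightarrow> 'h \<Rightarrow> 'h \<Rightarrow> complex" where
  "spectral_form E f z x =
     (\<Sum>k<4. \<i> ^ k * (\<integral>r. f r \<partial>scalar_measure E (x + (\<i> ^ k) *\<^sub>C z))) / 4"

text \<open>The graph of the operator $\int f\,dE$. Testing against \<open>z\<close> in the domain only, which is
  dense, makes all four integrals above absolutely convergent.\<close>

definition spectral_integral ::
    "(real set \<Rightarrow> 'h::complex_hilbert \<Rightarrow> 'h) \<Rightarrow> (real \<Rightarrow> complex) \<Rightarrow> ('h \<times> 'h) set" where
  "spectral_integral E f =
     {(x, y). x \<in> spectral_domain E f \<and>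
              (\<forall>z\<in>spectral_domain E f. cinner z y = spectral_form E f z x)}"

text \<open>$D^{it}$ for a positive nonsingular self-adjoint operator with graph \<open>D\<close>: if
  $D = \int r\,dE(r)$, then $D^{it} = \int r^{it}\,dE(r)$.\<close>

definition imaginary_power :: "('h::complex_hilbert \<times> 'h) set \<Rightarrow> real \<Rightarrow> 'h \<Rightarrow> 'h" where
  "imaginary_power D t =
     (THE V. \<exists>E. spectral_measure E \<and> D = spectral_integral E complex_of_real \<and>
        {(x, V x) | x. True} =
          spectral_integral E (\<lambda>r. complex_of_real r powr (\<i> * complex_of_real t)))"


section \<open>The modular automorphism group and the centralizer\<close>

text \<open>Here \<open>M\<close> is a von Neumann algebra and \<open>\<Omega>\<close> a cyclic and separating vector, so that the
  underlying space with \<open>\<Omega>\<close> is the GNS representation of the faithful normal state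
  $\varphi = \langle\Omega, \cdot\,\Omega\rangle$ on \<open>M\<close>. The operator $S$ is the closure of
  $x\Omega \mapsto x^*\Omega$; it is antilinear, so its adjoint is determined by
  $\langle S^*\eta, \xi\rangle = \langle S\xi, \eta\rangle$.\<close>

definition tomita_S :: "('h::complex_hilbert \<Rightarrow> 'h) set \<Rightarrow> 'h \<Rightarrow> ('h \<times> 'h) set" where
  "tomita_S M \<Omega> = closure {(x \<Omega>, cadjoint x \<Omega>) | x. x \<in> M}"

definition antilinear_adjoint :: "('h::complex_hilbert \<times> 'h) set \<Rightarrow> ('h \<times> 'h) set" where
  "antilinear_adjoint S = {(\<eta>, \<zeta>). \<forall>(\<xi>, \<xi>')\<in>S. cinner \<zeta> \<xi> = cinner \<xi>' \<eta>}"

text \<open>$\Delta = S^*S$; the relational composition applies its left argument first.\<close>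

definition modular_operator :: "('h::complex_hilbert \<Rightarrow> 'h) set \<Rightarrow> 'h \<Rightarrow> ('h \<times> 'h) set" where
  "modular_operator M \<Omega> = tomita_S M \<Omega> O antilinear_adjoint (tomita_S M \<Omega>)"

definition modular_automorphism ::
    "('h::complex_hilbert \<Rightarrow> 'h) set \<Rightarrow> 'h \<Rightarrow> real \<Rightarrow> ('h \<Rightarrow> 'h) \<Rightarrow> ('h \<Rightarrow> 'h)" where
  "modular_automorphism M \<Omega> t x =
     imaginary_power (modular_operator M \<Omega>) t \<circ> x \<circ> imaginary_power (modular_operator M \<Omega>) (- t)"

definition centralizer :: "('h::complex_hilbert \<Rightarrow> 'h) set \<Rightarrow> 'h \<Rightarrow> ('h \<Rightarrow> 'h) set" where
  "centralizer M \<Omega> = {x \<in> M. \<forall>t. modular_automorphism M \<Omega> t x = x}"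


section \<open>The deformed one-particle space\<close>

definition rotation_group :: "real \<Rightarrow> real \<Rightarrow> real^2^2" where
  "rotation_group lam t =
     vector [vector [cos (t * ln lam), - sin (t * ln lam)],
             vector [sin (t * ln lam),   cos (t * ln lam)]]"

text \<open>In finite dimension every orbit of a one-parameter matrix group \<open>V\<close> extends to an entire
  function, and the analytic generator is the value of the extension at $-i$
  (so that $V_t = A^{it}$).\<close>

definition analytic_generator :: "(real \<Rightarrow> complex^'n^'n) \<Rightarrow> complex^'n^'n" where
  "analytic_generator V =
     (THE A. \<exists>F. (\<forall>i j. (\<lambda>z. F z $ i $ j) holomorphic_on UNIV) \<and>
                 (\<forall>t. F (complex_of_real t) = V t) \<and> A = F (- \<i>))"

definition U_inner :: "(real \<Rightarrow> real^'n^'n) \<Rightarrow> complex^'n \<Rightarrow> complex^'n \<Rightarrow> complex" where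
  "U_inner U \<xi> \<eta> =
     (let A = analytic_generator (\<lambda>t. map_matrix complex_of_real (U t));
          B = 2 *\<^sub>R matrix_inv (mat 1 + matrix_inv A)
      in \<Sum>i\<in>UNIV. cnj ((B *v \<xi>) $ i) * \<eta> $ i)"


section \<open>The q-Fock space and the q-Araki-Woods algebra\<close>

definition inversions :: "nat \<Rightarrow> (nat \<Rightarrow> nat) \<Rightarrow> nat" where
  "inversions n \<pi> = card {(i, j). i < j \<and> j < n \<and> \<pi> j < \<pi> i}"

definition q_inner ::
    "real \<Rightarrow> (real \<Rightarrow> real^'n^'n) \<Rightarrow> (complex^'n) list \<Rightarrow> (complex^'n) list \<Rightarrow> complex" where
  "q_inner q U \<xi>s \<zeta>s =
     (if length \<xi>s = length \<zeta>s
      then \<Sum>\<pi> | \<pi> permutes {..<length \<xi>s}.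
             complex_of_real (q ^ inversions (length \<xi>s) \<pi>) *
             (\<Prod>k<length \<xi>s. U_inner U (\<xi>s ! k) (\<zeta>s ! \<pi> k))
      else 0)"

text \<open>\<open>T [\<xi>\<^sub>1, \<dots>, \<xi>\<^sub>n]\<close> is the elementary tensor $\xi_1\otimes\cdots\otimes\xi_n$ and \<open>T []\<close> the vacuum
  vector. The formula for the inner products forces \<open>T\<close> to be multilinear on words of each
  length, hence to induce an isometric embedding of the algebraic Fock space; with the density of
  its range, the Hilbert space \<open>'h\<close> is the completion of the algebraic Fock space, unique up to a
  unique unitary respecting the elementary tensors.\<close>

definition is_q_fock_space ::
    "real \<Rightarrow> (real \<Rightarrow> real^'n^'n) \<Rightarrow> ((complex^'n) list \<Rightarrow> 'h::complex_hilbert) \<Rightarrow> bool" where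
  "is_q_fock_space q U T \<longleftrightarrow>
     (\<forall>\<xi>s \<zeta>s. cinner (T \<xi>s) (T \<zeta>s) = q_inner q U \<xi>s \<zeta>s) \<and>
     closure (cspan (range T)) = UNIV"

definition q_creation ::
    "((complex^'n) list \<Rightarrow> 'h::complex_hilbert) \<Rightarrow> complex^'n \<Rightarrow> 'h \<Rightarrow> 'h" where
  "q_creation T \<xi> = (THE c. bounded_clinear c \<and> (\<forall>\<xi>s. c (T \<xi>s) = T (\<xi> # \<xi>s)))"

definition q_gaussian ::
    "((complex^'n) list \<Rightarrow> 'h::complex_hilbert) \<Rightarrow> complex^'n \<Rightarrow> 'h \<Rightarrow> 'h" where
  "q_gaussian T \<xi> = (\<lambda>x. q_creation T \<xi> x + cadjoint (q_creation T \<xi>) x)"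

definition q_araki_woods ::
    "((complex^'n) list \<Rightarrow> 'h::complex_hilbert) \<Rightarrow> ('h \<Rightarrow> 'h) set" where
  "q_araki_woods T =
     commutant (commutant (range (\<lambda>\<xi>::real^'n. q_gaussian T (\<chi> i. complex_of_real (\<xi> $ i)))))"

definition vacuum_centralizer ::
    "((complex^'n) list \<Rightarrow> 'h::complex_hilbert) \<Rightarrow> ('h \<Rightarrow> 'h) set" where
  "vacuum_centralizer T = centralizer (q_araki_woods T) (T [])"


section \<open>Constants\<close>

definition C_const :: "real \<Rightarrow> real" where
  "C_const q = (\<Prod>i. 1 / (1 - \<bar>q\<bar> ^ Suc i))"

definition d_const :: "real \<Rightarrow> nat \<Rightarrow> real" where
  "d_const q j = (\<Prod>i=1..j. 1 - q ^ i)"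

definition d_inf :: "real \<Rightarrow> real" where
  "d_inf q = (\<Prod>i. 1 - q ^ Suc i)"

definition D_const :: "real \<Rightarrow> real" where
  "D_const q = (SUP n. d_const q n)"

end

theory Submission
  imports Defs "HOL-Complex_Analysis.Conformal_Mappings"
begin

text \<open>
  Let $\mu=\sqrt\lambda$ and let $f$, $\bar e$ be the orthonormal eigenvectors of the generator $A$, with
  $e=\mu f$. Write $\alpha$, $\beta$ for the left creation operators of $f$, $\bar e$, so that $M_q$ is
  generated by $y=\mu\alpha+\beta^*$. The Wick word $W_n$ of $e^{\otimes n}\otimes\bar e^{\otimes n}$ is
  fixed by the modular group, and after normalization its left and right actions are bounded uniformly
  in $n$. Let $x\in M_q$ commute with $M_q^\varphi$ and let $\zeta$ be the component of $x\Omega$ orthogonal to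
  $\Omega$; then $W_n$ acts on $\zeta$ from the left and from the right in the same way. The left action is
  asymptotic to $\mu^n\alpha^n(y^*)^n$, whose leading term is $\mu^n\alpha^n\beta^n$; the remaining terms form a
  geometric series in $\mu$ which the hypothesis on $\lambda$ makes strictly smaller. The right action ends
  with the letters $\bar e^{\otimes n}$ and is asymptotically orthogonal to
  $f^{\otimes n}\otimes\bar e^{\otimes n}\otimes\zeta$. Hence $\zeta=0$.

  The right action is the left action for the Fock space obtained by reversing words and exchanging the
  two letters, so every estimate is proved for the left action only.
\<close>


section \<open>Complex Hilbert spaces\<close>

text \<open>Write C = \<open>C_const q\<close> and U = \<open>U_bound q\<close>. The normalized
  leading term is bounded below by 1/C, and the remaining terms have norm at most C U^(3/2) (mu +
  mu^2 + ...). The former wins if C^2 U^(3/2) mu/(1 - mu) < 1, and K mu/(1 - mu) < 1 means mu < 1/(1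
  + K): this is the shape of the bound on \<lambda>. For q > 0 one has U = 1 and C = 1/d_inf, so C^2
  = C/d_inf; for q < 0, U = 1 - q. The asymptotics hold vector by vector only: on a word of length d
  just the terms of the Wick word with k and l at least n - d survive, and the factor q^((n-k) l)
  makes those with k < n vanish in the limit. Bounds uniform in n carry this over to all vectors.
  Adjoints and imaginary powers are definite descriptions, so uniqueness is part of the work. On
  words over the two letters the Tomita operator is a flip with a positive weight, the modular
  operator is diagonal in the numbers of the two letters, and every spectral measure representing it
  is the diagonal one.\<close>

lemma scaleC_complex [simp]: "c *\<^sub>C (x::complex) = c * x"
  by (simp add: scaleC_complex_def)

lemma cinner_add_left: "cinner (x + y) z = cinner x z + cinner y (z :: 'h::complex_hilbert)"
  by (metis cinner_add_right cinner_commute complex_cnj_add)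

lemma cinner_scaleC_left: "cinner (c *\<^sub>C x) y = cnj c * cinner x (y :: 'h::complex_hilbert)"
  by (metis cinner_commute cinner_scaleC_right complex_cnj_mult)

lemma cinner_scaleR_right: "cinner x (r *\<^sub>R y) = r * cinner x (y :: 'h::complex_hilbert)"
  by (metis cinner_scaleC_right scaleC_of_real)

lemma cinner_scaleR_left: "cinner (r *\<^sub>R x) y = r * cinner x (y :: 'h::complex_hilbert)"
  by (metis cinner_scaleC_left scaleC_of_real complex_cnj_complex_of_real)

lemma cinner_zero_right [simp]: "cinner x 0 = 0" for x :: "'h::complex_hilbert"
  using cinner_scaleR_right[of x 0 0] by simp

lemma cinner_zero_left [simp]: "cinner 0 x = 0" for x :: "'h::complex_hilbert"
  using cinner_scaleR_left[of 0 0 x] by simp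

lemma cinner_minus_right: "cinner x (- y) = - cinner x y" for x :: "'h::complex_hilbert"
  using cinner_scaleR_right[of x "-1" y] by simp

lemma cinner_minus_left: "cinner (- x) y = - cinner x y" for x :: "'h::complex_hilbert"
  using cinner_scaleR_left[of "-1" x y] by simp

lemma cinner_diff_right: "cinner x (y - z) = cinner x y - cinner x z" for x :: "'h::complex_hilbert"
  using cinner_add_right[of x y "- z"] by (simp add: cinner_minus_right)

lemma cinner_diff_left: "cinner (x - y) z = cinner x z - cinner y z" for x :: "'h::complex_hilbert"
  using cinner_add_left[of x "- y" z] by (simp add: cinner_minus_left)

lemma cinner_eq_zero_iff [simp]: "cinner x x = 0 \<longleftrightarrow> x = 0" for x :: "'h::complex_hilbert"
  by (simp add: cinner_self)

lemma norm_scaleC [simp]: "norm (c *\<^sub>C x) = cmod c * norm x" for x :: "'h::complex_hilbert"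
proof -
  have "complex_of_real ((norm (c *\<^sub>C x))\<^sup>2) = complex_of_real ((cmod c * norm x)\<^sup>2)"
    by (simp only: cinner_self[symmetric] cinner_scaleC_left cinner_scaleC_right)
      (simp add: cinner_self complex_norm_square[symmetric] power_mult_distrib mult.assoc[symmetric]
        mult.commute[of "cnj c"])
  then show ?thesis
    by (metis of_real_eq_iff norm_ge_zero mult_nonneg_nonneg power2_eq_iff_nonneg)
qed

lemma norm_add_sq: "(norm (x + y))\<^sup>2 = (norm x)\<^sup>2 + 2 * Re (cinner x y) + (norm y)\<^sup>2"
  for x :: "'h::complex_hilbert"
proof -
  have "complex_of_real ((norm (x + y))\<^sup>2)
      = complex_of_real ((norm x)\<^sup>2) + (cinner x y + cnj (cinner x y)) + complex_of_real ((norm y)\<^sup>2)"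
    by (simp only: cinner_self[symmetric] cinner_add_left cinner_add_right cinner_commute[of y x])
      (simp add: algebra_simps)
  then have "complex_of_real ((norm (x + y))\<^sup>2)
      = complex_of_real ((norm x)\<^sup>2 + 2 * Re (cinner x y) + (norm y)\<^sup>2)"
    by (simp add: complex_add_cnj)
  then show ?thesis
    using of_real_eq_iff by blast
qed

lemma cinner_cauchy_schwarz: "cmod (cinner x y) \<le> norm x * norm y" for x :: "'h::complex_hilbert"
proof (cases "x = 0")
  case False
  define c where "c = cinner x y / (norm x)\<^sup>2"
  have nx: "(norm x)\<^sup>2 > 0" using False by simp
  have e: "cinner (y - c *\<^sub>C x) (y - c *\<^sub>C x) = (norm y)\<^sup>2 - complex_of_real ((cmod (cinner x y))\<^sup>2 / (norm x)\<^sup>2)"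
  proof -
    have a: "cinner x (y - c *\<^sub>C x) = 0"
      using nx by (simp add: cinner_diff_right cinner_scaleC_right cinner_self c_def)
    have "cinner (y - c *\<^sub>C x) (y - c *\<^sub>C x) = cinner y (y - c *\<^sub>C x)"
      by (subst cinner_diff_left) (simp add: cinner_scaleC_left a)
    also have "\<dots> = (norm y)\<^sup>2 - c * cnj (cinner x y)"
      by (simp add: cinner_diff_right cinner_scaleC_right cinner_self cinner_commute[of y x])
    also have "c * cnj (cinner x y) = complex_of_real ((cmod (cinner x y))\<^sup>2 / (norm x)\<^sup>2)"
      by (simp add: c_def complex_mult_cnj cmod_power2)
    finally show ?thesis .
  qed
  have "complex_of_real ((norm (y - c *\<^sub>C x))\<^sup>2) = complex_of_real ((norm y)\<^sup>2 - (cmod (cinner x y))\<^sup>2 / (norm x)\<^sup>2)"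
    using e cinner_self[of "y - c *\<^sub>C x"] by simp
  then have "(norm (y - c *\<^sub>C x))\<^sup>2 = (norm y)\<^sup>2 - (cmod (cinner x y))\<^sup>2 / (norm x)\<^sup>2"
    using of_real_eq_iff by blast
  then have "(cmod (cinner x y))\<^sup>2 / (norm x)\<^sup>2 \<le> (norm y)\<^sup>2"
    by (smt (verit) zero_le_power2)
  then have "(cmod (cinner x y))\<^sup>2 \<le> (norm x * norm y)\<^sup>2"
    using nx by (simp add: divide_le_eq power_mult_distrib mult.commute)
  then show ?thesis
    using power2_le_imp_le by fastforce
qed simp

lemma bounded_bilinear_cinner: "bounded_bilinear (cinner :: 'h::complex_hilbert \<Rightarrow> 'h \<Rightarrow> complex)"
proof
  show "\<exists>K. \<forall>a b :: 'h. cmod (cinner a b) \<le> norm a * norm b * K"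
    by (rule exI[of _ 1]) (simp add: cinner_cauchy_schwarz)
qed (auto simp: cinner_add_left cinner_add_right cinner_scaleR_left cinner_scaleR_right scaleR_conv_of_real)

interpretation cinner: bounded_bilinear "cinner :: 'h::complex_hilbert \<Rightarrow> 'h \<Rightarrow> complex"
  by (rule bounded_bilinear_cinner)

lemma scaleC_scaleR: "c *\<^sub>C (r *\<^sub>R x) = r *\<^sub>R (c *\<^sub>C x)" for x :: "'h::complex_hilbert"
  by (metis scaleC_of_real scaleC_scaleC mult.commute)

lemma bounded_bilinear_scaleC: "bounded_bilinear (scaleC :: complex \<Rightarrow> 'h::complex_hilbert \<Rightarrow> 'h)"
proof
  show "\<exists>K. \<forall>a (b :: 'h). norm (a *\<^sub>C b) \<le> norm a * norm b * K"
    by (rule exI[of _ 1]) simp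
  show "(r *\<^sub>R a) *\<^sub>C b = r *\<^sub>R (a *\<^sub>C (b :: 'h))" for r a b
    by (metis scaleC_of_real scaleC_scaleC scaleR_conv_of_real)
qed (auto simp: scaleC_add_left scaleC_add_right scaleC_scaleR)

interpretation scaleC: bounded_bilinear "scaleC :: complex \<Rightarrow> 'h::complex_hilbert \<Rightarrow> 'h"
  by (rule bounded_bilinear_scaleC)

lemma cinner_ext: "(\<And>z. cinner z x = cinner z y) \<Longrightarrow> x = (y :: 'h::complex_hilbert)"
  using cinner_eq_zero_iff[of "x - y"] by (simp add: cinner_diff_right)

text \<open>The weights and vectors are those of \<open>spectral_form\<close>; with the inner
  product antilinear in its first slot this pattern isolates \<open>cinner z x\<close> and not its
  conjugate.\<close>

lemma polarization:
  "(\<Sum>k<4. \<i> ^ k * complex_of_real ((norm (x + \<i> ^ k *\<^sub>C z))\<^sup>2)) = 4 * cinner z x"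
  for x :: "'h::complex_hilbert"
proof -
  have *: "complex_of_real ((norm (x + c *\<^sub>C z))\<^sup>2) = cinner x x + c * cinner x z + cnj c * cinner z x
      + cnj c * c * cinner z z" for c
    by (simp only: cinner_self[symmetric] cinner_add_left cinner_add_right cinner_scaleC_left cinner_scaleC_right)
      (simp add: algebra_simps)
  show ?thesis
    unfolding * by (simp add: numeral_eq_Suc algebra_simps)
qed


section \<open>Bounded operators\<close>

lemma bounded_clinearI:
  "bounded_linear f \<Longrightarrow> (\<And>c x. f (c *\<^sub>C x) = c *\<^sub>C f x) \<Longrightarrow> bounded_clinear f"
  by (simp add: bounded_clinear_def)

lemma bounded_clinear_bl: "bounded_clinear f \<Longrightarrow> bounded_linear f"
  and bounded_clinear_scaleC: "bounded_clinear f \<Longrightarrow> f (c *\<^sub>C x) = c *\<^sub>C f x"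
  by (simp_all add: bounded_clinear_def)

lemma bounded_clinear_add: "bounded_clinear f \<Longrightarrow> f (x + y) = f x + f y"
  and bounded_clinear_diff: "bounded_clinear f \<Longrightarrow> f (x - y) = f x - f y"
  and bounded_clinear_minus: "bounded_clinear f \<Longrightarrow> f (- x) = - f x"
  and bounded_clinear_zero: "bounded_clinear f \<Longrightarrow> f 0 = 0"
  and bounded_clinear_scaleR: "bounded_clinear f \<Longrightarrow> f (r *\<^sub>R x) = r *\<^sub>R f x"
  and bounded_clinear_sum: "bounded_clinear f \<Longrightarrow> f (sum g A) = (\<Sum>a\<in>A. f (g a))"
  using bounded_clinear_bl[of f]
  by (simp_all add: linear_simps[OF bounded_clinear_bl] bounded_linear.linear linear_0 linear_sum linear_neg)

lemmas bcl_simps = bounded_clinear_add bounded_clinear_diff bounded_clinear_zero bounded_clinear_minus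
  bounded_clinear_scaleR bounded_clinear_scaleC bounded_clinear_sum

lemma bounded_clinear_id [intro]: "bounded_clinear id" "bounded_clinear (\<lambda>x. x)"
  by (auto simp: bounded_clinear_def id_def bounded_linear_ident)

lemma bounded_clinear_compose [intro]:
  "bounded_clinear f \<Longrightarrow> bounded_clinear g \<Longrightarrow> bounded_clinear (f \<circ> g)"
  by (auto simp: bounded_clinear_def comp_def intro: bounded_linear_compose)

lemma bounded_clinear_compose' [intro]:
  "bounded_clinear f \<Longrightarrow> bounded_clinear g \<Longrightarrow> bounded_clinear (\<lambda>x. f (g x))"
  by (auto simp: bounded_clinear_def intro: bounded_linear_compose)

lemma bounded_clinear_plus [intro]:
  "bounded_clinear f \<Longrightarrow> bounded_clinear g \<Longrightarrow> bounded_clinear (\<lambda>x. f x + g x)"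
  by (auto simp: bounded_clinear_def scaleC_add_right intro: bounded_linear_add)

lemma bounded_clinear_cmult [intro]: "bounded_clinear f \<Longrightarrow> bounded_clinear (\<lambda>x. c *\<^sub>C f x)"
  by (auto simp: bounded_clinear_def scaleC_scaleC mult.commute
      intro: bounded_linear_compose[OF scaleC.bounded_linear_right])

lemma bounded_clinear_rmult [intro]: "bounded_clinear f \<Longrightarrow> bounded_clinear (\<lambda>x. r *\<^sub>R f x)"
  using bounded_clinear_cmult[of f "of_real r"] by (simp add: scaleC_of_real)

lemma bounded_clinear_sub [intro]:
  "bounded_clinear f \<Longrightarrow> bounded_clinear g \<Longrightarrow> bounded_clinear (\<lambda>x. f x - g x)"
  using bounded_clinear_plus[of f "\<lambda>x. (- 1) *\<^sub>R g x"] bounded_clinear_rmult[of g "-1"] by simp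

lemma bounded_clinear_0 [intro]: "bounded_clinear (\<lambda>x. 0)"
  by (auto simp: bounded_clinear_def)

lemma bounded_clinear_setsum [intro]:
  "(\<And>i. i \<in> I \<Longrightarrow> bounded_clinear (f i)) \<Longrightarrow> bounded_clinear (\<lambda>x. \<Sum>i\<in>I. f i x)"
  by (induction I rule: infinite_finite_induct) auto

lemma bounded_clinear_funpow [intro]: "bounded_clinear f \<Longrightarrow> bounded_clinear (f ^^ n)"
  by (induction n) auto

lemma bounded_clinear_bound:
  assumes "bounded_clinear f"
  obtains K where "K > 0" "\<And>x. norm (f x) \<le> K * norm x"
  using bounded_linear.pos_bounded[OF bounded_clinear_bl[OF assms]] by (auto simp: mult.commute)

text \<open>First-order condition at the minimum t = 0 of a quadratic polynomial, used to
  differentiate the Riesz functional in a given direction.\<close>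

lemma minimizer_imp_zero:
  fixes a b :: real
  assumes "\<And>t. a * t + b * t\<^sup>2 \<ge> 0" "b \<ge> 0"
  shows "a = 0"
proof (rule ccontr)
  assume "a \<noteq> 0"
  \<comment> \<open>The exact minimizer is -a/(2 b); the denominator b + 1 never vanishes and still
    gives a negative value.\<close>
  define t where "t = - a / (b + 1)"
  have b: "b + 1 \<noteq> 0" using assms(2) by linarith
  have "a * t + b * t\<^sup>2 = - (a * a * (b + 1)) / (b + 1)\<^sup>2 + b * (a * a) / (b + 1)\<^sup>2"
    using b by (simp add: t_def power2_eq_square)
  also have "\<dots> = - a\<^sup>2 / (b + 1)\<^sup>2"
    by (simp add: add_divide_distrib[symmetric] power2_eq_square algebra_simps)
  finally have "a * t + b * t\<^sup>2 = - a\<^sup>2 / (b + 1)\<^sup>2" .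
  moreover have "\<dots> < 0"
    using \<open>a \<noteq> 0\<close> assms(2) by (simp add: divide_neg_pos)
  ultimately show False using assms(1)[of t] by linarith
qed

text \<open>The representing vector is the minimizer of \<open>E\<close>, whose derivative at z in
  direction x is 2 Re (<z, x> - g x).\<close>

theorem riesz_representation:
  fixes g :: "'h::complex_hilbert \<Rightarrow> complex"
  assumes bl: "bounded_linear g" and sc: "\<And>c x. g (c *\<^sub>C x) = c * g x"
  shows "\<exists>z. \<forall>x. g x = cinner z x"
proof -
  define E where "E x = (norm x)\<^sup>2 - 2 * Re (g x)" for x
  obtain K where K: "\<And>x. cmod (g x) \<le> norm x * K"
    using bounded_linear.bounded[OF bl] by blast
  have low: "E x \<ge> - K\<^sup>2" for x
  proof -
    have "Re (g x) \<le> norm x * K" using K[of x] complex_Re_le_cmod[of "g x"] by linarith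
    moreover have "(norm x - K)\<^sup>2 \<ge> 0" by simp
    ultimately show ?thesis unfolding E_def by (simp add: power2_diff) 
  qed
  define m where "m = Inf (range E)"
  have bdd: "bdd_below (range E)" using low by (auto simp: bdd_below_def)
  have m_le: "m \<le> E x" for x unfolding m_def by (rule cInf_lower) (use bdd in auto)
  have "\<exists>x. E x < m + inverse (real (Suc n))" for n
  proof (rule ccontr)
    assume "\<not> ?thesis"
    then have "m + inverse (real (Suc n)) \<le> Inf (range E)"
      by (intro cInf_greatest) (auto simp: not_less)
    then have "m + inverse (real (Suc n)) \<le> m" by (simp only: m_def)
    then show False by simp
  qed
  then obtain X where X: "\<And>n. E (X n) < m + inverse (real (Suc n))" by metis
  \<comment> \<open>Parallelogram law: the linear part of \<open>E\<close> cancels, so the distance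
    of two almost minimizers is controlled by their excess over the infimum.\<close>
  have par: "(norm (x - y))\<^sup>2 / 4 = (E x + E y) / 2 - E ((1/2) *\<^sub>R (x + y))" for x y
  proof -
    have "g ((1/2) *\<^sub>R (x + y)) = (1/2) *\<^sub>R (g x + g y)"
      by (simp only: linear_simps(5)[OF bl] linear_simps(1)[OF bl])
    then have "Re (g ((1/2) *\<^sub>R (x + y))) = (Re (g x) + Re (g y)) / 2" by simp
    moreover have "(norm (x - y))\<^sup>2 + (norm (x + y))\<^sup>2 = 2 * (norm x)\<^sup>2 + 2 * (norm y)\<^sup>2"
      using norm_add_sq[of x y] norm_add_sq[of x "- y"] by (simp add: cinner_minus_right)
    moreover have "(norm ((1/2) *\<^sub>R (x + y)))\<^sup>2 = (norm (x + y))\<^sup>2 / 4"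
      by (simp add: power_divide del: scaleR_right_distrib)
    ultimately show ?thesis unfolding E_def by argo
  qed
  have "Cauchy X"
  proof (rule metric_CauchyI)
    fix e :: real assume e: "e > 0"
    obtain N where N: "inverse (real (Suc N)) < e\<^sup>2 / 4"
      using reals_Archimedean[of "e\<^sup>2 / 4"] e by auto
    have "dist (X i) (X j) < e" if "i \<ge> N" "j \<ge> N" for i j
    proof -
      have "inverse (real (Suc i)) \<le> inverse (real (Suc N))" "inverse (real (Suc j)) \<le> inverse (real (Suc N))"
        using that by (auto simp: field_simps)
      then have "(norm (X i - X j))\<^sup>2 / 4 < e\<^sup>2 / 4"
        using par[of "X i" "X j"] X[of i] X[of j] m_le[of "(1/2) *\<^sub>R (X i + X j)"] N by argo
      then show ?thesis
        using e by (simp add: dist_norm power_less_imp_less_base)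
    qed
    then show "\<exists>M. \<forall>i\<ge>M. \<forall>j\<ge>M. dist (X i) (X j) < e" by blast
  qed
  then obtain z where z: "X \<longlonglongrightarrow> z" using Cauchy_convergent convergent_def by blast
  have "(\<lambda>n. E (X n)) \<longlonglongrightarrow> E z"
    unfolding E_def using bounded_linear.tendsto[OF bl z] by (intro tendsto_intros z)
  moreover have "(\<lambda>n. m + inverse (real (Suc n))) \<longlonglongrightarrow> m + 0"
    by (intro tendsto_intros LIMSEQ_inverse_real_of_nat)
  ultimately have "E z \<le> m + 0"
    by (rule LIMSEQ_le) (use X less_imp_le in blast)
  then have min: "E z \<le> E x" for x using m_le[of x] by simp
  have re: "Re (g x) = Re (cinner z x)" for x
  proof -
    have "2 * (Re (cinner z x) - Re (g x)) = 0"
    proof (rule minimizer_imp_zero)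
      fix t :: real
      have "E (z + t *\<^sub>R x) = E z + 2 * (Re (cinner z x) - Re (g x)) * t + (norm x)\<^sup>2 * t\<^sup>2"
        unfolding E_def by (simp add: norm_add_sq linear_simps[OF bl] cinner_scaleR_right power_mult_distrib algebra_simps)
      then show "0 \<le> 2 * (Re (cinner z x) - Re (g x)) * t + (norm x)\<^sup>2 * t\<^sup>2"
        using min[of "z + t *\<^sub>R x"] by linarith
    qed simp
    then show ?thesis by simp
  qed
  have "g x = cinner z x" for x
  proof (rule complex_eqI)
    show "Re (g x) = Re (cinner z x)" by (rule re)
    show "Im (g x) = Im (cinner z x)"
      using re[of "\<i> *\<^sub>C x"] by (simp add: sc cinner_scaleC_right)
  qed
  then show ?thesis by blast
qed

text \<open>Justifies the definite description in \<open>cadjoint\<close>. Uniqueness asks nothing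
  of the candidate, because its values are determined by all inner products.\<close>

lemma cadjoint_ex1:
  assumes "bounded_clinear f"
  shows "\<exists>!g. \<forall>x y. cinner (g x) y = cinner x (f y)"
proof -
  have "\<exists>z. \<forall>y. cinner x (f y) = cinner z y" for x
    by (rule riesz_representation)
      (auto simp: bcl_simps[OF assms] cinner_scaleC_right
        intro!: bounded_linear_compose[OF cinner.bounded_linear_right] bounded_clinear_bl assms)
  then obtain g where "\<And>x y. cinner (g x) y = cinner x (f y)" by metis
  moreover have "h = g" if "\<forall>x y. cinner (h x) y = cinner x (f y)" for h
  proof
    fix x
    show "h x = g x"
      by (rule cinner_ext) (metis calculation cinner_commute that)
  qed
  ultimately show ?thesis by blast
qed

lemma cinner_cadjoint: "bounded_clinear f \<Longrightarrow> cinner (cadjoint f x) y = cinner x (f y)"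
  unfolding cadjoint_def using theI'[OF cadjoint_ex1] by blast

lemma cinner_cadjoint': "bounded_clinear f \<Longrightarrow> cinner x (cadjoint f y) = cinner (f x) y"
  by (metis cinner_cadjoint cinner_commute)

lemma cadjoint_eqI:
  "bounded_clinear f \<Longrightarrow> (\<And>x y. cinner (g x) y = cinner x (f y)) \<Longrightarrow> cadjoint f = g"
  unfolding cadjoint_def by (rule the1_equality[OF cadjoint_ex1]) auto

text \<open>Testing with y = g x bounds the square of norm (g x) by K norm x norm (g x). Phrased for
  a bare adjoint pair, so that it applies before \<open>cadjoint\<close> is known to be bounded and
  also to powers of annihilators.\<close>

lemma adjoint_pair_bound:
  assumes "\<And>x y. cinner (g x) y = cinner x (f y)" "\<And>x. norm (f x) \<le> K * norm x" "K \<ge> 0"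
  shows "norm (g x) \<le> K * norm (x :: 'h::complex_hilbert)"
proof (cases "g x = 0")
  case False
  have "(norm (g x))\<^sup>2 = cmod (cinner x (f (g x)))"
    unfolding assms(1)[symmetric] by (simp add: cinner_self norm_power)
  also have "\<dots> \<le> norm x * (K * norm (g x))"
    by (rule order.trans[OF cinner_cauchy_schwarz]) (simp add: assms mult_left_mono)
  finally have "norm (g x) * norm (g x) \<le> (K * norm x) * norm (g x)"
    by (simp add: power2_eq_square mult_ac)
  then show ?thesis using False by simp
qed (use assms in auto)

lemma bounded_clinear_cadjoint [intro]:
  assumes "bounded_clinear f"
  shows "bounded_clinear (cadjoint f)"
proof (rule bounded_clinearI)
  obtain K where K: "K > 0" "\<And>x. norm (f x) \<le> K * norm x" using bounded_clinear_bound[OF assms] by blast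
  have sc: "cadjoint f (c *\<^sub>C x) = c *\<^sub>C cadjoint f x" for c x
    by (rule cinner_ext) (simp add: cinner_cadjoint'[OF assms] cinner_scaleC_right)
  then show "cadjoint f (c *\<^sub>C x) = c *\<^sub>C cadjoint f x" for c x .
  show "bounded_linear (cadjoint f)"
  proof (rule bounded_linear_intro[where K = K])
    show "cadjoint f (x + y) = cadjoint f x + cadjoint f y" for x y
      by (rule cinner_ext) (simp add: cinner_cadjoint'[OF assms] cinner_add_right)
    show "cadjoint f (r *\<^sub>R x) = r *\<^sub>R cadjoint f x" for r x
      using sc[of "of_real r" x] by (simp add: scaleC_of_real)
    show "norm (cadjoint f x) \<le> norm x * K" for x
      using adjoint_pair_bound[of "cadjoint f" f K x] K by (simp add: cinner_cadjoint[OF assms] mult.commute)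
  qed
qed

lemma cadjoint_cadjoint [simp]: "bounded_clinear f \<Longrightarrow> cadjoint (cadjoint f) = f"
  by (rule cadjoint_eqI) (auto simp: cinner_cadjoint')

lemma cadjoint_compose:
  "bounded_clinear f \<Longrightarrow> bounded_clinear g \<Longrightarrow> cadjoint (f \<circ> g) = cadjoint g \<circ> cadjoint f"
  by (rule cadjoint_eqI) (auto simp: cinner_cadjoint)

lemma cadjoint_plus:
  "bounded_clinear f \<Longrightarrow> bounded_clinear g \<Longrightarrow> cadjoint (\<lambda>x. f x + g x) = (\<lambda>x. cadjoint f x + cadjoint g x)"
  by (rule cadjoint_eqI) (auto simp: cinner_cadjoint cinner_add_left cinner_add_right)

lemma cadjoint_cmult:
  "bounded_clinear f \<Longrightarrow> cadjoint (\<lambda>x. c *\<^sub>C f x) = (\<lambda>x. cnj c *\<^sub>C cadjoint f x)"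
  by (rule cadjoint_eqI) (auto simp: cinner_cadjoint cinner_scaleC_left cinner_scaleC_right)

lemma cadjoint_id [simp]: "cadjoint id = id"
  by (rule cadjoint_eqI) auto

lemma cinner_funpow:
  fixes f g :: "'h::complex_hilbert \<Rightarrow> 'h"
  assumes "\<And>x y. cinner (g x) y = cinner x (f y)"
  shows "cinner ((g ^^ n) x) y = cinner x ((f ^^ n) y)"
proof (induction n arbitrary: x)
  case (Suc n)
  have "cinner ((g ^^ Suc n) x) y = cinner ((g ^^ n) (g x)) y" by (simp add: funpow_swap1)
  then show ?case by (simp add: Suc assms)
qed simp


section \<open>Commutants\<close>

lemma commutantI: "bounded_clinear x \<Longrightarrow> (\<And>y. y \<in> S \<Longrightarrow> x \<circ> y = y \<circ> x) \<Longrightarrow> x \<in> commutant S"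
  and commutant_bcl: "x \<in> commutant S \<Longrightarrow> bounded_clinear x"
  and commutantD: "x \<in> commutant S \<Longrightarrow> y \<in> S \<Longrightarrow> x \<circ> y = y \<circ> x"
  by (auto simp: commutant_def)

lemma commutantD': "x \<in> commutant S \<Longrightarrow> y \<in> S \<Longrightarrow> x (y v) = y (x v)"
  using commutantD[of x S y] by (metis comp_apply)

lemma commutant_antimono: "S \<subseteq> S' \<Longrightarrow> commutant S' \<subseteq> commutant S"
  by (auto simp: commutant_def)

lemma subset_bicommutant: "(\<And>x. x \<in> S \<Longrightarrow> bounded_clinear x) \<Longrightarrow> S \<subseteq> commutant (commutant S)"
  by (auto simp: commutant_def)

lemma commutant_triple:
  "(\<And>x. x \<in> S \<Longrightarrow> bounded_clinear x) \<Longrightarrow> commutant (commutant (commutant S)) = commutant S"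
  using subset_bicommutant[of S] subset_bicommutant[of "commutant S"] commutant_antimono
  by (metis commutant_bcl subset_antisym)

lemma commutant_cadjoint:
  assumes S: "\<And>x. x \<in> S \<Longrightarrow> bounded_clinear x \<and> cadjoint x \<in> S" and x: "x \<in> commutant S"
  shows "cadjoint x \<in> commutant S"
proof (rule commutantI)
  have bx: "bounded_clinear x" using x by (rule commutant_bcl)
  then show "bounded_clinear (cadjoint x)" ..
  fix y assume y: "y \<in> S"
  then have by': "bounded_clinear y" "cadjoint y \<in> S" using S by auto
  have "cadjoint (x \<circ> cadjoint y) = cadjoint (cadjoint y \<circ> x)"
    using commutantD[OF x by'(2)] by simp
  then show "cadjoint x \<circ> y = y \<circ> cadjoint x"
    using by' bx by (simp add: cadjoint_compose bounded_clinear_cadjoint)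
qed

lemma von_neumann_algebra_commutant:
  assumes S: "\<And>x. x \<in> S \<Longrightarrow> bounded_clinear x \<and> cadjoint x \<in> S"
  shows "von_neumann_algebra (commutant S)"
  unfolding von_neumann_algebra_def
  using commutant_bcl commutant_cadjoint[OF S] commutant_triple[of S] S by blast

lemma scalar_operators_subset_commutant: 
  assumes "\<And>x. x \<in> S \<Longrightarrow> bounded_clinear x"
  shows "scalar_operators \<subseteq> commutant S"
  unfolding scalar_operators_def
  by (auto intro!: commutantI simp: fun_eq_iff bounded_clinear_scaleC assms)


section \<open>Extension from a total family\<close>

text \<open>Formal linear combinations are lists of coefficients and words, so that maps can be
  handled on words before they are known to respect linear relations. The target may also be
  \<open>complex\<close>, which makes \<open>lin\<close> a weighted scalar sum, as in
  \<open>qi\<close>.\<close>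

definition lin :: "('w \<Rightarrow> 'b::complex_hilbert) \<Rightarrow> (complex \<times> 'w) list \<Rightarrow> 'b" where
  "lin f c = (\<Sum>(z, w)\<leftarrow>c. z *\<^sub>C f w)"

definition lin_bind :: "(complex \<times> 'w) list \<Rightarrow> ('w \<Rightarrow> (complex \<times> 'v) list) \<Rightarrow> (complex \<times> 'v) list" where
  "lin_bind c k = concat (map (\<lambda>(z, w). map (\<lambda>(z', u). (z * z', u)) (k w)) c)"

lemma lin_Nil [simp]: "lin f [] = 0"
  and lin_Cons [simp]: "lin f ((z, w) # c) = z *\<^sub>C f w + lin f c"
  and lin_append [simp]: "lin f (c @ d) = lin f c + lin f d"
  by (simp_all add: lin_def)

lemma lin_map: "lin f (map (\<lambda>(z, w). (a * z, g w)) c) = a *\<^sub>C lin (\<lambda>w. f (g w)) c"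
  by (induction c) (auto simp: scaleC_add_right scaleC_scaleC)

lemma lin_map': "lin f (map (\<lambda>(z, w). (z, g w)) c) = lin (\<lambda>w. f (g w)) c"
  by (induction c) (auto simp: scaleC_add_right)

lemma lin_cmap: "lin f (map (\<lambda>(z, w). (a * z, w)) c) = a *\<^sub>C lin f c"
  by (induction c) (auto simp: scaleC_add_right scaleC_scaleC)

lemma lin_bind [simp]: "lin f (lin_bind c k) = lin (\<lambda>w. lin f (k w)) c"
  by (induction c) (auto simp: lin_bind_def lin_cmap split: prod.splits)

lemma lin_scale: "lin (\<lambda>w. a *\<^sub>C f w) c = a *\<^sub>C lin f c"
  by (induction c) (auto simp: scaleC_add_right scaleC_scaleC mult.commute)

lemma lin_plus: "lin (\<lambda>w. f w + g w) c = lin f c + lin g c"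
  by (induction c) (auto simp: scaleC_add_right)

lemma lin_zero [simp]: "lin (\<lambda>w. 0) c = 0"
  by (induction c) auto

lemma lin_clinear:
  assumes "\<And>x y. h (x + y) = h x + h y" "\<And>c x. h (c *\<^sub>C x) = c *\<^sub>C h x" "h 0 = 0"
  shows "h (lin f c) = lin (\<lambda>w. h (f w)) c"
  by (induction c) (auto simp: assms)

lemma bounded_clinear_lin: "bounded_clinear h \<Longrightarrow> h (lin f c) = lin (\<lambda>w. h (f w)) c"
  by (rule lin_clinear) (auto simp: bcl_simps)

lemma cinner_lin_right: "cinner x (lin f c) = lin (\<lambda>w. cinner x (f w)) c"
  by (induction c) (auto simp: cinner_add_right cinner_scaleC_right)

lemma cinner_lin_left: "cinner (lin f c) y = cnj (lin (\<lambda>w. cinner y (f w)) c)"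
  by (metis cinner_commute cinner_lin_right)

lemma lin_in_cspan: "lin f c \<in> cspan (range f)"
  by (induction c)
    (auto intro!: complex_vector.span_add complex_vector.span_scale simp: complex_vector.span_base complex_vector.span_zero)

lemma cspan_range_lin: "cspan (range f) = range (lin f)"
proof
  show "cspan (range f) \<subseteq> range (lin f)"
  proof
    fix x assume "x \<in> cspan (range f)"
    then show "x \<in> range (lin f)"
    proof (induction rule: complex_vector.span_induct_alt)
      case base
      show ?case by (rule range_eqI[of _ _ "[]"]) simp
    next
      case (step c x y)
      then obtain w d where "x = f w" "y = lin f d" by auto
      then show ?case by (intro range_eqI[of _ _ "(c, w) # d"]) simp
    qed
  qed
qed (auto intro: lin_in_cspan)

text \<open>The exponent \<open>s\<close> is the identity for linear and \<^const>\<open>cnj\<close> for antilinear extensions.\<close>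

lemma extension_exists:
  fixes b :: "'w \<Rightarrow> 'h::complex_hilbert" and f :: "'w \<Rightarrow> 'k::complex_hilbert"
  assumes total: "closure (cspan (range b)) = UNIV"
    and s: "s = id \<or> s = cnj"
    and bound: "\<And>c. norm (lin f (map (\<lambda>(z, w). (s z, w)) c)) \<le> K * norm (lin b c)"
  shows "\<exists>g. bounded_linear g \<and> (\<forall>c x. g (c *\<^sub>C x) = s c *\<^sub>C g x) \<and> (\<forall>w. g (b w) = f w)
    \<and> (\<forall>x. norm (g x) \<le> K * norm x)"
proof -
  define fl where "fl c = lin f (map (\<lambda>(z, w). (s z, w)) c)" for c
  have s_add: "s (a + b) = s a + s b" and s_mult: "s (a * b) = s a * s b" and s_real: "s (of_real r) = of_real r"
    and s1: "s 1 = 1" for a b r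
    using s by auto
  have fl_app: "fl (c @ d) = fl c + fl d" for c d by (simp add: fl_def)
  have fl_sc: "fl (map (\<lambda>(z, w). (a * z, w)) c) = s a *\<^sub>C fl c" for a c
    unfolding fl_def by (induction c) (auto simp: s_mult scaleC_add_right scaleC_scaleC)
  define D where "D = range (lin b)"
  define g0 where "g0 x = fl (SOME c. lin b c = x)" for x
  have g0: "g0 (lin b c) = fl c" for c
  proof -
    define d where "d = (SOME d. lin b d = lin b c)"
    have d: "lin b d = lin b c" unfolding d_def by (rule someI) simp
    \<comment> \<open>Applied to the formal difference of two representations of the same vector,
      the bound has right-hand side 0; hence the chosen representation does not matter.\<close>
    have "norm (fl (d @ map (\<lambda>(z, w). (-1 * z, w)) c)) \<le> K * norm (lin b (d @ map (\<lambda>(z, w). (-1 * z, w)) c))"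
      unfolding fl_def by (rule bound)
    also have "\<dots> = 0" unfolding lin_append lin_cmap d by (simp add: scaleC.minus_left)
    finally have "fl d + s (-1) *\<^sub>C fl c = 0" unfolding fl_app fl_sc by simp
    moreover have "s (-1) = -1" using s_real[of "-1"] by simp
    ultimately show ?thesis unfolding g0_def d_def[symmetric] by (simp add: scaleC.minus_left)
  qed
  have D_diff: "x - y \<in> D \<and> g0 (x - y) = g0 x - g0 y" if xy: "x \<in> D" "y \<in> D" for x y
  proof -
    obtain c d where c: "x = lin b c" "y = lin b d" using xy unfolding D_def by blast
    have e: "x - y = lin b (c @ map (\<lambda>(z, w). (-1 * z, w)) d)"
      unfolding lin_append lin_cmap c by (simp add: scaleC.minus_left)
    have "g0 (x - y) = fl c + s (-1) *\<^sub>C fl d" unfolding e g0 fl_app fl_sc ..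
    moreover have "s (-1) = -1" using s_real[of "-1"] by simp
    moreover have "g0 x = fl c" "g0 y = fl d" using g0 c by simp_all
    moreover have "x - y \<in> D" unfolding e D_def by (rule rangeI)
    ultimately show ?thesis by (simp add: scaleC.minus_left)
  qed
  have g0_bound: "norm (g0 x) \<le> \<bar>K\<bar> * norm x" if x: "x \<in> D" for x
  proof -
    obtain c where c: "x = lin b c" using x by (auto simp: D_def)
    have "norm (fl c) \<le> K * norm (lin b c)" unfolding fl_def by (rule bound)
    also have "\<dots> \<le> \<bar>K\<bar> * norm (lin b c)" by (rule mult_right_mono) auto
    finally show ?thesis unfolding c g0 .
  qed
  have uc: "uniformly_continuous_on D g0"
    unfolding uniformly_continuous_on_def
  proof (intro allI impI)
    fix e :: real assume e: "e > 0"
    have "dist (g0 x') (g0 x) < e" if "x \<in> D" "x' \<in> D" "dist x' x < e / (\<bar>K\<bar> + 1)" for x x'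
    proof -
      have "dist (g0 x') (g0 x) = norm (g0 (x' - x))" using D_diff[OF that(2,1)] by (simp add: dist_norm)
      also have "\<dots> \<le> \<bar>K\<bar> * norm (x' - x)" using g0_bound D_diff[OF that(2,1)] by blast
      also have "\<dots> \<le> (\<bar>K\<bar> + 1) * norm (x' - x)" by (rule mult_right_mono) auto
      also have "\<dots> < e" using that(3) by (simp add: dist_norm pos_less_divide_eq mult.commute)
      finally show ?thesis .
    qed
    then show "\<exists>d>0. \<forall>x\<in>D. \<forall>x'\<in>D. dist x' x < d \<longrightarrow> dist (g0 x') (g0 x) < e"
      using e by (intro exI[of _ "e / (\<bar>K\<bar> + 1)"]) auto
  qed
  have clD: "closure D = UNIV" using total by (simp add: D_def cspan_range_lin)
  obtain g where g: "uniformly_continuous_on (closure D) g" "\<And>x. x \<in> D \<Longrightarrow> g0 x = g x"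
    using uniformly_continuous_on_extension_on_closure[OF uc] by metis
  have cg: "continuous_on UNIV g" using g(1) clD uniformly_continuous_imp_continuous by metis
  have gl: "g (lin b c) = fl c" for c using g(2)[of "lin b c"] g0[of c] by (auto simp: D_def)
  have dense: "P x" if "closed {x. P x}" "\<And>c. P (lin b c)" for P x
  proof -
    have "closure D \<subseteq> {x. P x}" by (rule closure_minimal) (use that D_def in auto)
    then show ?thesis using clD by auto
  qed
  have "continuous_on UNIV (\<lambda>x. g (F x))" if "continuous_on UNIV F" for F :: "'h \<Rightarrow> 'h"
    using continuous_on_compose2[OF cg that] by auto
  note cgI = this
  have add: "g (x + y) = g x + g y" for x y
  proof -
    have "g (x + lin b d) = g x + g (lin b d)" for x d
    proof (rule dense[where P = "\<lambda>x. g (x + lin b d) = g x + g (lin b d)"])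
      show "closed {x. g (x + lin b d) = g x + g (lin b d)}"
        by (intro closed_Collect_eq continuous_on_add continuous_on_const cg cgI continuous_on_id)
      show "g (lin b c + lin b d) = g (lin b c) + g (lin b d)" for c
        unfolding lin_append[symmetric] gl fl_app ..
    qed
    note step = this
    show ?thesis
    proof (rule dense[where P = "\<lambda>y. g (x + y) = g x + g y"])
      show "closed {y. g (x + y) = g x + g y}"
        by (intro closed_Collect_eq continuous_on_add continuous_on_const cg cgI continuous_on_id)
    qed (rule step)
  qed
  have sc: "g (a *\<^sub>C x) = s a *\<^sub>C g x" for a x
  proof (rule dense[where P = "\<lambda>x. g (a *\<^sub>C x) = s a *\<^sub>C g x"])
    show "closed {x. g (a *\<^sub>C x) = s a *\<^sub>C g x}"
      by (intro closed_Collect_eq cgI scaleC.continuous_on continuous_on_const cg continuous_on_id)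
    show "g (a *\<^sub>C lin b c) = s a *\<^sub>C g (lin b c)" for c
      unfolding lin_cmap[symmetric] gl fl_sc ..
  qed
  have bd: "norm (g x) \<le> K * norm x" for x
  proof (rule dense[where P = "\<lambda>x. norm (g x) \<le> K * norm x"])
    show "closed {x. norm (g x) \<le> K * norm x}"
      by (intro closed_Collect_le continuous_intros cg)
    show "norm (g (lin b c)) \<le> K * norm (lin b c)" for c
      unfolding gl fl_def by (rule bound)
  qed
  have "bounded_linear g"
    by (rule bounded_linear_intro[where K = K])
      (use add sc[of "of_real _"] s_real bd in \<open>auto simp: scaleC_of_real mult.commute\<close>)
  moreover have "g (b w) = f w" for w
    using gl[of "[(1, w)]"] by (simp add: fl_def s1)
  ultimately show ?thesis using sc bd by blast
qed


lemma lin_cong: "(\<And>z u. (z, u) \<in> set c \<Longrightarrow> f u = g u) \<Longrightarrow> lin f c = lin g c"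
  by (induction c) force+

lemma cinner_lin_cong:
  assumes "\<And>v w. cinner (f v) (g w) = cinner (f' v) (g' w)"
  shows "cinner (lin f c) (lin g d) = cinner (lin f' c) (lin g' d)"
proof -
  have 1: "cinner (f v) (lin g d) = cinner (f' v) (lin g' d)" for v
    unfolding cinner_lin_right assms ..
  show ?thesis
    by (induction c) (auto simp: cinner_add_left cinner_scaleC_left 1)
qed

lemma cinner_lin_cnj:
  assumes "\<And>v w. cinner (f v) (f' w) = cnj (cinner (g v) (g' w))"
  shows "cinner (lin f (map (\<lambda>(z, w). (cnj z, w)) c)) (lin f' (map (\<lambda>(z, w). (cnj z, w)) d))
    = cnj (cinner (lin g c) (lin g' d))"
proof -
  have 1: "cinner (f v) (lin f' (map (\<lambda>(z, w). (cnj z, w)) d)) = cnj (cinner (g v) (lin g' d))" for v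
    by (induction d) (auto simp: cinner_add_right cinner_scaleC_right assms)
  show ?thesis
    by (induction c) (auto simp: cinner_add_left cinner_scaleC_left 1)
qed

lemma norm_eq_of_cinner:
  "cinner x x = cinner y y \<Longrightarrow> norm x = norm y" for x :: "'h::complex_hilbert" and y :: "'k::complex_hilbert"
  by (metis cinner_self norm_ge_zero of_real_eq_iff power2_eq_iff_nonneg)

lemma pythagoras:
  fixes f :: "'i \<Rightarrow> 'h::complex_hilbert"
  assumes "finite S" "\<And>i j. i \<in> S \<Longrightarrow> j \<in> S \<Longrightarrow> i \<noteq> j \<Longrightarrow> cinner (f i) (f j) = 0"
  shows "(norm (sum f S))\<^sup>2 = (\<Sum>i\<in>S. (norm (f i))\<^sup>2)"
  using assms
proof (induction S rule: finite_induct)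
  case (insert i S)
  have "cinner (f i) (sum f S) = 0"
    unfolding cinner.sum_right using insert by (intro sum.neutral) auto
  then show ?case using insert by (simp add: norm_add_sq)
qed simp

lemma lin_split:
  assumes "finite S" "\<And>z w. (z, w) \<in> set c \<Longrightarrow> key w \<in> S"
  shows "lin f c = (\<Sum>\<kappa>\<in>S. lin f (filter (\<lambda>(z, w). key w = \<kappa>) c))"
  using assms(2)
proof (induction c)
  case (Cons p c)
  obtain z w where p: "p = (z, w)" by force
  have "(\<Sum>\<kappa>\<in>S. lin f (filter (\<lambda>(z, w). key w = \<kappa>) (p # c)))
     = (\<Sum>\<kappa>\<in>S. (if key w = \<kappa> then z *\<^sub>C f w else 0) + lin f (filter (\<lambda>(z, w). key w = \<kappa>) c))"
    by (intro sum.cong) (auto simp: p)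
  also have "\<dots> = z *\<^sub>C f w + lin f c"
  proof -
    have "key w \<in> S" using Cons.prems[of z w] by (simp add: p)
    moreover have "lin f c = (\<Sum>\<kappa>\<in>S. lin f (filter (\<lambda>(z, w). key w = \<kappa>) c))"
      by (rule Cons.IH) (use Cons.prems in auto)
    ultimately show ?thesis using assms(1) by (simp add: sum.distrib)
  qed
  finally show ?case by (simp add: p)
qed simp


section \<open>The q-inner product of words\<close>

text \<open>The q-annihilation of an orthonormal letter: deleting an occurrence costs one factor
  \<open>q\<close> for every letter to its left.\<close>

primrec ann :: "real \<Rightarrow> 'a \<Rightarrow> 'a list \<Rightarrow> (complex \<times> 'a list) list" where
  "ann q x [] = []"
| "ann q x (c # w) = (if x = c then [(1, w)] else []) @ map (\<lambda>(z, u). (of_real q * z, c # u)) (ann q x w)"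

text \<open>The right-hand counterpart, where the price counts the letters to the right of the
  deleted one.\<close>

primrec rann :: "real \<Rightarrow> 'a \<Rightarrow> 'a list \<Rightarrow> (complex \<times> 'a list) list" where
  "rann q x [] = []"
| "rann q x (c # w) = map (\<lambda>(z, u). (z, c # u)) (rann q x w) @ (if x = c then [(of_real (q ^ length w), w)] else [])"

text \<open>The permutation sum \<open>q_inner\<close> for orthonormal letters, expanded along the
  image of the first position; \<open>q_inner_orthonormal\<close> proves the agreement.\<close>

primrec qi :: "real \<Rightarrow> 'a list \<Rightarrow> 'a list \<Rightarrow> complex" where
  "qi q [] w = (if w = [] then 1 else 0)"
| "qi q (x # v) w = lin (qi q v) (ann q x w)"

lemma lin_ann_Cons:
  "lin F (ann q x (c # w)) = (if x = c then F w else 0) + of_real q *\<^sub>C lin (\<lambda>u. F (c # u)) (ann q x w)"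
  by (simp add: lin_map)

lemma lin_rann_Cons:
  "lin F (rann q x (c # w)) = lin (\<lambda>u. F (c # u)) (rann q x w) + (if x = c then of_real (q ^ length w) *\<^sub>C F w else 0)"
  by (simp add: lin_map')

declare ann.simps(2) [simp del] rann.simps(2) [simp del]

lemma set_ann_Cons:
  "(z, u) \<in> set (ann q x (c # w)) \<Longrightarrow> (x = c \<and> u = w) \<or> (\<exists>u' z'. u = c # u' \<and> (z', u') \<in> set (ann q x w))"
  by (auto simp: ann.simps(2) split: if_splits)

lemma mset_ann: "(z, u) \<in> set (ann q x w) \<Longrightarrow> mset w = add_mset x (mset u)"
proof (induction w arbitrary: z u)
  case (Cons c w)
  from set_ann_Cons[OF Cons.prems] Cons.IH show ?case by auto
qed simp

lemma length_ann: "(z, u) \<in> set (ann q x w) \<Longrightarrow> length w = Suc (length u)"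
  by (drule mset_ann) (metis size_mset size_add_mset)

text \<open>Two different positions are deleted. If the one deleted from the left lies further
  right, whichever deletion comes second has one letter less to cross, so both orders cost the same
  power of q.\<close>

lemma lin_ann_rann_commute:
  "lin (\<lambda>u. lin F (rann q x u)) (ann q y w) = lin (\<lambda>u. lin F (ann q y u)) (rann q x w)"
proof (induction w arbitrary: F)
  case (Cons c w)
  \<comment> \<open>The annihilated words are one letter shorter than \<open>w\<close>; the outer
    \<open>q\<close> makes up for the missing power.\<close>
  have len: "of_real q *\<^sub>C lin (\<lambda>u. if x = c then of_real (q ^ length u) *\<^sub>C F u else 0) (ann q y w)
    = (if x = c then of_real (q ^ length w) *\<^sub>C lin F (ann q y w) else 0)"
  proof (cases "x = c")
    case True
    have "lin (\<lambda>u. of_real q *\<^sub>C (of_real (q ^ length u) *\<^sub>C F u)) (ann q y w)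
       = lin (\<lambda>u. of_real (q ^ length w) *\<^sub>C F u) (ann q y w)"
      by (rule lin_cong) (auto dest: length_ann simp: scaleC_scaleC)
    then have "of_real q *\<^sub>C lin (\<lambda>u. of_real (q ^ length u) *\<^sub>C F u) (ann q y w)
       = of_real (q ^ length w) *\<^sub>C lin F (ann q y w)"
      unfolding lin_scale .
    then show ?thesis using True by simp
  qed simp
  have 1: "lin (\<lambda>u. lin F (rann q x (c # u))) (ann q y w) = lin (\<lambda>u. lin (\<lambda>u. F (c # u)) (ann q y u)) (rann q x w)
      + lin (\<lambda>u. if x = c then of_real (q ^ length u) *\<^sub>C F u else 0) (ann q y w)"
    unfolding lin_rann_Cons lin_plus Cons.IH ..
  have 2: "lin (\<lambda>u. lin F (ann q y (c # u))) (rann q x w) = lin (\<lambda>u. if y = c then F u else 0) (rann q x w)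
      + of_real q *\<^sub>C lin (\<lambda>u. lin (\<lambda>u. F (c # u)) (ann q y u)) (rann q x w)"
    unfolding lin_ann_Cons lin_plus lin_scale ..
  have 3: "lin (\<lambda>u. if y = c then F u else 0) (rann q x w) = (if y = c then lin F (rann q x w) else 0)"
    by simp
  show ?case
    unfolding lin_ann_Cons[of _ _ _ c w] lin_rann_Cons[of _ _ _ c w] 1 2 3 scaleC_add_right len
    by (simp only: add_ac)
qed simp

text \<open>Expansion along the last letter instead of the first, possible because left and right
  annihilation commute. It yields the invariance of the form under reversal, and with it the passage
  between left and right actions.\<close>

lemma qi_snoc: "qi q (v @ [x]) w = lin (qi q v) (rann q x w)"
proof (induction v arbitrary: w)
  case Nil
  have "lin (qi q []) (ann q x w) = (if w = [x] then 1 else 0)"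
    by (cases w) (auto simp: lin_ann_Cons)
  moreover have "lin (qi q []) (rann q x w) = (if w = [x] then 1 else 0)"
    by (cases w) (auto simp: lin_rann_Cons)
  ultimately show ?case by (simp only: append_Nil qi.simps(2))
next
  case (Cons y v)
  have "qi q (v @ [x]) = (\<lambda>w. lin (qi q v) (rann q x w))" using Cons.IH by blast
  then show ?case by (simp add: lin_ann_rann_commute)
qed

lemma lin_ann_snoc:
  "lin F (ann q x (w @ [c])) = lin (\<lambda>u. F (u @ [c])) (ann q x w) + (if x = c then of_real (q ^ length w) *\<^sub>C F w else 0)"
  by (induction w arbitrary: F) (auto simp: lin_ann_Cons scaleC_add_right scaleC_scaleC)

lemma lin_ann_rev: "lin F (ann q x (rev w)) = lin (\<lambda>u. F (rev u)) (rann q x w)"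
  by (induction w arbitrary: F) (auto simp: lin_ann_snoc lin_rann_Cons)

lemma lin_rann_rev: "lin F (rann q x (rev w)) = lin (\<lambda>u. F (rev u)) (ann q x w)"
  using lin_ann_rev[of "\<lambda>u. F (rev u)" q x "rev w"] by simp

lemma qi_rev: "qi q (rev v) (rev w) = qi q v w"
  by (induction v arbitrary: w) (auto simp: qi_snoc lin_rann_rev)

lemma lin_ann_map: "inj f \<Longrightarrow> lin F (ann q (f x) (map f w)) = lin (\<lambda>u. F (map f u)) (ann q x w)"
  by (induction w arbitrary: F) (auto simp: lin_ann_Cons inj_eq)

lemma qi_map: "inj f \<Longrightarrow> qi q (map f v) (map f w) = qi q v w"
  by (induction v arbitrary: w) (auto simp: lin_ann_map)

lemma cnj_lin_ann: "cnj (lin F (ann q x w)) = lin (\<lambda>u. cnj (F u)) (ann q x w)"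
  by (induction w arbitrary: F) (auto simp: lin_ann_Cons)

lemma cnj_qi [simp]: "cnj (qi q v w) = qi q v w"
  by (induction v arbitrary: w) (auto simp: cnj_lin_ann)

lemma qi_mset: "mset v \<noteq> mset w \<Longrightarrow> qi q v w = 0"
proof (induction v arbitrary: w)
  case (Cons x v)
  have "lin (qi q v) (ann q x w) = lin (\<lambda>_. 0) (ann q x w)"
    by (rule lin_cong) (use Cons mset_ann in fastforce)
  then show ?case by simp
qed simp

text \<open>The bidegree of a word in the two letters. Words of different bidegree are orthogonal,
  and the modular operator will be a function of it.\<close>

definition key :: "bool list \<Rightarrow> nat \<times> nat" where
  "key w = (count_list w True, count_list w False)"

lemma key_Nil [simp]: "key [] = (0, 0)"
  and key_Cons: "key (x # w) = (if x then (Suc (fst (key w)), snd (key w)) else (fst (key w), Suc (snd (key w))))"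
  by (auto simp: key_def)

lemma key_eq_mset: "mset v = mset w \<Longrightarrow> key v = key w"
  by (simp add: key_def flip: count_mset)

lemma qi_key: "key v \<noteq> key w \<Longrightarrow> qi q v w = 0"
  by (rule qi_mset) (use key_eq_mset in blast)

lemma key_length: "fst (key w) + snd (key w) = length w"
  by (induction w) (auto simp: key_Cons)

abbreviation flip :: "bool list \<Rightarrow> bool list" where
  "flip w \<equiv> rev (map Not w)"

lemma flip_flip [simp]: "flip (flip w) = w"
  by (simp add: rev_map comp_def)

lemma key_flip [simp]: "key (flip w) = prod.swap (key w)"
proof -
  have "count_list (map Not w) x = count_list w (\<not> x)" for x by (induction w) auto
  then show ?thesis by (simp add: key_def)
qed

lemma qi_flip: "qi q (flip v) (flip w) = qi q v w"
  by (simp add: qi_rev qi_map inj_def)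


section \<open>The q-Fock space over two orthonormal letters\<close>

text \<open>\<open>True\<close> stands for the unit vector f and \<open>False\<close> for e-bar. The
  words are total but in general not orthogonal: \<open>qi\<close> is their Gram matrix.\<close>

locale q_fock =
  fixes q :: real and B :: "bool list \<Rightarrow> 'h::complex_hilbert"
  assumes q1: "- 1 < q" and q2: "q < 1"
    and cinner_B: "cinner (B v) (B w) = qi q v w"
    and total: "closure (cspan (range B)) = UNIV"
begin

lemma dense_induct:
  assumes "closed {x. P x}" "\<And>c. P (lin B c)"
  shows "P x"
proof -
  have "closure (cspan (range B)) \<subseteq> {x. P x}"
    by (rule closure_minimal) (use assms in \<open>auto simp: cspan_range_lin\<close>)
  then show ?thesis using total by auto
qed

lemma ext_B:
  assumes "\<And>w. cinner (B w) a = cinner (B w) b"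
  shows "a = b"
proof (rule cinner_ext)
  fix z
  show "cinner z a = cinner z b"
  proof (rule dense_induct[where P = "\<lambda>z. cinner z a = cinner z b"])
    show "closed {z. cinner z a = cinner z b}"
      by (intro closed_Collect_eq cinner.continuous_on continuous_on_id continuous_on_const)
    show "cinner (lin B c) a = cinner (lin B c) b" for c
      by (simp add: cinner_lin_left) (metis (no_types, lifting) assms cinner_commute lin_cong)
  qed
qed

lemma bcl_eqI:
  assumes "bounded_clinear f" "bounded_clinear g" "\<And>w. f (B w) = g (B w)"
  shows "f = g"
proof
  fix x
  show "f x = g x"
  proof (rule dense_induct[where P = "\<lambda>x. f x = g x"])
    show "closed {x. f x = g x}"
      by (intro closed_Collect_eq linear_continuous_on bounded_clinear_bl assms)
    show "f (lin B c) = g (lin B c)" for c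
      using assms by (simp add: bounded_clinear_lin)
  qed
qed

lemma bcl_eqI': 
  "bounded_clinear f \<Longrightarrow> bounded_clinear g \<Longrightarrow> (\<And>w. f (B w) = g (B w)) \<Longrightarrow> f x = g x"
  using bcl_eqI by metis

lemma mirror: "q_fock q (\<lambda>w. B (flip w))"
proof
  have "B w \<in> range (\<lambda>w. B (flip w))" for w
    by (rule range_eqI[of _ _ "flip w"]) (simp only: flip_flip)
  then have "range (\<lambda>w. B (flip w)) = range B" by blast
  then show "closure (cspan (range (\<lambda>w. B (flip w)))) = UNIV" using total by simp
qed (auto simp: q1 q2 cinner_B qi_flip)

section \<open>Boundedness of the creation operators\<close>

lemma cre_adjoint:
  "cinner (lin (\<lambda>w. B (x # w)) c) (lin B d) = cinner (lin B c) (lin (\<lambda>w. lin B (ann q x w)) d)"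
  by (rule cinner_lin_cong) (simp add: cinner_B cinner_lin_right)

text \<open>Quadratic form version of the relation that annihilation after creation is 1 plus q
  times creation after annihilation. It is stated on formal combinations, since creation is not yet
  known to be a bounded operator.\<close>

lemma norm_cre:
  "(norm (lin (\<lambda>w. B (x # w)) c))\<^sup>2 = (norm (lin B c))\<^sup>2 + q * (norm (lin (\<lambda>w. lin B (ann q x w)) c))\<^sup>2"
proof -
  let ?a = "lin_bind c (ann q x)"
  have "cinner (lin (\<lambda>w. B (x # w)) c) (lin (\<lambda>w. B (x # w)) c)
      = cinner (lin B c) (lin (\<lambda>w. lin B (ann q x (x # w))) c)"
    by (rule cinner_lin_cong) (simp add: cinner_B cinner_lin_right)
  also have "\<dots> = cinner (lin B c) (lin B c) + of_real q * cinner (lin B c) (lin (\<lambda>w. B (x # w)) ?a)"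
    by (simp add: lin_ann_Cons lin_plus lin_scale cinner_add_right cinner_scaleC_right)
  also have "cinner (lin B c) (lin (\<lambda>w. B (x # w)) ?a) = cinner (lin (\<lambda>w. lin B (ann q x w)) c) (lin B ?a)"
    by (metis cinner_commute cre_adjoint)
  also have "lin B ?a = lin (\<lambda>w. lin B (ann q x w)) c" by simp
  finally have "complex_of_real ((norm (lin (\<lambda>w. B (x # w)) c))\<^sup>2)
      = complex_of_real ((norm (lin B c))\<^sup>2 + q * (norm (lin (\<lambda>w. lin B (ann q x w)) c))\<^sup>2)"
    by (simp add: cinner_self)
  then show ?thesis using of_real_eq_iff by blast
qed

text \<open>Annihilation shortens words, so the bound for shorter words controls creation on them by
  \<open>norm_cre\<close>, and passing to the adjoint gives annihilation one length higher. The
  constant 1/(1 - q) is the fixed point of this loop.\<close>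

lemma norm_ann_le:
  assumes "0 < q" "\<And>z w. (z, w) \<in> set c \<Longrightarrow> length w < N"
  shows "(norm (lin (\<lambda>w. lin B (ann q x w)) c))\<^sup>2 \<le> (norm (lin B c))\<^sup>2 / (1 - q)"
  using assms(2)
proof (induction N arbitrary: c)
  case 0
  then have "c = []" by (cases c) auto
  then show ?case by simp
next
  case (Suc N)
  define a where "a = lin_bind c (ann q x)"
  define A where "A = lin (\<lambda>w. lin B (ann q x w)) c"
  have A: "lin B a = A" by (simp add: a_def A_def)
  have "(norm (lin (\<lambda>w. lin B (ann q x w)) a))\<^sup>2 \<le> (norm (lin B a))\<^sup>2 / (1 - q)"
  proof (rule Suc.IH)
    fix z w assume "(z, w) \<in> set a"
    then obtain z' w' z'' where "(z', w') \<in> set c" "(z'', w) \<in> set (ann q x w')"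
      by (auto simp: a_def lin_bind_def)
    then show "length w < N" using Suc.prems length_ann by fastforce
  qed
  then have "(norm (lin (\<lambda>w. B (x # w)) a))\<^sup>2 \<le> (norm A)\<^sup>2 + q * ((norm A)\<^sup>2 / (1 - q))"
    using norm_cre[of x a] mult_left_mono[of _ _ q] assms(1) unfolding A by fastforce
  also have "\<dots> = (norm A)\<^sup>2 / (1 - q)" using q2 by (simp add: field_simps)
  finally have C: "norm (lin (\<lambda>w. B (x # w)) a) \<le> norm A / sqrt (1 - q)"
    using q2 by (metis real_le_rsqrt real_sqrt_divide real_sqrt_abs abs_norm_cancel)
  have "(norm A)\<^sup>2 = Re (cinner A (lin B a))" by (simp add: A cinner_self)
  also have "cinner A (lin B a) = cinner (lin B c) (lin (\<lambda>w. B (x # w)) a)"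
    unfolding A_def by (metis cinner_commute cre_adjoint)
  also have "Re \<dots> \<le> norm (lin B c) * (norm A / sqrt (1 - q))"
    using C complex_Re_le_cmod cinner_cauchy_schwarz by (meson mult_left_mono norm_ge_zero order.trans)
  finally have "norm A * norm A \<le> (norm (lin B c) / sqrt (1 - q)) * norm A"
    by (simp add: power2_eq_square mult_ac)
  then have "norm A \<le> norm (lin B c) / sqrt (1 - q)"
    using q2 mult_right_le_imp_le[of "norm A" "norm A" "norm (lin B c) / sqrt (1 - q)"] by (cases "norm A = 0") auto
  then have "(norm A)\<^sup>2 \<le> (norm (lin B c) / sqrt (1 - q))\<^sup>2" by (simp add: power_mono)
  then show ?case using q2 by (simp add: A_def power_divide)
qed

text \<open>A crude constant, sufficient to extend creation to the whole space; the growth of its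
  powers is determined in \<open>cr_pow_upper\<close>.\<close>

lemma norm_cre_le: "norm (lin (\<lambda>w. B (x # w)) c) \<le> (1 + 1 / (1 - q)) * norm (lin B c)"
proof -
  let ?A = "lin (\<lambda>w. lin B (ann q x w)) c"
  have "(norm (lin (\<lambda>w. B (x # w)) c))\<^sup>2 \<le> (1 + 1 / (1 - q)) * (norm (lin B c))\<^sup>2"
  proof (cases "q > 0")
    case True
    obtain N where N: "\<And>z w. (z, w) \<in> set c \<Longrightarrow> length w < N"
    proof
      show "length w < Suc (Max (length ` snd ` set c))" if "(z, w) \<in> set c" for z w
        using that by (intro le_imp_less_Suc Max_ge) force+
    qed
    have "q * (norm ?A)\<^sup>2 \<le> 1 * ((norm (lin B c))\<^sup>2 / (1 - q))"
      using norm_ann_le[where x = x and c = c, OF True N] True q2 by (intro mult_mono) auto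
    then show ?thesis using norm_cre[of x c] by (simp add: field_simps)
  next
    case False
    have "0 \<le> 1 / (1 - q) * (norm (lin B c))\<^sup>2" using q2 by simp
    moreover have "q * (norm ?A)\<^sup>2 \<le> 0" using False by (simp add: mult_nonpos_nonneg)
    ultimately show ?thesis unfolding norm_cre distrib_right by linarith
  qed
  also have "\<dots> \<le> (1 + 1 / (1 - q)) * (1 + 1 / (1 - q)) * (norm (lin B c))\<^sup>2"
    using q2 mult_right_mono[of 1 "1 + 1 / (1 - q)" "1 + 1 / (1 - q)"] by (intro mult_right_mono) auto
  also have "\<dots> = ((1 + 1 / (1 - q)) * norm (lin B c))\<^sup>2" by (simp add: power2_eq_square mult_ac)
  finally show ?thesis by (rule power2_le_imp_le) (use q2 in simp)
qed

definition cr :: "bool \<Rightarrow> 'h \<Rightarrow> 'h" where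
  "cr x = (SOME g. bounded_clinear g \<and> (\<forall>w. g (B w) = B (x # w)))"

lemma cr: "bounded_clinear (cr x) \<and> (\<forall>w. cr x (B w) = B (x # w))"
proof -
  have "\<exists>g. bounded_linear g \<and> (\<forall>c x. g (c *\<^sub>C x) = id c *\<^sub>C g x) \<and> (\<forall>w. g (B w) = B (x # w))
    \<and> (\<forall>y. norm (g y) \<le> (1 + 1 / (1 - q)) * norm y)"
    by (rule extension_exists[OF total]) (auto simp: norm_cre_le[of x, simplified] case_prod_unfold)
  then have "\<exists>g. bounded_clinear g \<and> (\<forall>w. g (B w) = B (x # w))"
    by (auto intro: bounded_clinearI)
  then show ?thesis unfolding cr_def by (rule someI_ex)
qed

lemma bcl_cr [intro, simp]: "bounded_clinear (cr x)" and cr_B [simp]: "cr x (B w) = B (x # w)"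
  using cr by auto

definition an :: "bool \<Rightarrow> 'h \<Rightarrow> 'h" where
  "an x = cadjoint (cr x)"

lemma bcl_an [intro, simp]: "bounded_clinear (an x)"
  unfolding an_def by auto

lemma cinner_an: "cinner (an x v) w = cinner v (cr x w)"
  and cinner_cr: "cinner (cr x v) w = cinner v (an x w)"
  by (simp_all add: an_def cinner_cadjoint cinner_cadjoint')

lemma an_B: "an x (B w) = lin B (ann q x w)"
  by (rule ext_B) (simp add: cinner_cr[symmetric] cinner_B cinner_lin_right)

lemma an_cr: "an x (cr y v) = (if x = y then v else 0) + q *\<^sub>R cr y (an x v)"
  by (rule bcl_eqI'[where f = "\<lambda>v. an x (cr y v)" and g = "\<lambda>v. (if x = y then v else 0) + q *\<^sub>R cr y (an x v)"];
      cases "x = y")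
    (auto simp: an_B lin_ann_Cons bounded_clinear_lin scaleC_of_real intro!: bounded_clinear_plus bounded_clinear_rmult)

lemma an_vac [simp]: "an x (B []) = 0"
  by (simp add: an_B)

lemma cr_pow_B: "(cr x ^^ n) (B w) = B (replicate n x @ w)"
  by (induction n) auto

text \<open>Parts of different bidegree are orthogonal, so a multiplier depending on the bidegree
  only is bounded by its supremum.\<close>

lemma dg_bound:
  assumes "\<And>\<kappa>. cmod (g \<kappa>) \<le> K"
  shows "norm (lin (\<lambda>w. g (key w) *\<^sub>C B w) c) \<le> K * norm (lin B c)"
proof -
  define S where "S = key ` snd ` set c"
  define P where "P \<kappa> = filter (\<lambda>(z, w). key w = \<kappa>) c" for \<kappa>
  have S: "finite S" "\<And>z w. (z, w) \<in> set c \<Longrightarrow> key w \<in> S" unfolding S_def by force+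
  have orth: "cinner (lin B (P \<kappa>)) (lin B (P \<kappa>')) = 0" if "\<kappa> \<noteq> \<kappa>'" for \<kappa> \<kappa>'
  proof -
    have "cinner (lin B (P \<kappa>)) (B w) = 0" if "key w = \<kappa>'" for w
    proof -
      have "lin (\<lambda>v. cinner (B w) (B v)) (P \<kappa>) = lin (\<lambda>_. 0) (P \<kappa>)"
        by (rule lin_cong) (use that \<open>\<kappa> \<noteq> \<kappa>'\<close> in \<open>auto simp: P_def cinner_B intro!: qi_key\<close>)
      then show ?thesis by (simp add: cinner_lin_left)
    qed
    then have "lin (\<lambda>w. cinner (lin B (P \<kappa>)) (B w)) (P \<kappa>') = lin (\<lambda>_. 0) (P \<kappa>')"
      by (intro lin_cong) (auto simp: P_def)
    then show ?thesis by (simp add: cinner_lin_right)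
  qed
  have 1: "lin B c = (\<Sum>\<kappa>\<in>S. lin B (P \<kappa>))"
    unfolding P_def by (rule lin_split) (use S in auto)
  have "lin (\<lambda>w. g (key w) *\<^sub>C B w) (P \<kappa>) = g \<kappa> *\<^sub>C lin B (P \<kappa>)" for \<kappa>
    unfolding lin_scale[symmetric] by (rule lin_cong) (auto simp: P_def)
  then have 2: "lin (\<lambda>w. g (key w) *\<^sub>C B w) c = (\<Sum>\<kappa>\<in>S. g \<kappa> *\<^sub>C lin B (P \<kappa>))"
    using lin_split[of S c key "\<lambda>w. g (key w) *\<^sub>C B w"] S by (simp add: P_def)
  have K: "0 \<le> K" using assms[of undefined] norm_ge_zero order.trans by blast
  have "(norm (lin (\<lambda>w. g (key w) *\<^sub>C B w) c))\<^sup>2 = (\<Sum>\<kappa>\<in>S. (norm (g \<kappa> *\<^sub>C lin B (P \<kappa>)))\<^sup>2)"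
    unfolding 2 by (rule pythagoras) (auto simp: S cinner_scaleC_left cinner_scaleC_right orth)
  also have "\<dots> \<le> (\<Sum>\<kappa>\<in>S. K\<^sup>2 * (norm (lin B (P \<kappa>)))\<^sup>2)"
    using assms by (intro sum_mono) (auto simp: power_mult_distrib intro!: mult_right_mono power_mono)
  also have "\<dots> = K\<^sup>2 * (norm (lin B c))\<^sup>2"
    unfolding 1 sum_distrib_left[symmetric] by (subst pythagoras) (auto simp: S orth)
  finally have "(norm (lin (\<lambda>w. g (key w) *\<^sub>C B w) c))\<^sup>2 \<le> (K * norm (lin B c))\<^sup>2"
    by (simp add: power_mult_distrib)
  then show ?thesis by (rule power2_le_imp_le) (simp add: K)
qed

text \<open>Functions of the two letter-number operators: powers of q in the word length, spectral
  projections, modular unitaries and truncations are all of this form. The norm clause makes every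
  pointwise bound of \<open>g\<close> available, not just one fixed bound.\<close>

definition dg :: "(nat \<times> nat \<Rightarrow> complex) \<Rightarrow> 'h \<Rightarrow> 'h" where
  "dg g = (SOME h. bounded_clinear h \<and> (\<forall>w. h (B w) = g (key w) *\<^sub>C B w) \<and>
     (\<forall>K. (\<forall>\<kappa>. cmod (g \<kappa>) \<le> K) \<longrightarrow> (\<forall>x. norm (h x) \<le> K * norm x)))"

lemma dg:
  assumes "\<And>\<kappa>. cmod (g \<kappa>) \<le> K"
  shows "bounded_clinear (dg g) \<and> (\<forall>w. dg g (B w) = g (key w) *\<^sub>C B w) \<and>
     (\<forall>K. (\<forall>\<kappa>. cmod (g \<kappa>) \<le> K) \<longrightarrow> (\<forall>x. norm (dg g x) \<le> K * norm x))"
proof -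
  have ex: "\<exists>h. bounded_linear h \<and> (\<forall>c x. h (c *\<^sub>C x) = id c *\<^sub>C h x) \<and> (\<forall>w. h (B w) = g (key w) *\<^sub>C B w)
    \<and> (\<forall>y. norm (h y) \<le> K * norm y)" if "\<And>\<kappa>. cmod (g \<kappa>) \<le> K" for K
    by (rule extension_exists[OF total]) (use dg_bound[OF that] in \<open>auto simp: case_prod_unfold\<close>)
  obtain h where h: "bounded_clinear h" "\<forall>w. h (B w) = g (key w) *\<^sub>C B w"
    using ex[OF assms] by (auto intro: bounded_clinearI)
  have "norm (h x) \<le> K * norm x" if K: "\<forall>\<kappa>. cmod (g \<kappa>) \<le> K" for K x
  proof -
    obtain h' where h': "bounded_clinear h'" "\<forall>w. h' (B w) = g (key w) *\<^sub>C B w" "\<forall>y. norm (h' y) \<le> K * norm y"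
      using ex[of K] K unfolding id_apply bounded_clinear_def by blast
    then have "h = h'" using h by (intro bcl_eqI) auto
    then show ?thesis using h' by simp
  qed
  then have "\<exists>h. bounded_clinear h \<and> (\<forall>w. h (B w) = g (key w) *\<^sub>C B w) \<and>
     (\<forall>K. (\<forall>\<kappa>. cmod (g \<kappa>) \<le> K) \<longrightarrow> (\<forall>x. norm (h x) \<le> K * norm x))"
    using h by blast
  then show ?thesis unfolding dg_def by (rule someI_ex)
qed

definition bdd :: "(nat \<times> nat \<Rightarrow> complex) \<Rightarrow> bool" where
  "bdd g \<longleftrightarrow> (\<exists>K. \<forall>\<kappa>. cmod (g \<kappa>) \<le> K)"

lemma bddI: "(\<And>\<kappa>. cmod (g \<kappa>) \<le> K) \<Longrightarrow> bdd g"
  by (auto simp: bdd_def)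

lemma bcl_dg [intro]: "bdd g \<Longrightarrow> bounded_clinear (dg g)"
  and dg_B: "bdd g \<Longrightarrow> dg g (B w) = g (key w) *\<^sub>C B w"
  using dg by (auto simp: bdd_def)

lemma norm_dg: "(\<And>\<kappa>. cmod (g \<kappa>) \<le> K) \<Longrightarrow> norm (dg g x) \<le> K * norm x"
  using dg by blast

lemma cinner_dg: 
  assumes "bdd g"
  shows "cinner (dg g x) y = cinner x (dg (\<lambda>\<kappa>. cnj (g \<kappa>)) y)"
proof -
  have b: "bdd (\<lambda>\<kappa>. cnj (g \<kappa>))" using assms by (simp add: bdd_def)
  have "cadjoint (dg (\<lambda>\<kappa>. cnj (g \<kappa>))) = dg g"
  proof (rule bcl_eqI)
    show "cadjoint (dg (\<lambda>\<kappa>. cnj (g \<kappa>))) (B w) = dg g (B w)" for w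
    proof (rule ext_B)
      fix v
      show "cinner (B v) (cadjoint (dg (\<lambda>\<kappa>. cnj (g \<kappa>))) (B w)) = cinner (B v) (dg g (B w))"
        by (cases "key v = key w")
          (auto simp: cinner_cadjoint' bcl_dg b assms dg_B cinner_scaleC_left cinner_scaleC_right cinner_B qi_key)
    qed
  qed (use assms b in auto)
  then show ?thesis using cinner_cadjoint[OF bcl_dg[OF b]] by metis
qed

lemma dg_1 [simp]: "dg (\<lambda>_. 1) x = x"
  by (rule bcl_eqI'[where f = "dg (\<lambda>_. 1)" and g = "\<lambda>x. x"]) (auto simp: bddI[of _ 1] dg_B)

section \<open>The antiunitary mirror map\<close>

lemma conj_exists:
  "\<exists>J. bounded_linear J \<and> (\<forall>c x. J (c *\<^sub>C x) = cnj c *\<^sub>C J x) \<and> (\<forall>w. J (B w) = B (flip w))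
    \<and> (\<forall>x. norm (J x) \<le> 1 * norm x)"
proof (rule extension_exists[OF total])
  fix c
  have "cinner (lin (\<lambda>w. B (flip w)) (map (\<lambda>(z, w). (cnj z, w)) c)) (lin (\<lambda>w. B (flip w)) (map (\<lambda>(z, w). (cnj z, w)) c))
    = cnj (cinner (lin B c) (lin B c))"
    by (rule cinner_lin_cnj) (simp add: cinner_B qi_flip)
  then have "cinner (lin (\<lambda>w. B (flip w)) (map (\<lambda>(z, w). (cnj z, w)) c)) (lin (\<lambda>w. B (flip w)) (map (\<lambda>(z, w). (cnj z, w)) c))
    = cinner (lin B c) (lin B c)"
    by (simp add: cinner_self)
  then show "norm (lin (\<lambda>w. B (flip w)) (map (\<lambda>(z, w). (cnj z, w)) c)) \<le> 1 * norm (lin B c)"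
    using norm_eq_of_cinner by fastforce
qed simp

text \<open>This map will be the modular conjugation: the Tomita operator is this map after a
  positive diagonal operator.\<close>

lemma antilinear_mirror_exists:
  "\<exists>J. bounded_linear J \<and> (\<forall>c x. J (c *\<^sub>C x) = cnj c *\<^sub>C J x) \<and> (\<forall>w. J (B w) = B (flip w))
    \<and> (\<forall>x y. cinner (J x) (J y) = cinner y x)"
proof -
  obtain J where J: "bounded_linear J" "\<And>c x. J (c *\<^sub>C x) = cnj c *\<^sub>C J x" "\<And>w. J (B w) = B (flip w)"
    using conj_exists by blast
  have cont: "continuous_on UNIV J" using J(1) linear_continuous_on by blast
  have JB: "cinner (J x) (B (flip w)) = cinner (B w) x" for x w
  proof (rule dense_induct[where P = "\<lambda>x. cinner (J x) (B (flip w)) = cinner (B w) x"])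
    show "closed {x. cinner (J x) (B (flip w)) = cinner (B w) x}"
      by (intro closed_Collect_eq cinner.continuous_on continuous_on_id continuous_on_const cont)
    show "cinner (J (lin B c)) (B (flip w)) = cinner (B w) (lin B c)" for c
    proof (induction c)
      case (Cons p c)
      obtain z v where p: "p = (z, v)" by force
      have "cinner (B (flip v)) (B (flip w)) = cinner (B w) (B v)"
        using cinner_commute[of "B w" "B v"] by (simp add: cinner_B qi_flip)
      then show ?case
        using Cons by (simp add: p linear_simps[OF J(1)] J cinner_add_left cinner_add_right cinner_scaleC_left cinner_scaleC_right)
    qed (simp add: linear_simps[OF J(1)])
  qed
  have "cinner (J x) (J y) = cinner y x" for x y
  proof (rule dense_induct[where P = "\<lambda>y. cinner (J x) (J y) = cinner y x"])
    show "closed {y. cinner (J x) (J y) = cinner y x}"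
      by (intro closed_Collect_eq cinner.continuous_on continuous_on_id continuous_on_const cont)
    show "cinner (J x) (J (lin B c)) = cinner (lin B c) x" for c
    proof (induction c)
      case (Cons p c)
      obtain z v where p: "p = (z, v)" by force
      show ?case
        using Cons by (simp add: p linear_simps[OF J(1)] J cinner_add_left cinner_add_right cinner_scaleC_left cinner_scaleC_right JB)
    qed (simp add: linear_simps[OF J(1)])
  qed
  then show ?thesis using J by blast
qed

end


section \<open>q-numbers and q-binomial coefficients\<close>

definition qn :: "real \<Rightarrow> nat \<Rightarrow> real" where
  "qn q n = (\<Sum>i<n. q ^ i)"

text \<open>The Gaussian binomial coefficient: the powers of 1 - q cancel in the quotient of
  q-factorials, which leaves the products \<open>d_const\<close>.\<close>

definition qbin :: "real \<Rightarrow> nat \<Rightarrow> nat \<Rightarrow> real" where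
  "qbin q n k = (if k \<le> n then d_const q n / (d_const q k * d_const q (n - k)) else 0)"

lemma qn_0 [simp]: "qn q 0 = 0"
  and qn_Suc': "qn q (Suc n) = qn q n + q ^ n"
  by (simp_all add: qn_def)

lemma qn_Suc: "qn q (Suc n) = 1 + q * qn q n"
proof (induction n)
  case (Suc n)
  have "qn q (Suc (Suc n)) = 1 + q * (qn q n + q ^ n)"
    unfolding qn_Suc'[of q "Suc n"] Suc by (simp add: algebra_simps)
  then show ?case by (simp add: qn_Suc')
qed (simp add: qn_Suc')

lemma qn_closed: "q \<noteq> 1 \<Longrightarrow> qn q n = (1 - q ^ n) / (1 - q)"
  unfolding qn_def by (rule sum_gp_strict[THEN trans]) auto

lemma d_const_0 [simp]: "d_const q 0 = 1"
  and d_const_Suc: "d_const q (Suc n) = d_const q n * (1 - q ^ Suc n)"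
  by (simp_all add: d_const_def)

context
  fixes q :: real
  assumes q: "- 1 < q" "q < 1"
begin

lemma one_minus_pow_pos: "n > 0 \<Longrightarrow> 1 - q ^ n > 0"
proof -
  assume "n > 0"
  have "\<bar>q\<bar> < 1" using q by linarith
  then have "\<bar>q ^ n\<bar> < 1" using \<open>n > 0\<close> power_strict_mono[of "\<bar>q\<bar>" 1 n] by (simp add: power_abs)
  then show ?thesis by linarith
qed

lemma d_const_pos: "d_const q n > 0"
  by (induction n) (auto simp: d_const_Suc simp del: power_Suc intro!: mult_pos_pos one_minus_pow_pos)

lemma qbin_0 [simp]: "qbin q n 0 = 1" and qbin_self [simp]: "qbin q n n = 1"
  using d_const_pos[of n] by (auto simp: qbin_def)

lemma qbin_Suc: "qbin q (Suc n) (Suc k) = qbin q n k + q ^ Suc k * qbin q n (Suc k)"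
proof -
  consider "k = n" | "k < n" | "k > n" by linarith
  then show ?thesis
  proof cases
    case 2
    define m where "m = n - Suc k"
    have n: "n = Suc (k + m)" using 2 by (simp add: m_def)
    have 1: "1 - q ^ Suc k \<noteq> 0" "1 - q ^ Suc m \<noteq> 0" "d_const q k \<noteq> 0" "d_const q m \<noteq> 0"
      using one_minus_pow_pos[of "Suc k"] one_minus_pow_pos[of "Suc m"] d_const_pos[of k] d_const_pos[of m] by auto
    \<comment> \<open>The last factor of the numerator splits so that each summand cancels one
      factor of the denominator.\<close>
    have e: "1 - q ^ Suc n = (1 - q ^ Suc k) + q ^ Suc k * (1 - q ^ Suc m)"
      unfolding n by (simp add: algebra_simps power_add)
    have "qbin q (Suc n) (Suc k) = d_const q n * (1 - q ^ Suc n) / (d_const q k * (1 - q ^ Suc k) * (d_const q m * (1 - q ^ Suc m)))"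
      by (simp add: qbin_def n d_const_Suc del: power_Suc)
    moreover have "qbin q n k = d_const q n / (d_const q k * (d_const q m * (1 - q ^ Suc m)))"
      by (simp add: qbin_def n d_const_Suc del: power_Suc)
    moreover have "qbin q n (Suc k) = d_const q n / (d_const q k * (1 - q ^ Suc k) * d_const q m)"
      by (simp add: qbin_def n d_const_Suc del: power_Suc)
    moreover have "D * ((1 - a) + a * (1 - b)) / (x * (1 - a) * (y * (1 - b)))
        = D / (x * (y * (1 - b))) + a * (D / (x * (1 - a) * y))"
      if "1 - a \<noteq> 0" "1 - b \<noteq> 0" "x \<noteq> 0" "y \<noteq> 0" for D a b x y :: real
    proof -
      have "D * ((1 - a) + a * (1 - b)) / (x * (1 - a) * (y * (1 - b)))
        = D * (1 - a) / (x * (1 - a) * (y * (1 - b))) + D * (a * (1 - b)) / (x * (1 - a) * (y * (1 - b)))"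
        by (simp add: add_divide_distrib distrib_left)
      also have "D * (1 - a) / (x * (1 - a) * (y * (1 - b))) = D / (x * (y * (1 - b)))"
        using that by (simp add: divide_simps)
      also have "D * (a * (1 - b)) / (x * (1 - a) * (y * (1 - b))) = a * (D / (x * (1 - a) * y))"
        using that by (simp add: divide_simps)
      finally show ?thesis .
    qed
    ultimately show ?thesis
      unfolding e using 1 by presburger
  qed (auto simp: qbin_def d_const_pos[of n, THEN less_imp_neq, symmetric]
        d_const_pos[of "Suc n", THEN less_imp_neq, symmetric])
qed

text \<open>Absorption identity; in \<open>W_Suc\<close> it turns the contraction sum into a smaller
  Wick word.\<close>

lemma qbin_absorb: "qbin q (Suc m) (Suc l) * qn q (Suc l) = qn q (Suc m) * qbin q m l"
proof (cases "l \<le> m")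
  case True
  have 1: "1 - q ^ Suc l \<noteq> 0" "d_const q l \<noteq> 0" "d_const q (m - l) \<noteq> 0" "1 - q \<noteq> 0"
    using one_minus_pow_pos[of "Suc l"] d_const_pos[of l] d_const_pos[of "m - l"] q by auto
  show ?thesis
    using True 1 q by (simp add: qbin_def qn_closed d_const_Suc mult_ac del: power_Suc)
qed (simp add: qbin_def)

end

lemma sum_atMost_Suc_split: "(\<Sum>k\<le>Suc n. f k) = f 0 + (\<Sum>k\<le>n. f (Suc k))"
  for f :: "nat \<Rightarrow> 'a::comm_monoid_add"
  by (rule sum.atMost_Suc_shift)


section \<open>Left and right operators\<close>

lemma lin_rann_map: "inj f \<Longrightarrow> lin F (rann q (f x) (map f w)) = lin (\<lambda>u. F (map f u)) (rann q x w)"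
  by (induction w arbitrary: F) (auto simp: lin_rann_Cons inj_eq)

context q_fock
begin

lemma bcl_pow [intro, simp]: "bounded_clinear (cr x ^^ k)" "bounded_clinear (an x ^^ k)"
  by (rule bounded_clinear_funpow; simp)+

interpretation R: q_fock q "\<lambda>w. B (flip w)" by (rule mirror)

lemmas bcl_crs = bcl_simps[OF bcl_cr] bcl_simps[OF bcl_an]

text \<open>The mirrored space creates and annihilates at the right end, with the letter
  negated.\<close>

lemma R_cr_B: "R.cr x (B w) = B (w @ [\<not> x])"
  using R.cr_B[of x "flip w"] by (simp only: flip_flip) (simp add: rev_map comp_def)

lemma R_an_B: "R.an x (B w) = lin B (rann q (\<not> x) w)"
proof -
  have "R.an x (B (flip (flip w))) = lin (\<lambda>u. B (flip u)) (ann q x (rev (map Not w)))"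
    by (rule R.an_B)
  also have "\<dots> = lin (\<lambda>u. B (map Not u)) (rann q x (map Not w))"
    unfolding lin_ann_rev by (simp add: rev_map)
  also have "\<dots> = lin B (rann q (\<not> x) w)"
    using lin_rann_map[of Not "\<lambda>u. B (map Not u)" q "\<not> x" w] by (simp add: inj_def comp_def)
  finally show ?thesis by (simp only: flip_flip)
qed

text \<open>q to the power of the word length: the price for crossing a whole word.\<close>

definition Gam :: "'h \<Rightarrow> 'h" where
  "Gam = dg (\<lambda>\<kappa>. of_real (q ^ (fst \<kappa> + snd \<kappa>)))"

lemma bdd_Gam: "bdd (\<lambda>\<kappa>. of_real (q ^ (fst \<kappa> + snd \<kappa>)))"
  by (rule bddI[of _ 1]) (use q1 q2 in \<open>auto simp: norm_power power_abs intro!: power_le_one\<close>)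

lemma bcl_Gam [intro, simp]: "bounded_clinear Gam"
  unfolding Gam_def by (rule bcl_dg[OF bdd_Gam])

lemma Gam_B: "Gam (B w) = (q ^ length w) *\<^sub>R B w"
  unfolding Gam_def dg_B[OF bdd_Gam] key_length scaleC_of_real ..

lemma cr_R_cr: "cr x (R.cr y v) = R.cr y (cr x v)"
  by (rule bcl_eqI'[where f = "\<lambda>v. cr x (R.cr y v)"]) (auto simp: R_cr_B)

lemma bcl_if: "bounded_clinear f \<Longrightarrow> bounded_clinear (\<lambda>v. if P then f v else 0)"
  by (cases P) auto

text \<open>The only correction arises when the right annihilator removes the newly created leftmost
  letter, which lies beyond the whole word.\<close>

lemma R_an_cr: "R.an y (cr x v) = cr x (R.an y v) + (if x = (\<not> y) then Gam v else 0)"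
  by (rule bcl_eqI'[where f = "\<lambda>v. R.an y (cr x v)" and g = "\<lambda>v. cr x (R.an y v) + (if x = (\<not> y) then Gam v else 0)"])
    (auto intro!: bounded_clinear_plus bcl_if
      simp: R_an_B lin_rann_Cons bounded_clinear_lin Gam_B scaleC_of_real simp del: of_real_power)

lemma an_R_cr: "an x (R.cr y v) = R.cr y (an x v) + (if x = (\<not> y) then Gam v else 0)"
  by (rule bcl_eqI'[where f = "\<lambda>v. an x (R.cr y v)" and g = "\<lambda>v. R.cr y (an x v) + (if x = (\<not> y) then Gam v else 0)"])
    (auto intro!: bounded_clinear_plus bcl_if
      simp: an_B R_cr_B lin_ann_snoc bounded_clinear_lin Gam_B scaleC_of_real simp del: of_real_power)

lemma an_R_an: "an x (R.an y v) = R.an y (an x v)"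
  by (rule cinner_ext) (simp add: cinner_cr[symmetric] R.cinner_cr[symmetric] cr_R_cr)

lemma Gam_cr: "Gam (cr x v) = q *\<^sub>R cr x (Gam v)"
  by (rule bcl_eqI'[where f = "\<lambda>v. Gam (cr x v)" and g = "\<lambda>v. q *\<^sub>R cr x (Gam v)"])
    (auto simp: Gam_B bcl_crs intro!: bounded_clinear_rmult)

lemma an_cr_pow_neq: "x \<noteq> y \<Longrightarrow> an x ((cr y ^^ k) v) = q ^ k *\<^sub>R (cr y ^^ k) (an x v)"
  by (induction k) (auto simp: an_cr bcl_crs mult.commute)

text \<open>\<open>qn q k\<close> adds up the prices of deleting one of the k new letters. At
  \<open>k = 0\<close> the truncated \<open>k - 1\<close> is harmless because
  \<open>qn q 0 = 0\<close>.\<close>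

lemma an_cr_pow: "an x ((cr x ^^ k) v) = qn q k *\<^sub>R (cr x ^^ (k - 1)) v + q ^ k *\<^sub>R (cr x ^^ k) (an x v)"
proof (induction k)
  case (Suc k)
  show ?case
  proof (cases k)
    case (Suc j)
    have "cr x ((cr x ^^ (k - 1)) v) = (cr x ^^ k) v" by (simp add: Suc)
    then show ?thesis
      using Suc.IH by (simp add: an_cr bcl_crs qn_Suc scaleR_add_left scaleR_add_right mult.commute)
  qed (simp add: an_cr qn_def)
qed simp

end


section \<open>The generators and the Wick words\<close>

locale q_aw = q_fock q B for q :: real and B :: "bool list \<Rightarrow> 'h::complex_hilbert" +
  fixes mu :: real
  assumes mu1: "0 < mu" and mu2: "mu < 1"
begin

lemma mirror_aw: "q_aw q (\<lambda>w. B (flip w)) mu"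
  using mirror mu1 mu2 by (simp add: q_aw_def q_aw_axioms_def)

definition yl :: "'h \<Rightarrow> 'h" where "yl v = mu *\<^sub>R cr True v + an False v"
definition ys :: "'h \<Rightarrow> 'h" where "ys v = mu *\<^sub>R an True v + cr False v"

lemma bcl_yl [intro, simp]: "bounded_clinear yl" and bcl_ys [intro, simp]: "bounded_clinear ys"
  unfolding yl_def[abs_def] ys_def[abs_def] by (auto intro!: bounded_clinear_plus bounded_clinear_rmult)

lemma cinner_yl: "cinner (yl v) w = cinner v (ys w)" and cinner_ys: "cinner (ys v) w = cinner v (yl w)"
  by (simp_all add: yl_def ys_def cinner_add_left cinner_add_right cinner_scaleR_left cinner_scaleR_right
      cinner_cr cinner_an)

lemma cadjoint_yl: "cadjoint yl = ys" and cadjoint_ys: "cadjoint ys = yl"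
  by (rule cadjoint_eqI; simp add: cinner_yl cinner_ys)+

definition Malg :: "('h \<Rightarrow> 'h) set" where "Malg = commutant (commutant {yl, ys})"

lemma Malg_bcl: "x \<in> Malg \<Longrightarrow> bounded_clinear x"
  unfolding Malg_def by (rule commutant_bcl)

lemma gens_closed: "x \<in> {yl, ys} \<Longrightarrow> bounded_clinear x \<and> cadjoint x \<in> {yl, ys}"
  by (auto simp: cadjoint_yl cadjoint_ys)

lemma commutant_gens_closed:
  "x \<in> commutant {yl, ys} \<Longrightarrow> bounded_clinear x \<and> cadjoint x \<in> commutant {yl, ys}"
  using commutant_bcl commutant_cadjoint[OF gens_closed] by blast

lemma von_neumann_Malg: "von_neumann_algebra Malg"
  unfolding Malg_def by (rule von_neumann_algebra_commutant[OF commutant_gens_closed])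

lemma Malg_cadjoint: "x \<in> Malg \<Longrightarrow> cadjoint x \<in> Malg"
  using von_neumann_Malg by (auto simp: von_neumann_algebra_def)

lemma cr_False_eq: "cr False v = ys v - mu *\<^sub>R an True v"
  and cr_True_eq: "cr True v = (1 / mu) *\<^sub>R (yl v - an False v)"
  using mu1 by (simp_all add: ys_def yl_def)

text \<open>The vacuum is cyclic for the generators: a longer word is a generator applied to a
  shorter one, corrected by annihilated and hence shorter words. Operators commuting with the
  generators are therefore determined by their vacuum values.\<close>

lemma separating:
  assumes a: "bounded_clinear a" "\<And>v. a (yl v) = yl (a v)" "\<And>v. a (ys v) = ys (a v)"
    and b: "bounded_clinear b" "\<And>v. b (yl v) = yl (b v)" "\<And>v. b (ys v) = ys (b v)"
    and vac: "a (B []) = b (B [])"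
  shows "a = b"
proof (rule bcl_eqI[OF a(1) b(1)])
  fix w
  show "a (B w) = b (B w)"
  proof (induction "length w" arbitrary: w rule: less_induct)
    case less
    show ?case
    proof (cases w)
      case (Cons x v)
      have v: "a (B v) = b (B v)" using less Cons by simp
      have "a (an x' (B v)) = b (an x' (B v))" for x'
        unfolding an_B bounded_clinear_lin[OF a(1)] bounded_clinear_lin[OF b(1)]
        by (rule lin_cong) (use less Cons length_ann in fastforce)
      then have "a (cr x (B v)) = b (cr x (B v))"
        by (cases x) (simp_all add: cr_False_eq cr_True_eq bcl_simps[OF a(1)] bcl_simps[OF b(1)] a b v del: cr_B)
      then show ?thesis by (simp add: Cons)
    qed (simp add: vac)
  qed
qed

text \<open>The Wick word of $e^{\otimes n}\otimes\bar e^{\otimes m}$, written in normal order.\<close>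

definition W :: "nat \<Rightarrow> nat \<Rightarrow> 'h \<Rightarrow> 'h" where
  "W n m v = (\<Sum>k\<le>n. \<Sum>l\<le>m. (qbin q n k * qbin q m l * q ^ ((n - k) * l) * mu ^ (k + (m - l))) *\<^sub>R
     (cr True ^^ k) ((cr False ^^ l) ((an False ^^ (n - k)) ((an True ^^ (m - l)) v))))"

lemma bcl_W [intro, simp]: "bounded_clinear (W n m)"
  unfolding W_def[abs_def]
  by (intro bounded_clinear_setsum bounded_clinear_rmult bounded_clinear_compose'[OF bcl_pow(1)]
      bounded_clinear_compose'[OF bcl_pow(2)] bcl_pow)

text \<open>The q-binomial theorem: the two summands of \<open>ys\<close> involve different letters
  and thus q-commute without a constant term.\<close>

lemma W_0: "W 0 m v = (ys ^^ m) v"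
proof (induction m)
  case 0
  show ?case using q1 q2 by (simp add: W_def)
next
  case (Suc m)
  define t where "t l p = (cr False ^^ l) ((an True ^^ p) v)" for l p
  have W0: "W 0 m v = (\<Sum>l\<le>m. (qbin q m l * mu ^ (m - l)) *\<^sub>R t l (m - l))" for m
    using q1 q2 by (simp add: W_def t_def)
  have ys_t: "ys (t l p) = (mu * q ^ l) *\<^sub>R t l (Suc p) + t (Suc l) p" for l p
    by (simp add: ys_def t_def an_cr_pow_neq)
  have "(ys ^^ Suc m) v = (\<Sum>l\<le>m. (qbin q m l * mu ^ (m - l)) *\<^sub>R ys (t l (m - l)))"
    using Suc[symmetric] by (simp add: W0 bcl_simps[OF bcl_ys])
  also have "\<dots> = (\<Sum>l\<le>m. (q ^ l * qbin q m l * mu ^ (Suc m - l)) *\<^sub>R t l (Suc m - l))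
       + (\<Sum>l\<le>m. (qbin q m l * mu ^ (m - l)) *\<^sub>R t (Suc l) (m - l))"
    unfolding sum.distrib[symmetric]
    by (intro sum.cong) (auto simp: ys_t Suc_diff_le scaleR_add_right mult_ac)
  also have "(\<Sum>l\<le>m. (q ^ l * qbin q m l * mu ^ (Suc m - l)) *\<^sub>R t l (Suc m - l))
     = (\<Sum>l\<le>Suc m. (q ^ l * qbin q m l * mu ^ (Suc m - l)) *\<^sub>R t l (Suc m - l))"
    by (simp add: qbin_def)
  also have "\<dots> = mu ^ Suc m *\<^sub>R t 0 (Suc m) + (\<Sum>l\<le>m. (q ^ Suc l * qbin q m (Suc l) * mu ^ (m - l)) *\<^sub>R t (Suc l) (m - l))"
    unfolding sum_atMost_Suc_split using q1 q2 by simp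
  also have "mu ^ Suc m *\<^sub>R t 0 (Suc m) + (\<Sum>l\<le>m. (q ^ Suc l * qbin q m (Suc l) * mu ^ (m - l)) *\<^sub>R t (Suc l) (m - l))
      + (\<Sum>l\<le>m. (qbin q m l * mu ^ (m - l)) *\<^sub>R t (Suc l) (m - l)) = W 0 (Suc m) v"
    unfolding W0 sum_atMost_Suc_split add.assoc sum.distrib[symmetric] qbin_Suc[OF q1 q2] using q1 q2
    by (simp add: algebra_simps scaleR_add_left)
  finally show ?case by simp
qed

text \<open>Multiplication by a generator adds one letter e and one contraction: the new e is paired
  with some e-bar, after crossing all n letters e and up to m - 1 letters e-bar, hence the factor
  \<open>q ^ n * qn q m\<close>. For \<open>m = 0\<close> this factor vanishes and the truncated
  \<open>m - 1\<close> is immaterial.\<close>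

lemma W_Suc: "W (Suc n) m v = yl (W n m v) - (q ^ n * qn q m) *\<^sub>R W n (m - 1) v"
proof -
  define t where "t k l j p = (cr True ^^ k) ((cr False ^^ l) ((an False ^^ j) ((an True ^^ p) v)))" for k l j p
  define c where "c n k m l = qbin q n k * qbin q m l * q ^ ((n - k) * l) * mu ^ (k + (m - l))" for n k m l
  have W: "W n m v = (\<Sum>k\<le>n. \<Sum>l\<le>m. c n k m l *\<^sub>R t k l (n - k) (m - l))" for n m
    by (simp add: W_def t_def c_def)
  have yl_t: "yl (t k l j p) = mu *\<^sub>R t (Suc k) l j p + (q ^ (k + l)) *\<^sub>R t k l (Suc j) p + (q ^ k * qn q l) *\<^sub>R t k (l - 1) j p"
    for k l j p
    by (simp add: yl_def t_def an_cr_pow_neq an_cr_pow bcl_simps[OF bcl_pow(1)] scaleR_add_right power_add)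
  \<comment> \<open>The contracted part of \<open>yl\<close> times the Wick word; by absorption its
    coefficients are those of a word with one e-bar less.\<close>
  have third: "(\<Sum>k\<le>n. \<Sum>l\<le>m. (c n k m l * (q ^ k * qn q l)) *\<^sub>R t k (l - 1) (n - k) (m - l))
     = (q ^ n * qn q m) *\<^sub>R W n (m - 1) v"
  proof (cases m)
    case (Suc m')
    have c': "c n k m (Suc l) * (q ^ k * qn q (Suc l)) = q ^ n * qn q m * c n k m' l" if "k \<le> n" "l \<le> m'" for k l
    proof -
      have "(n - k) * Suc l + k = n + (n - k) * l" using that by simp
      then have p: "q ^ ((n - k) * Suc l) * q ^ k = q ^ n * q ^ ((n - k) * l)" by (metis power_add)
      have "c n k m (Suc l) * (q ^ k * qn q (Suc l))
          = qbin q n k * (qbin q m (Suc l) * qn q (Suc l)) * (q ^ ((n - k) * Suc l) * q ^ k) * mu ^ (k + (m' - l))"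
        by (simp add: c_def Suc)
      also have "\<dots> = qbin q n k * (qn q m * qbin q m' l) * (q ^ n * q ^ ((n - k) * l)) * mu ^ (k + (m' - l))"
        unfolding p Suc qbin_absorb[OF q1 q2] ..
      also have "\<dots> = q ^ n * qn q m * c n k m' l" by (simp add: c_def mult_ac)
      finally show ?thesis .
    qed
    have "(\<Sum>l\<le>m. (c n k m l * (q ^ k * qn q l)) *\<^sub>R t k (l - 1) (n - k) (m - l))
       = (\<Sum>l\<le>m'. (q ^ n * qn q m * c n k m' l) *\<^sub>R t k l (n - k) (m' - l))" if "k \<le> n" for k
    proof -
      have "(\<Sum>l\<le>m. (c n k m l * (q ^ k * qn q l)) *\<^sub>R t k (l - 1) (n - k) (m - l))
        = (\<Sum>l\<le>m'. (c n k m (Suc l) * (q ^ k * qn q (Suc l))) *\<^sub>R t k l (n - k) (m' - l))"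
        unfolding Suc sum_atMost_Suc_split by simp
      also have "\<dots> = (\<Sum>l\<le>m'. (q ^ n * qn q m * c n k m' l) *\<^sub>R t k l (n - k) (m' - l))"
        by (intro sum.cong refl) (use c' that in auto)
      finally show ?thesis .
    qed
    then have "(\<Sum>k\<le>n. \<Sum>l\<le>m. (c n k m l * (q ^ k * qn q l)) *\<^sub>R t k (l - 1) (n - k) (m - l))
       = (\<Sum>k\<le>n. \<Sum>l\<le>m'. (q ^ n * qn q m * c n k m' l) *\<^sub>R t k l (n - k) (m' - l))"
      by (intro sum.cong[OF refl]) (simp only: atMost_iff)
    then show ?thesis unfolding W Suc by (simp add: scaleR_sum_right)
  qed simp
  have "W (Suc n) m v = (\<Sum>k\<le>Suc n. \<Sum>l\<le>m. c (Suc n) k m l *\<^sub>R t k l (Suc n - k) (m - l))"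
    by (rule W)
  \<comment> \<open>Pascal's rule in \<open>k\<close>: the first sum will match the annihilating
    half of \<open>yl\<close>, the second its creating half.\<close>
  also have "\<dots> = (\<Sum>k\<le>Suc n. \<Sum>l\<le>m. (q ^ k * qbin q n k * qbin q m l * q ^ ((Suc n - k) * l) * mu ^ (k + (m - l))) *\<^sub>R t k l (Suc n - k) (m - l))
     + (\<Sum>k\<le>n. \<Sum>l\<le>m. (c n k m l * mu) *\<^sub>R t (Suc k) l (n - k) (m - l))"
  proof -
    have "(\<Sum>l\<le>m. c (Suc n) (Suc k) m l *\<^sub>R t (Suc k) l (n - k) (m - l))
      = (\<Sum>l\<le>m. (q ^ Suc k * qbin q n (Suc k) * qbin q m l * q ^ ((n - k) * l) * mu ^ (Suc k + (m - l))) *\<^sub>R t (Suc k) l (n - k) (m - l))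
      + (\<Sum>l\<le>m. (c n k m l * mu) *\<^sub>R t (Suc k) l (n - k) (m - l))" for k
      unfolding sum.distrib[symmetric] scaleR_add_left[symmetric]
      by (intro sum.cong refl arg_cong[where f = "\<lambda>r. r *\<^sub>R _"])
        (simp add: c_def qbin_Suc[OF q1 q2] algebra_simps)
    moreover have "(\<Sum>l\<le>m. c (Suc n) 0 m l *\<^sub>R t 0 l (Suc n) (m - l))
      = (\<Sum>l\<le>m. (q ^ 0 * qbin q n 0 * qbin q m l * q ^ ((Suc n - 0) * l) * mu ^ (0 + (m - l))) *\<^sub>R t 0 l (Suc n) (m - l))"
      using q1 q2 by (simp add: c_def)
    ultimately show ?thesis
      unfolding sum_atMost_Suc_split by (simp only: diff_Suc_Suc diff_zero sum.distrib add.assoc)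
  qed
  also have "(\<Sum>k\<le>Suc n. \<Sum>l\<le>m. (q ^ k * qbin q n k * qbin q m l * q ^ ((Suc n - k) * l) * mu ^ (k + (m - l))) *\<^sub>R t k l (Suc n - k) (m - l))
     = (\<Sum>k\<le>n. \<Sum>l\<le>m. (c n k m l * q ^ (k + l)) *\<^sub>R t k l (Suc (n - k)) (m - l))"
  proof -
    have "qbin q n (Suc n) = 0" by (simp add: qbin_def)
    moreover have "q ^ k * qbin q n k * qbin q m l * q ^ ((Suc n - k) * l) * mu ^ (k + (m - l)) = c n k m l * q ^ (k + l)"
      if "k \<le> n" for k l
      using that by (simp add: c_def Suc_diff_le power_add)
    ultimately show ?thesis
      unfolding sum.atMost_Suc
      by (simp only: mult_zero_right mult_zero_left scaleR_zero_left sum.neutral_const add_0_right)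
        (intro sum.cong[OF refl], simp only: atMost_iff Suc_diff_le)
  qed
  finally have 1: "W (Suc n) m v = (\<Sum>k\<le>n. \<Sum>l\<le>m. (c n k m l * q ^ (k + l)) *\<^sub>R t k l (Suc (n - k)) (m - l))
     + (\<Sum>k\<le>n. \<Sum>l\<le>m. (c n k m l * mu) *\<^sub>R t (Suc k) l (n - k) (m - l))" .
  have "yl (W n m v) = (\<Sum>k\<le>n. \<Sum>l\<le>m. c n k m l *\<^sub>R yl (t k l (n - k) (m - l)))"
    unfolding W by (simp add: bcl_simps[OF bcl_yl])
  also have "\<dots> = W (Suc n) m v + (\<Sum>k\<le>n. \<Sum>l\<le>m. (c n k m l * (q ^ k * qn q l)) *\<^sub>R t k (l - 1) (n - k) (m - l))"
    unfolding 1 yl_t scaleR_add_right scaleR_scaleR sum.distrib by (simp only: add_ac)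
  finally show ?thesis unfolding third by simp
qed

text \<open>Used twice: with a = b = 1 for operators in the commutant, and with inverse phases for
  the modular unitaries. The condition a b = 1 makes the contraction term, which has one letter of
  each kind less, scale like the rest.\<close>

lemma W_covariant:
  assumes z: "bounded_clinear z" and yl: "\<And>v. z (yl v) = a *\<^sub>C yl (z v)" and ys: "\<And>v. z (ys v) = b *\<^sub>C ys (z v)"
    and ab: "a * b = 1"
  shows "z (W n m v) = (a ^ n * b ^ m) *\<^sub>C W n m (z v)"
proof (induction n arbitrary: m)
  case 0
  have "z ((ys ^^ m) v) = b ^ m *\<^sub>C (ys ^^ m) (z v)"
    by (induction m) (simp_all add: ys bcl_simps[OF bcl_ys] scaleC_scaleC)
  then show ?case by (simp add: W_0)
next
  case (Suc n)
  show ?case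
  proof (cases m)
    case 0
    then show ?thesis using Suc[of 0] by (simp add: W_Suc yl bcl_simps[OF bcl_yl] scaleC_scaleC)
  next
    case (Suc m')
    have "a ^ Suc n * b ^ Suc m' = (a * b) * (a ^ n * b ^ m')" by simp
    then have e: "a ^ Suc n * b ^ m = a ^ n * b ^ m'" unfolding ab Suc by simp
    have "z (W (Suc n) m v) = a *\<^sub>C yl (z (W n m v)) - (q ^ n * qn q m) *\<^sub>R z (W n m' v)"
      by (simp add: W_Suc yl bcl_simps[OF z] Suc)
    also have "\<dots> = (a ^ Suc n * b ^ m) *\<^sub>C yl (W n m (z v)) - (q ^ n * qn q m) *\<^sub>R ((a ^ n * b ^ m') *\<^sub>C W n m' (z v))"
      by (simp add: Suc.IH bcl_simps[OF bcl_yl] scaleC_scaleC)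
    also have "\<dots> = (a ^ Suc n * b ^ m) *\<^sub>C W (Suc n) m (z v)"
      unfolding e[symmetric] by (simp add: W_Suc scaleC.diff_right scaleC_scaleR Suc)
    finally show ?thesis .
  qed
qed

lemma W_commute:
  assumes "bounded_clinear z" "\<And>v. z (yl v) = yl (z v)" "\<And>v. z (ys v) = ys (z v)"
  shows "z (W n m v) = W n m (z v)"
  using W_covariant[of z 1 1] assms by simp

lemma W_in_Malg: "W n m \<in> Malg"
  unfolding Malg_def
proof (rule commutantI)
  fix z assume z: "z \<in> commutant {yl, ys}"
  then show "W n m \<circ> z = z \<circ> W n m"
    using W_commute[OF commutant_bcl[OF z] commutantD'[OF z] commutantD'[OF z]] by (simp add: fun_eq_iff)
qed simp

lemma an_pow_vac: "(an x ^^ p) (B []) = (if p = 0 then B [] else 0)"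
  by (induction p) (auto simp: bcl_crs)

text \<open>Annihilators kill the vacuum, so the term with \<open>k = n\<close> and
  \<open>l = n\<close> alone remains; mu^n comes from e = mu f.\<close>

lemma W_vac: "W n n (B []) = mu ^ n *\<^sub>R B (replicate n True @ replicate n False)"
proof -
  have inner: "(an False ^^ j) ((an True ^^ p) (B [])) = (if j = 0 \<and> p = 0 then B [] else 0)" for j p
    by (auto simp: an_pow_vac bcl_simps[OF bcl_pow(2)])
  have "W n n (B []) = (\<Sum>k\<le>n. \<Sum>l\<le>n. if k = n then if l = n then mu ^ n *\<^sub>R (cr True ^^ n) ((cr False ^^ n) (B [])) else 0 else 0)"
    unfolding W_def inner
    by (intro sum.cong refl) (use q1 q2 in \<open>auto simp: bcl_simps[OF bcl_pow(1)]\<close>)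
  also have "\<dots> = mu ^ n *\<^sub>R (cr True ^^ n) ((cr False ^^ n) (B []))"
    by (simp only: sum.swap[of _ "{..n}"] sum.delta finite_atMost atMost_iff order_refl if_True)
  finally show ?thesis by (simp add: cr_pow_B)
qed

end

section \<open>Commutation of the left and the right action\<close>

context q_aw
begin

interpretation R: q_aw q "\<lambda>w. B (flip w)" mu by (rule mirror_aw)

lemmas R_rules = cr_R_cr an_R_cr R_an_cr an_R_an bcl_crs bcl_simps[OF R.bcl_cr] bcl_simps[OF R.bcl_an]

text \<open>Contractions across the whole word occur for \<open>yl\<close> with \<open>R.yl\<close>
  and for \<open>ys\<close> with \<open>R.ys\<close>, once from each side; the two multiples of
  \<open>Gam\<close>, both with coefficient mu, cancel.\<close>

lemma yl_R_yl: "yl (R.yl v) = R.yl (yl v)" and yl_R_ys: "yl (R.ys v) = R.ys (yl v)"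
  and ys_R_yl: "ys (R.yl v) = R.yl (ys v)" and ys_R_ys: "ys (R.ys v) = R.ys (ys v)"
  unfolding yl_def ys_def R.yl_def R.ys_def by (simp_all add: R_rules algebra_simps)

lemma R_gens_commutant: "R.yl \<in> commutant {yl, ys}" "R.ys \<in> commutant {yl, ys}"
  by (auto intro!: commutantI simp: fun_eq_iff yl_R_yl yl_R_ys ys_R_yl ys_R_ys)

lemma Malg_R_gens: "x \<in> Malg \<Longrightarrow> x (R.yl v) = R.yl (x v)" "x \<in> Malg \<Longrightarrow> x (R.ys v) = R.ys (x v)"
  using commutantD'[OF _ R_gens_commutant(1)] commutantD'[OF _ R_gens_commutant(2)] by (auto simp: Malg_def)

text \<open>The word f^n e-bar^n is its own flip, so the left and the right Wick operator produce
  the same vector from the vacuum.\<close>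

lemma R_W_vac: "R.W n n (B []) = W n n (B [])"
  using R.W_vac[of n] by (simp add: W_vac map_replicate_const)

end


section \<open>Bounds for the q-factorials\<close>

text \<open>Bounds all quotients d_(m+n)/d_m, see \<open>d_upper\<close>.\<close>

definition U_bound :: "real \<Rightarrow> real" where "U_bound q = max 1 (1 - q)"
text \<open>The q-factorial is \<open>kap q ^ (2 * n)\<close> times the bounded factor
  \<open>d_const q n\<close>, so \<open>kap q\<close> is the growth rate of the powers of a creation
  operator.\<close>

definition kap :: "real \<Rightarrow> real" where "kap q = 1 / sqrt (1 - q)"
definition qf :: "real \<Rightarrow> nat \<Rightarrow> real" where "qf q n = (\<Prod>i<n. qn q (Suc i))"

lemma qf_0 [simp]: "qf q 0 = 1" and qf_Suc: "qf q (Suc n) = qn q (Suc n) * qf q n"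
  by (simp_all add: qf_def mult.commute)

context
  fixes q :: real
  assumes q: "- 1 < q" "q < 1"
begin

lemma kap_pos: "kap q > 0" and kap_sq: "(kap q)\<^sup>2 = 1 / (1 - q)"
  using q by (simp_all add: kap_def power_divide)

lemma kap_sq_pow: "kap q ^ (2 * n) = 1 / (1 - q) ^ n"
  by (simp add: power_mult kap_sq power_one_over)

lemma qf_eq: "qf q n = kap q ^ (2 * n) * d_const q n"
proof (induction n)
  case (Suc n)
  have "qf q (Suc n) = (1 - q ^ Suc n) / (1 - q) * (kap q ^ (2 * n) * d_const q n)"
    using q by (simp add: qf_Suc Suc qn_closed)
  also have "\<dots> = kap q ^ (2 * Suc n) * d_const q (Suc n)"
    unfolding kap_sq_pow d_const_Suc by (simp add: mult_ac)
  finally show ?case .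
qed simp

lemma qf_pos: "qf q n > 0"
  by (simp add: qf_eq kap_pos d_const_pos[OF q])

lemma qn_pos: "qn q (Suc n) > 0"
  using q one_minus_pow_pos[OF q, of "Suc n"] by (simp add: qn_closed)

lemma abs_q: "\<bar>q\<bar> < 1" "- 1 < \<bar>q\<bar>"
  using q by linarith+

lemma d_abs_convergent: "convergent_prod (\<lambda>i. 1 / (1 - \<bar>q\<bar> ^ Suc i))"
proof (rule abs_convergent_prod_imp_convergent_prod, rule summable_imp_abs_convergent_prod)
  have "norm (norm (1 / (1 - \<bar>q\<bar> ^ Suc i) - 1)) \<le> \<bar>q\<bar> ^ Suc i / (1 - \<bar>q\<bar>)" for i
  proof -
    have 1: "\<bar>q\<bar> ^ Suc i \<le> \<bar>q\<bar>" using abs_q power_decreasing[of 1 "Suc i" "\<bar>q\<bar>"] by simp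
    have "1 / (1 - \<bar>q\<bar> ^ Suc i) - 1 = \<bar>q\<bar> ^ Suc i / (1 - \<bar>q\<bar> ^ Suc i)"
      using 1 abs_q by (simp add: field_simps)
    moreover have "\<dots> \<le> \<bar>q\<bar> ^ Suc i / (1 - \<bar>q\<bar>)"
      using 1 abs_q by (intro divide_left_mono) (auto simp: mult_pos_pos)
    moreover have "\<bar>q\<bar> ^ Suc i / (1 - \<bar>q\<bar> ^ Suc i) \<ge> 0"
      using 1 abs_q by (intro divide_nonneg_nonneg) auto
    ultimately have "\<bar>1 / (1 - \<bar>q\<bar> ^ Suc i) - 1\<bar> \<le> \<bar>q\<bar> ^ Suc i / (1 - \<bar>q\<bar>)" by linarith
    then show ?thesis by (simp only: real_norm_def abs_abs)
  qed
  moreover have "summable (\<lambda>i. \<bar>q\<bar> ^ Suc i / (1 - \<bar>q\<bar>))"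
    using abs_q by (intro summable_divide) (simp add: summable_mult summable_geometric)
  ultimately show "summable (\<lambda>i. norm (1 / (1 - \<bar>q\<bar> ^ Suc i) - 1))"
    by (rule summable_comparison_test'[rotated])
qed

lemma d_abs_partial: "(\<Prod>i\<le>n. 1 / (1 - \<bar>q\<bar> ^ Suc i)) = 1 / d_const \<bar>q\<bar> (Suc n)"
proof (induction n)
  case (Suc n)
  have "d_const \<bar>q\<bar> (Suc (Suc n)) = d_const \<bar>q\<bar> (Suc n) * (1 - \<bar>q\<bar> ^ Suc (Suc n))"
    by (rule d_const_Suc)
  then show ?case by (simp only: prod.atMost_Suc Suc times_divide_eq_right mult_1_right divide_divide_eq_left)
qed (simp add: d_const_def)

lemma C_const_LIMSEQ: "(\<lambda>n. 1 / d_const \<bar>q\<bar> (Suc n)) \<longlonglongrightarrow> C_const q"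
  unfolding C_const_def d_abs_partial[symmetric]
  by (rule convergent_prod_LIMSEQ[OF d_abs_convergent])

lemma d_abs_decseq: "d_const \<bar>q\<bar> (Suc n) \<le> d_const \<bar>q\<bar> n"
  using d_const_pos[OF abs_q(2,1), of n] abs_q
  by (simp add: d_const_Suc mult_le_cancel_left1 del: power_Suc)

lemma C_const_ge: "1 / d_const \<bar>q\<bar> n \<le> C_const q"
proof -
  have "incseq (\<lambda>n. 1 / d_const \<bar>q\<bar> n)"
    using d_const_pos[OF abs_q(2,1)] d_abs_decseq by (intro incseq_SucI) (auto intro!: divide_left_mono)
  then have inc: "incseq (\<lambda>n. 1 / d_const \<bar>q\<bar> (Suc n))" by (auto simp: incseq_def)
  have "1 / d_const \<bar>q\<bar> n \<le> 1 / d_const \<bar>q\<bar> (Suc n)"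
    using d_const_pos[OF abs_q(2,1)] d_abs_decseq by (auto intro!: divide_left_mono)
  also have "\<dots> \<le> C_const q"
    by (rule incseq_le[OF inc C_const_LIMSEQ])
  finally show ?thesis .
qed

lemma C_const_ge_1: "1 \<le> C_const q"
  using C_const_ge[of 0] by simp

lemma C_d_abs: "1 \<le> C_const q * d_const \<bar>q\<bar> n"
  using C_const_ge[of n] d_const_pos[OF abs_q(2,1), of n] by (simp add: divide_le_eq)

text \<open>Factor by factor: 1 - q^(m+i) is at least 1 - |q|^i, whatever the sign of q and the size
  of m.\<close>

lemma d_ratio_lower: "d_const q m * d_const \<bar>q\<bar> n \<le> d_const q (m + n)"
proof (induction n)
  case (Suc n)
  have "q ^ Suc (m + n) \<le> \<bar>q\<bar> ^ Suc (m + n)" by (metis abs_ge_self power_abs)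
  also have "\<dots> \<le> \<bar>q\<bar> ^ Suc n" using abs_q by (intro power_decreasing) auto
  finally have 1: "1 - \<bar>q\<bar> ^ Suc n \<le> 1 - q ^ Suc (m + n)" by simp
  have "(d_const q m * d_const \<bar>q\<bar> n) * (1 - \<bar>q\<bar> ^ Suc n) \<le> d_const q (m + n) * (1 - q ^ Suc (m + n))"
    using Suc 1 d_const_pos[OF q] one_minus_pow_pos[OF abs_q(2,1), of "Suc n"]
    by (intro mult_mono) (auto intro: less_imp_le)
  then show ?case by (simp add: d_const_Suc mult.assoc del: power_Suc)
qed simp

lemma d_lower: "d_const q m \<le> C_const q * d_const q (m + n)"
proof -
  have "d_const q m * 1 \<le> d_const q m * (C_const q * d_const \<bar>q\<bar> n)"
    using C_d_abs[of n] d_const_pos[OF q, of m] by (intro mult_left_mono) auto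
  also have "\<dots> = C_const q * (d_const q m * d_const \<bar>q\<bar> n)" by simp
  also have "\<dots> \<le> C_const q * d_const q (m + n)"
    using d_ratio_lower C_const_ge_1 by (intro mult_left_mono) auto
  finally show ?thesis by simp
qed

text \<open>For q < 0 and odd m the factors after position m can be paired as (1 - a)(1 - q a) with
  a \<ge> 0, and each pair is at most 1.\<close>

lemma d_neg_odd:
  assumes "q < 0" "odd m"
  shows "d_const q (m + n) \<le> d_const q m"
  using assms(2)
proof (induction n arbitrary: m rule: induct_nat_012)
  case 1
  have "q ^ Suc m \<ge> 0" using 1 by (intro zero_le_even_power) auto
  then show ?case using d_const_pos[OF q, of m] by (simp add: d_const_Suc mult_le_cancel_left1 del: power_Suc)
next
  case (ge2 n)
  have "q ^ Suc m \<ge> 0" using ge2 by (intro zero_le_even_power) auto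
  define a where "a = q ^ Suc m"
  have a: "a \<ge> 0" unfolding a_def by fact
  have "(1 - a) * (1 - q * a) = 1 - a * (1 + q * (1 - a))" by (simp add: algebra_simps)
  moreover have "1 + q * (1 - a) \<ge> 0"
  proof -
    have "a \<le> 1" using one_minus_pow_pos[OF q, of "Suc m"] by (simp add: a_def)
    then have "q * (1 - a) \<ge> -1 * (1 - a)" using q by (intro mult_right_mono) auto
    moreover have "-1 * (1 - a) = a - 1" by simp
    ultimately show ?thesis using a by linarith
  qed
  ultimately have "(1 - a) * (1 - q * a) \<le> 1" using a by simp
  then have "d_const q (m + 2) \<le> d_const q m"
    using d_const_pos[OF q, of m] mult_left_le[of "(1 - a) * (1 - q * a)" "d_const q m"]
    by (simp add: d_const_Suc numeral_2_eq_2 a_def mult.assoc)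
  moreover have "d_const q (m + 2 + n) \<le> d_const q (m + 2)" by (rule ge2.IH) (use ge2.prems in auto)
  ultimately show ?case by simp
qed simp

text \<open>If q < 0 and m is even, a single factor, at most 1 - q, leads to the odd case.\<close>

lemma d_upper: "d_const q (m + n) \<le> U_bound q * d_const q m"
proof (cases "q < 0")
  case True
  have U: "U_bound q = 1 - q" using True by (simp add: U_bound_def)
  show ?thesis
  proof (cases "odd m")
    case odd: True
    have "d_const q (m + n) \<le> 1 * d_const q m" using d_neg_odd[OF True odd] by simp
    also have "\<dots> \<le> (1 - q) * d_const q m"
      using True d_const_pos[OF q, of m] by (intro mult_right_mono) auto
    finally show ?thesis by (simp add: U)
  next
    case False
    show ?thesis
    proof (cases n)
      case 0
      then show ?thesis using True d_const_pos[OF q, of m] by (simp add: U mult_le_cancel_right1)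
    next
      case (Suc n')
      have "- (q ^ Suc m) \<le> - q"
      proof -
        have "(- q) ^ Suc m \<le> (- q) ^ 1" using True q by (intro power_decreasing) auto
        moreover have "(- q) ^ Suc m = - (q ^ Suc m)" using False by simp
        ultimately show ?thesis by (simp only: power_one_right)
      qed
      then have "d_const q (Suc m) \<le> (1 - q) * d_const q m"
        using d_const_pos[OF q, of m] unfolding d_const_Suc
        by (subst mult.commute, intro mult_right_mono) auto
      moreover have "d_const q (Suc m + n') \<le> d_const q (Suc m)"
        by (rule d_neg_odd) (use True False in auto)
      ultimately show ?thesis by (simp add: Suc U)
    qed
  qed
next
  case False
  have "d_const q (m + n) \<le> d_const q m"
  proof (induction n)
    case (Suc n)
    have "d_const q (m + Suc n) \<le> d_const q (m + n)"
      using False d_const_pos[OF q, of "m + n"] by (simp add: d_const_Suc mult_le_cancel_left1 del: power_Suc)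
    then show ?case using Suc by simp
  qed simp
  then show ?thesis using False by (simp add: U_bound_def)
qed

lemma U_ge_1: "1 \<le> U_bound q"
  by (simp add: U_bound_def)

lemma qbin_nonneg: "0 \<le> qbin q n k"
  using d_const_pos[OF q] by (auto simp: qbin_def intro!: divide_nonneg_nonneg less_imp_le)

text \<open>For q < 0 the first factor of \<open>d_const q p\<close> already is 1 - q, and the
  others dominate those formed with |q|. This absorbs \<open>U_bound q\<close> in
  \<open>qbin_le\<close>, whose bound is then \<open>C_const q\<close> without a further
  factor.\<close>

lemma U_le_C_d: "p > 0 \<Longrightarrow> U_bound q \<le> C_const q * d_const q p"
proof -
  assume "p > 0"
  then obtain p' where p: "p = Suc p'" using gr0_implies_Suc by blast
  show ?thesis
  proof (cases "q < 0")
    case True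
    have "(1 - q) * d_const \<bar>q\<bar> (Suc n) \<le> d_const q (Suc n)" for n
    proof (induction n)
      case 0
      have "(1 - q) * (1 - \<bar>q\<bar>) \<le> (1 - q) * 1" using True by (intro mult_left_mono) auto
      then show ?case by (simp add: d_const_def)
    next
      case (Suc n)
      have "q ^ Suc (Suc n) \<le> \<bar>q\<bar> ^ Suc (Suc n)" by (metis abs_ge_self power_abs)
      then have "((1 - q) * d_const \<bar>q\<bar> (Suc n)) * (1 - \<bar>q\<bar> ^ Suc (Suc n)) \<le> d_const q (Suc n) * (1 - q ^ Suc (Suc n))"
        using Suc d_const_pos[OF q] one_minus_pow_pos[OF abs_q(2,1), of "Suc (Suc n)"]
        by (intro mult_mono) (auto intro: less_imp_le)
      then show ?case by (simp add: d_const_Suc[of _ "Suc n"] mult.assoc del: power_Suc)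
    qed
    then have *: "(1 - q) * d_const \<bar>q\<bar> p \<le> d_const q p" by (simp add: p)
    have "(1 - q) * 1 \<le> (1 - q) * (C_const q * d_const \<bar>q\<bar> p)"
      using C_d_abs[of p] q by (intro mult_left_mono) auto
    also have "\<dots> = C_const q * ((1 - q) * d_const \<bar>q\<bar> p)" by simp
    also have "\<dots> \<le> C_const q * d_const q p" using * C_const_ge_1 by (intro mult_left_mono) auto
    finally show ?thesis using True by (simp add: U_bound_def)
  next
    case False
    then show ?thesis using C_d_abs[of p] by (simp add: U_bound_def)
  qed
qed

lemma qbin_le: "qbin q n p \<le> C_const q"
proof -
  consider "p = 0" | "0 < p" "p \<le> n" | "p > n" by linarith
  then show ?thesis
  proof cases
    case 2
    have "d_const q n \<le> U_bound q * d_const q (n - p)"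
      using d_upper[of "n - p" p] 2 by simp
    also have "\<dots> \<le> C_const q * d_const q p * d_const q (n - p)"
      using U_le_C_d[OF 2(1)] d_const_pos[OF q] by (intro mult_right_mono) (auto intro: less_imp_le)
    finally show ?thesis
      using 2 d_const_pos[OF q, of p] d_const_pos[OF q, of "n - p"]
      by (simp add: qbin_def divide_le_eq mult.assoc)
  qed (use q C_const_ge_1 in \<open>auto simp: qbin_def d_const_pos[OF q, THEN less_imp_neq, symmetric]\<close>)
qed

lemma qf_upper: "qf q (m + n) \<le> U_bound q * kap q ^ (2 * n) * qf q m"
proof -
  have "kap q ^ (2 * (m + n)) * d_const q (m + n) \<le> kap q ^ (2 * (m + n)) * (U_bound q * d_const q m)"
    using d_upper kap_pos by (intro mult_left_mono) auto
  then show ?thesis by (simp add: qf_eq power_add mult_ac add_mult_distrib2)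
qed

lemma qf_lower: "kap q ^ (2 * n) * qf q m \<le> C_const q * qf q (m + n)"
proof -
  have "kap q ^ (2 * (m + n)) * d_const q m \<le> kap q ^ (2 * (m + n)) * (C_const q * d_const q (m + n))"
    using d_lower kap_pos by (intro mult_left_mono) auto
  then show ?thesis by (simp add: qf_eq power_add mult_ac add_mult_distrib2)
qed

end


section \<open>Wold decomposition and the norms of creation powers\<close>

context q_fock
begin

lemma cinner_cr_pow: "cinner ((cr x ^^ n) v) w = cinner v ((an x ^^ n) w)"
  and cinner_an_pow: "cinner ((an x ^^ n) v) w = cinner v ((cr x ^^ n) w)"
  by (rule cinner_funpow, simp add: cinner_cr cinner_an)+

lemma an_pow_cr_pow: "an x z = 0 \<Longrightarrow> (an x ^^ n) ((cr x ^^ (m + n)) z) = (qf q (m + n) / qf q m) *\<^sub>R (cr x ^^ m) z"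
proof (induction n)
  case (Suc n)
  have "(an x ^^ Suc n) ((cr x ^^ (m + Suc n)) z) = (an x ^^ n) (an x ((cr x ^^ Suc (m + n)) z))"
    by (simp add: funpow_swap1)
  also have "an x ((cr x ^^ Suc (m + n)) z) = qn q (Suc (m + n)) *\<^sub>R (cr x ^^ (m + n)) z"
    using an_cr_pow[of x "Suc (m + n)" z] Suc.prems by (simp add: bcl_simps[OF bcl_pow(1)] bcl_crs)
  finally show ?case using Suc by (simp add: bcl_simps[OF bcl_pow(2)] qf_Suc)
qed (use qf_pos[OF q1 q2, of m] in simp)

lemma cr_pow_orth:
  assumes "an x z = 0" "an x z' = 0" "m \<noteq> m'"
  shows "cinner ((cr x ^^ m) z) ((cr x ^^ m') z') = 0"
proof -
  have *: "cinner ((cr x ^^ m) z) ((cr x ^^ m') z') = 0" if "an x z = 0" "m < m'" for m m' z z'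
  proof -
    define k where "k = m' - Suc m"
    have k: "m' = Suc k + m" using that(2) by (simp add: k_def)
    have "cinner ((cr x ^^ m) z) ((cr x ^^ m') z') = cinner ((an x ^^ m') ((cr x ^^ m) z)) z'"
      by (simp add: cinner_an_pow)
    also have "(an x ^^ m') ((cr x ^^ m) z) = (an x ^^ k) (an x ((an x ^^ m) ((cr x ^^ (0 + m)) z)))"
      by (simp add: k funpow_add funpow_swap1)
    also have "\<dots> = 0"
      using that by (simp only: an_pow_cr_pow) (simp add: bcl_crs bcl_simps[OF bcl_pow(2)])
    finally show ?thesis by simp
  qed
  show ?thesis
  proof (cases "m < m'")
    case False
    then have "cinner ((cr x ^^ m') z') ((cr x ^^ m) z) = 0"
      using *[OF assms(2), of m' m z] assms(3) by simp
    then show ?thesis using cinner_commute[of "(cr x ^^ m) z"] by simp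
  qed (rule *[OF assms(1)])
qed

lemma norm_cr_pow:
  assumes "an x z = 0"
  shows "(norm ((cr x ^^ m) z))\<^sup>2 = qf q m * (norm z)\<^sup>2"
proof -
  have "complex_of_real ((norm ((cr x ^^ m) z))\<^sup>2) = complex_of_real (qf q m * (norm z)\<^sup>2)"
    using an_pow_cr_pow[OF assms, of m 0]
    by (simp only: cinner_self[symmetric] cinner_cr_pow) (simp add: cinner_scaleR_right cinner_self)
  then show ?thesis using of_real_eq_iff by blast
qed

text \<open>The top component is peeled off: \<open>z\<close> is the (N+1)-fold annihilation of
  \<open>v\<close> divided by the q-factorial, and subtracting its creation power lowers the order
  by one.\<close>

lemma wold:
  "(an x ^^ Suc N) v = 0 \<Longrightarrow> \<exists>f. (\<forall>m\<le>N. an x (f m) = 0) \<and> v = (\<Sum>m\<le>N. (cr x ^^ m) (f m))"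
proof (induction N arbitrary: v)
  case 0
  then show ?case by (intro exI[of _ "\<lambda>_. v"]) auto
next
  case (Suc N)
  define z where "z = (1 / qf q (Suc N)) *\<^sub>R (an x ^^ Suc N) v"
  have z: "an x z = 0" using Suc.prems by (simp add: z_def bcl_crs)
  have "(an x ^^ Suc N) (v - (cr x ^^ Suc N) z) = 0"
    using an_pow_cr_pow[OF z, of "Suc N" 0] qf_pos[OF q1 q2, of "Suc N"]
    by (simp add: z_def bcl_simps[OF bcl_pow(2)] del: funpow.simps)
  then obtain f where f: "\<forall>m\<le>N. an x (f m) = 0" "v - (cr x ^^ Suc N) z = (\<Sum>m\<le>N. (cr x ^^ m) (f m))"
    using Suc.IH by blast
  have "v = (\<Sum>m\<le>N. (cr x ^^ m) (f m)) + (cr x ^^ Suc N) z" using f(2) by (metis diff_add_cancel)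
  also have "\<dots> = (\<Sum>m\<le>Suc N. (cr x ^^ m) ((f(Suc N := z)) m))" by simp
  finally show ?case using f(1) z by (intro exI[of _ "f(Suc N := z)"]) auto
qed

lemma an_pow_kill: "length w < n \<Longrightarrow> (an x ^^ n) (B w) = 0"
proof (induction n arbitrary: w)
  case (Suc n)
  have "(an x ^^ Suc n) (B w) = lin (\<lambda>u. (an x ^^ n) (B u)) (ann q x w)"
    by (simp add: funpow_swap1 an_B bounded_clinear_lin)
  also have "\<dots> = lin (\<lambda>_. 0) (ann q x w)"
    by (rule lin_cong) (use Suc length_ann in fastforce)
  finally show ?case by simp
qed simp

lemma an_pow_kill': "length w < n \<Longrightarrow> (an y ^^ n) ((an x ^^ p) (B w)) = 0"
proof (induction p arbitrary: w)
  case (Suc p)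
  have "(an y ^^ n) ((an x ^^ Suc p) (B w)) = lin (\<lambda>u. (an y ^^ n) ((an x ^^ p) (B u))) (ann q x w)"
    by (simp add: funpow_swap1 an_B bounded_clinear_lin)
  also have "\<dots> = lin (\<lambda>_. 0) (ann q x w)"
    by (rule lin_cong) (use Suc length_ann in fastforce)
  finally show ?case by simp
qed (simp add: an_pow_kill)

lemma ex_an_pow_kill: "\<exists>N. (an x ^^ Suc N) (lin B c) = 0"
proof -
  define N where "N = Max (insert 0 (length ` snd ` set c))"
  have "length w \<le> N" if "(z, w) \<in> set c" for z w
    unfolding N_def using that by (intro Max_ge) force+
  then have "lin (\<lambda>w. (an x ^^ Suc N) (B w)) c = lin (\<lambda>_. 0) c"
    by (intro lin_cong) (use an_pow_kill le_imp_less_Suc in blast)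
  then show ?thesis by (intro exI[of _ N]) (simp only: bounded_clinear_lin[OF bcl_pow(2)] lin_zero)
qed

lemma norm_cr_pow_wold:
  assumes "\<forall>m\<le>N. an x (f m) = 0"
  shows "(norm ((cr x ^^ n) (\<Sum>m\<le>N. (cr x ^^ m) (f m))))\<^sup>2 = (\<Sum>m\<le>N. qf q (m + n) * (norm (f m))\<^sup>2)"
proof -
  have "(cr x ^^ n) (\<Sum>m\<le>N. (cr x ^^ m) (f m)) = (\<Sum>m\<le>N. (cr x ^^ (m + n)) (f m))"
    by (simp add: bcl_simps[OF bcl_pow(1)] funpow_add add.commute[of _ n])
  moreover have "(norm \<dots>)\<^sup>2 = (\<Sum>m\<le>N. (norm ((cr x ^^ (m + n)) (f m)))\<^sup>2)"
    by (rule pythagoras) (use assms in \<open>auto intro: cr_pow_orth\<close>)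
  ultimately show ?thesis using assms norm_cr_pow by simp
qed

text \<open>In the Wold decomposition the squared norms are sums weighted by \<open>qf q m\<close>
  and \<open>qf q (m + n)\<close>, so the comparison reduces to quotients of q-factorials. Iterating
  one-step bounds would in general lose a factor at each step.\<close>

lemma cr_pow_bounds_lin:
  "(norm ((cr x ^^ n) (lin B c)))\<^sup>2 \<le> U_bound q * kap q ^ (2 * n) * (norm (lin B c))\<^sup>2"
  "kap q ^ (2 * n) * (norm (lin B c))\<^sup>2 \<le> C_const q * (norm ((cr x ^^ n) (lin B c)))\<^sup>2"
proof -
  obtain N f where f: "\<forall>m\<le>N. an x (f m) = 0" and c: "lin B c = (\<Sum>m\<le>N. (cr x ^^ m) (f m))"
    using ex_an_pow_kill wold by metis
  have 0: "(norm (lin B c))\<^sup>2 = (\<Sum>m\<le>N. qf q m * (norm (f m))\<^sup>2)"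
    using norm_cr_pow_wold[OF f, of 0] by (simp add: c)
  have 1: "(norm ((cr x ^^ n) (lin B c)))\<^sup>2 = (\<Sum>m\<le>N. qf q (m + n) * (norm (f m))\<^sup>2)"
    unfolding c by (rule norm_cr_pow_wold[OF f])
  show "(norm ((cr x ^^ n) (lin B c)))\<^sup>2 \<le> U_bound q * kap q ^ (2 * n) * (norm (lin B c))\<^sup>2"
    unfolding 0 1 sum_distrib_left mult.assoc[symmetric]
    by (intro sum_mono mult_right_mono qf_upper q1 q2) auto
  show "kap q ^ (2 * n) * (norm (lin B c))\<^sup>2 \<le> C_const q * (norm ((cr x ^^ n) (lin B c)))\<^sup>2"
    unfolding 0 1 sum_distrib_left mult.assoc[symmetric]
    by (intro sum_mono mult_right_mono qf_lower q1 q2) auto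
qed

lemma cr_pow_upper: "norm ((cr x ^^ n) v) \<le> sqrt (U_bound q) * kap q ^ n * norm v"
proof (rule dense_induct[where P = "\<lambda>v. norm ((cr x ^^ n) v) \<le> sqrt (U_bound q) * kap q ^ n * norm v"])
  show "closed {v. norm ((cr x ^^ n) v) \<le> sqrt (U_bound q) * kap q ^ n * norm v}"
    by (intro closed_Collect_le continuous_intros linear_continuous_on bounded_clinear_bl bcl_pow)
  fix c
  have "(norm ((cr x ^^ n) (lin B c)))\<^sup>2 \<le> (sqrt (U_bound q) * kap q ^ n * norm (lin B c))\<^sup>2"
    using cr_pow_bounds_lin(1)[where n = n and c = c and x = x] U_ge_1[OF q1 q2] by (simp add: power_mult_distrib power_mult[symmetric] mult.commute)
  then show "norm ((cr x ^^ n) (lin B c)) \<le> sqrt (U_bound q) * kap q ^ n * norm (lin B c)"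
    by (rule power2_le_imp_le) (use kap_pos[OF q1 q2] U_ge_1[OF q1 q2] in auto)
qed

lemma an_pow_upper: "norm ((an x ^^ n) v) \<le> sqrt (U_bound q) * kap q ^ n * norm v"
  by (rule adjoint_pair_bound[OF cinner_an_pow cr_pow_upper]) (use kap_pos[OF q1 q2] U_ge_1[OF q1 q2] in auto)

lemma cr_pow_lower: "kap q ^ n * norm v \<le> sqrt (C_const q) * norm ((cr x ^^ n) v)"
proof (rule dense_induct[where P = "\<lambda>v. kap q ^ n * norm v \<le> sqrt (C_const q) * norm ((cr x ^^ n) v)"])
  show "closed {v. kap q ^ n * norm v \<le> sqrt (C_const q) * norm ((cr x ^^ n) v)}"
    by (intro closed_Collect_le continuous_intros linear_continuous_on bounded_clinear_bl bcl_pow)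
  fix c
  have "(kap q ^ n * norm (lin B c))\<^sup>2 \<le> (sqrt (C_const q) * norm ((cr x ^^ n) (lin B c)))\<^sup>2"
    using cr_pow_bounds_lin(2)[where n = n and c = c and x = x] C_const_ge_1[OF q1 q2] by (simp add: power_mult_distrib power_mult[symmetric] mult.commute)
  then show "kap q ^ n * norm (lin B c) \<le> sqrt (C_const q) * norm ((cr x ^^ n) (lin B c))"
    by (rule power2_le_imp_le) (use C_const_ge_1[OF q1 q2] in auto)
qed

text \<open>\<open>F n\<close> need not be linear, so that the antilinear variable of an inner
  product is covered too.\<close>

lemma tendsto_dense:
  fixes F :: "nat \<Rightarrow> 'h \<Rightarrow> 'b::real_normed_vector"
  assumes lip: "\<And>n x y. norm (F n x - F n y) \<le> K * norm (x - y)"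
    and lim: "\<And>c. (\<lambda>n. F n (lin B c)) \<longlonglongrightarrow> 0"
  shows "(\<lambda>n. F n x) \<longlonglongrightarrow> 0"
proof (rule metric_LIMSEQ_I)
  fix e :: real assume e: "e > 0"
  define K' where "K' = \<bar>K\<bar> + 1"
  have K'0: "K' > 0" by (simp add: K'_def)
  have K'1: "norm (F n x - F n y) \<le> K' * norm (x - y)" for n x y
  proof -
    have "K * norm (x - y) \<le> K' * norm (x - y)" unfolding K'_def by (rule mult_right_mono) auto
    then show ?thesis using lip[of n x y] by linarith
  qed
  note K' = K'0 K'1
  have "x \<in> closure (cspan (range B))" using total by simp
  then have "x \<in> closure (range (lin B))" by (simp add: cspan_range_lin)
  moreover have "e / (2 * K') > 0" using e K'(1) by simp
  ultimately obtain y where "y \<in> range (lin B)" "dist y x < e / (2 * K')"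
    unfolding closure_approachable by blast
  then obtain c where c: "norm (x - lin B c) < e / (2 * K')"
    by (auto simp: dist_norm norm_minus_commute)
  obtain N where N: "\<And>n. n \<ge> N \<Longrightarrow> dist (F n (lin B c)) 0 < e / 2"
    using metric_LIMSEQ_D[OF lim, of "e / 2" c] e by auto
  have "dist (F n x) 0 < e" if "n \<ge> N" for n
  proof -
    have "norm (F n x - F n (lin B c)) \<le> K' * norm (x - lin B c)" by (rule K')
    also have "\<dots> < e / 2" using mult_strict_left_mono[OF c K'(1)] K'(1) by (simp add: field_simps)
    finally have "norm (F n x) < e / 2 + norm (F n (lin B c))"
      using norm_triangle_ineq2[of "F n x" "F n (lin B c)"] by linarith
    then show ?thesis using N[OF that] by simp
  qed
  then show "\<exists>N. \<forall>n\<ge>N. dist (F n x) 0 < e" by blast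
qed

lemma tendsto_dense_clinear:
  assumes F: "\<And>n. bounded_clinear (F n)" "\<And>n x. norm (F n x) \<le> K * norm x"
    and lim: "\<And>w. (\<lambda>n. F n (B w)) \<longlonglongrightarrow> 0"
  shows "(\<lambda>n. F n x) \<longlonglongrightarrow> 0"
proof (rule tendsto_dense)
  show "norm (F n x - F n y) \<le> K * norm (x - y)" for n x y
    using F by (simp flip: bounded_clinear_diff)
  show "(\<lambda>n. F n (lin B c)) \<longlonglongrightarrow> 0" for c
  proof (induction c)
    case (Cons p c)
    obtain z w where p: "p = (z, w)" by force
    have "(\<lambda>n. z *\<^sub>C F n (B w) + F n (lin B c)) \<longlonglongrightarrow> z *\<^sub>C 0 + 0"
      by (intro tendsto_add Cons scaleC.tendsto tendsto_const lim)
    then show ?case by (simp add: p bcl_simps[OF F(1)])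
  qed (simp add: bcl_simps[OF F(1)])
qed

end


section \<open>Asymptotic orthogonality of left and right tensors\<close>

lemma funpow_commute: "(\<And>v. f (g v) = g (f v)) \<Longrightarrow> (f ^^ m) ((g ^^ n) v) = (g ^^ n) ((f ^^ m) v)"
proof (induction m)
  case (Suc m)
  have "f ((g ^^ n) u) = (g ^^ n) (f u)" for u by (induction n) (simp_all add: Suc.prems)
  then show ?case using Suc by simp
qed simp

lemma power_double: "x ^ (2 * n) = x ^ n * x ^ n" for x :: real
  by (simp add: mult_2 power_add)

lemma set_rann_Cons:
  "(z, u) \<in> set (rann q x (c # w)) \<Longrightarrow> (x = c \<and> u = w) \<or> (\<exists>u'. u = c # u' \<and> (z, u') \<in> set (rann q x w))"
  by (auto simp: rann.simps(2) split: if_splits)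

lemma mset_rann: "(z, u) \<in> set (rann q x w) \<Longrightarrow> mset w = add_mset x (mset u)"
proof (induction w arbitrary: z u)
  case (Cons c w)
  from set_rann_Cons[OF Cons.prems] Cons.IH show ?case by auto
qed simp

lemma rann_notin: "x \<notin> set w \<Longrightarrow> rann q x w = []"
  by (induction w) (auto simp: rann.simps(2))

context q_fock
begin

interpretation R: q_fock q "\<lambda>w. B (flip w)" by (rule mirror)

lemma Gam_cr_pow: "Gam ((cr x ^^ k) v) = q ^ k *\<^sub>R (cr x ^^ k) (Gam v)"
  by (induction k) (simp_all add: Gam_cr bcl_crs)

lemma R_an_cr_pow:
  assumes "x = (\<not> y)"
  shows "R.an y ((cr x ^^ k) v) = (cr x ^^ k) (R.an y v) + qn q k *\<^sub>R (cr x ^^ (k - 1)) (Gam v)"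
proof (induction k)
  case (Suc k)
  have "cr x (qn q k *\<^sub>R (cr x ^^ (k - 1)) (Gam v)) = qn q k *\<^sub>R (cr x ^^ k) (Gam v)"
    by (cases k) (simp_all add: bcl_crs)
  then show ?case
    using assms Suc by (simp add: R_an_cr Gam_cr_pow bcl_crs qn_Suc' scaleR_add_left)
qed simp

text \<open>Creation of e-bar^k, normalized dually to the q-factorial so that right annihilation
  lowers \<open>k\<close> without a coefficient in \<open>ran_gam_Suc\<close>.\<close>

definition gam :: "nat \<Rightarrow> 'h \<Rightarrow> 'h" where
  "gam k v = (kap q ^ k / qf q k) *\<^sub>R (cr False ^^ k) v"

definition ran :: "nat \<Rightarrow> 'h \<Rightarrow> 'h" where
  "ran m v = (1 / kap q ^ m) *\<^sub>R (R.an True ^^ m) v"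

lemma bcl_gam [intro, simp]: "bounded_clinear (gam k)" and bcl_ran [intro, simp]: "bounded_clinear (ran m)"
  unfolding gam_def[abs_def] ran_def[abs_def] by (auto intro!: bounded_clinear_rmult R.bcl_pow)

lemma norm_gam: "norm (gam k v) \<le> sqrt (U_bound q) * C_const q * norm v"
proof -
  have d: "1 \<le> C_const q * d_const q k" using d_lower[OF q1 q2, of 0 k] by simp
  have dp: "d_const q k > 0" by (rule d_const_pos[OF q1 q2])
  have k: "kap q > 0" by (rule kap_pos[OF q1 q2])
  have "norm (gam k v) \<le> (kap q ^ k / qf q k) * (sqrt (U_bound q) * kap q ^ k * norm v)"
    unfolding gam_def using qf_pos[OF q1 q2, of k] k cr_pow_upper[of k False v]
    by (simp add: divide_right_mono mult_left_mono)
  also have "\<dots> = (1 / d_const q k) * (sqrt (U_bound q) * norm v)"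
    using k dp by (simp add: qf_eq[OF q1 q2] mult_2 power_add)
  also have "\<dots> \<le> C_const q * (sqrt (U_bound q) * norm v)"
    using d dp U_ge_1[OF q1 q2] by (intro mult_right_mono) (auto simp: divide_le_eq)
  finally show ?thesis by (simp add: mult_ac)
qed

text \<open>The right annihilator removes an e-bar either from \<open>v\<close> or from the prefix;
  in the latter case it crosses all of \<open>v\<close>, whence \<open>Gam\<close>.\<close>

lemma ran_gam_Suc:
  "ran (Suc m) (gam k v) = ran m (gam k ((1 / kap q) *\<^sub>R R.an True v)) + (if k = 0 then 0 else ran m (gam (k - 1) (Gam v)))"
proof -
  have k: "kap q > 0" by (rule kap_pos[OF q1 q2])
  have "(1 / kap q) *\<^sub>R R.an True (gam k v) = gam k ((1 / kap q) *\<^sub>R R.an True v) + (if k = 0 then 0 else gam (k - 1) (Gam v))"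
  proof (cases k)
    case (Suc j)
    have "kap q ^ k / qf q k * qn q k / kap q = kap q ^ j / qf q j"
      using k qn_pos[OF q1 q2, of j] by (simp add: Suc qf_Suc)
    moreover have "R.an True ((cr False ^^ k) v) = (cr False ^^ k) (R.an True v) + qn q k *\<^sub>R (cr False ^^ j) (Gam v)"
      by (subst R_an_cr_pow) (simp_all add: Suc)
    ultimately show ?thesis
      using k by (simp add: gam_def bcl_simps[OF R.bcl_an] bcl_simps[OF bcl_pow(1)] scaleR_add_right Suc mult.commute
          del: funpow.simps)
  qed (simp add: gam_def bcl_simps[OF R.bcl_an])
  moreover have "ran (Suc m) u = ran m ((1 / kap q) *\<^sub>R R.an True u)" for u
    by (simp add: ran_def funpow_swap1 bcl_simps[OF R.bcl_pow(2)] bcl_simps[OF R.bcl_an])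
  ultimately have "ran (Suc m) (gam k v) = ran m (gam k ((1 / kap q) *\<^sub>R R.an True v) + (if k = 0 then 0 else gam (k - 1) (Gam v)))"
    by simp
  then show ?thesis by (simp only: bounded_clinear_add[OF bcl_ran] if_distrib[of "ran m"] bounded_clinear_zero[OF bcl_ran])
qed

text \<open>The constant must not depend on \<open>k\<close>, since the recursion in
  \<open>m\<close> changes \<open>k\<close>.\<close>

definition decays :: "real \<Rightarrow> 'h \<Rightarrow> bool" where
  "decays t v \<longleftrightarrow> (\<exists>D\<ge>0. \<forall>m k. norm (ran m (gam k v)) \<le> D * t ^ m)"

lemma decays_lin: "(\<And>z w. (z, w) \<in> set c \<Longrightarrow> decays t (B w)) \<Longrightarrow> decays t (lin B c)"
proof (induction c)
  case Nil
  then show ?case by (auto simp: decays_def bcl_simps[OF bcl_ran] bcl_simps[OF bcl_gam] intro!: exI[of _ 0])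
next
  case (Cons p c)
  obtain z w where p: "p = (z, w)" by force
  obtain D1 where D1: "D1 \<ge> 0" "\<And>m k. norm (ran m (gam k (B w))) \<le> D1 * t ^ m"
    using Cons.prems[of z w] by (auto simp: p decays_def)
  obtain D2 where D2: "D2 \<ge> 0" "\<And>m k. norm (ran m (gam k (lin B c))) \<le> D2 * t ^ m"
    using Cons.IH Cons.prems by (auto simp: decays_def)
  have "norm (ran m (gam k (lin B (p # c)))) \<le> (cmod z * D1 + D2) * t ^ m" for m k
  proof -
    have "norm (ran m (gam k (lin B (p # c)))) \<le> cmod z * norm (ran m (gam k (B w))) + norm (ran m (gam k (lin B c)))"
      by (simp add: p bcl_simps[OF bcl_ran] bcl_simps[OF bcl_gam]) (metis norm_scaleC norm_triangle_ineq)
    also have "\<dots> \<le> cmod z * (D1 * t ^ m) + D2 * t ^ m"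
      using D1(2) D2(2) by (intro add_mono mult_left_mono) auto
    finally show ?thesis by (simp add: algebra_simps)
  qed
  then show ?case using D1(1) D2(1) unfolding decays_def
    by (intro exI[of _ "cmod z * D1 + D2"]) auto
qed

lemma word_decays:
  assumes t: "\<bar>q\<bar> < t" and w: "True \<in> set w"
  shows "decays t (B w)"
  using w
proof (induction "length w" arbitrary: w rule: less_induct)
  case less
  have k: "kap q > 0" by (rule kap_pos[OF q1 q2])
  have tp: "t > 0" using t by linarith
  have "decays t (lin B (rann q False w))"
  proof (rule decays_lin)
    fix z u assume zu: "(z, u) \<in> set (rann q False w)"
    have "mset w = add_mset False (mset u)" using mset_rann[OF zu] by simp
    then have "True \<in> set u" "length u < length w"
      using less.prems by (metis set_mset_mset set_mset_add_mset_insert insert_iff, metis size_mset size_add_mset lessI)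
    then show "decays t (B u)" by (rule less.hyps[rotated])
  qed
  then obtain D' where D': "D' \<ge> 0" "\<And>m k. norm (ran m (gam k (R.an True (B w)))) \<le> D' * t ^ m"
    by (auto simp: R_an_B decays_def)
  \<comment> \<open>Chosen such that D covers m = 0 and satisfies D'/kap + |q| D \<le> t D, which is
    the induction step in \<open>m\<close>.\<close>
  define D where "D = sqrt (U_bound q) * C_const q * norm (B w) + D' / (kap q * (t - \<bar>q\<bar>))"
  have D0: "sqrt (U_bound q) * C_const q * norm (B w) \<le> D" and D: "D' / kap q \<le> (t - \<bar>q\<bar>) * D" "D \<ge> 0"
  proof -
    have a: "0 \<le> sqrt (U_bound q) * C_const q * norm (B w)"
      using U_ge_1[OF q1 q2] C_const_ge_1[OF q1 q2] by simp
    have b: "0 \<le> D' / (kap q * (t - \<bar>q\<bar>))" using D'(1) k t by simp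
    show "sqrt (U_bound q) * C_const q * norm (B w) \<le> D" "D \<ge> 0" using a b by (simp_all add: D_def)
    have "D' / kap q = (t - \<bar>q\<bar>) * (D' / (kap q * (t - \<bar>q\<bar>)))" using t k by simp
    also have "\<dots> \<le> (t - \<bar>q\<bar>) * D" using t a by (intro mult_left_mono) (auto simp: D_def)
    finally show "D' / kap q \<le> (t - \<bar>q\<bar>) * D" .
  qed
  have "norm (ran m (gam k (B w))) \<le> D * t ^ m" for m k
  proof (induction m arbitrary: k)
    case 0
    show ?case using norm_gam[of k "B w"] D0 by (simp add: ran_def)
  next
    case (Suc m)
    have len: "length w > 0" using less.prems by auto
    have 1: "norm (ran m (gam k ((1 / kap q) *\<^sub>R R.an True (B w)))) \<le> D' / kap q * t ^ m"
      using D'(2)[of m k] k by (simp add: bcl_simps[OF bcl_ran] bcl_simps[OF bcl_gam] divide_right_mono)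
    have 2: "norm (if k = 0 then 0 else ran m (gam (k - 1) (Gam (B w)))) \<le> \<bar>q\<bar> * (D * t ^ m)"
    proof (cases "k = 0")
      case False
      have "norm (ran m (gam (k - 1) (Gam (B w)))) = \<bar>q\<bar> ^ length w * norm (ran m (gam (k - 1) (B w)))"
        by (simp add: Gam_B bcl_simps[OF bcl_ran] bcl_simps[OF bcl_gam] power_abs)
      also have "\<dots> \<le> \<bar>q\<bar> ^ 1 * (D * t ^ m)"
        using Suc len abs_q[OF q1 q2] by (intro mult_mono power_decreasing) (auto simp: Suc_le_eq)
      finally show ?thesis using False by simp
    qed (use D tp in simp)
    have "norm (ran (Suc m) (gam k (B w))) \<le> D' / kap q * t ^ m + \<bar>q\<bar> * (D * t ^ m)"
      unfolding ran_gam_Suc by (rule norm_triangle_le) (use 1 2 in linarith)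
    also have "\<dots> \<le> (t - \<bar>q\<bar>) * D * t ^ m + \<bar>q\<bar> * (D * t ^ m)"
      using D tp by (intro add_right_mono mult_right_mono) auto
    finally show ?case by (simp add: algebra_simps)
  qed
  then show ?case using D(2) by (auto simp: decays_def)
qed

lemma word_decays_LIMSEQ:
  assumes "True \<in> set w"
  shows "(\<lambda>n. (1 / kap q ^ (2 * n)) *\<^sub>R (R.an True ^^ n) ((cr False ^^ n) (B w))) \<longlonglongrightarrow> 0"
proof -
  define t where "t = (1 + \<bar>q\<bar>) / 2"
  have t: "\<bar>q\<bar> < t" "t < 1" "0 \<le> t" using abs_q[OF q1 q2] by (auto simp: t_def)
  have k: "kap q > 0" by (rule kap_pos[OF q1 q2])
  obtain D where D: "D \<ge> 0" "\<And>m k. norm (ran m (gam k (B w))) \<le> D * t ^ m"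
    using word_decays[OF t(1) assms] by (auto simp: decays_def)
  have eq: "(1 / kap q ^ (2 * n)) *\<^sub>R (R.an True ^^ n) ((cr False ^^ n) (B w)) = d_const q n *\<^sub>R ran n (gam n (B w))" for n
    using k d_const_pos[OF q1 q2, of n]
    by (simp add: ran_def gam_def qf_eq[OF q1 q2] bcl_simps[OF R.bcl_pow(2)] mult_2 power_add)
  show ?thesis
  proof (rule Lim_null_comparison)
    show "\<forall>\<^sub>F n in sequentially. norm ((1 / kap q ^ (2 * n)) *\<^sub>R (R.an True ^^ n) ((cr False ^^ n) (B w))) \<le> U_bound q * (D * t ^ n)"
    proof (rule always_eventually, rule allI)
      fix n
      have "\<bar>d_const q n\<bar> \<le> U_bound q" using d_upper[OF q1 q2, of 0 n] d_const_pos[OF q1 q2, of n] by simp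
      then show "norm ((1 / kap q ^ (2 * n)) *\<^sub>R (R.an True ^^ n) ((cr False ^^ n) (B w))) \<le> U_bound q * (D * t ^ n)"
        unfolding eq norm_scaleR using D by (intro mult_mono) auto
    qed
    have "(\<lambda>n. U_bound q * (D * t ^ n)) \<longlonglongrightarrow> U_bound q * (D * 0)"
      by (intro tendsto_intros LIMSEQ_power_zero) (use t in auto)
    then show "(\<lambda>n. U_bound q * (D * t ^ n)) \<longlonglongrightarrow> 0" by simp
  qed
qed

text \<open>Here the right annihilator removes letters f, each of which lies beyond the
  \<open>h\<close> letters e-bar and costs \<open>q ^ h\<close>.\<close>

lemma R_an_pow_word:
  "(R.an False ^^ n) ((cr True ^^ (p + n)) (B (replicate h False)))
    = (q ^ (h * n) * (qf q (p + n) / qf q p)) *\<^sub>R (cr True ^^ p) (B (replicate h False))"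
proof (induction n)
  case 0
  show ?case using qf_pos[OF q1 q2, of p] by simp
next
  case (Suc n)
  let ?x = "B (replicate h False)"
  have x: "R.an False ?x = 0" by (simp add: R_an_B rann_notin)
  have "(R.an False ^^ Suc n) ((cr True ^^ (p + Suc n)) ?x) = (R.an False ^^ n) (R.an False ((cr True ^^ Suc (p + n)) ?x))"
    by (simp add: funpow_swap1)
  also have "R.an False ((cr True ^^ Suc (p + n)) ?x) = (qn q (Suc (p + n)) * q ^ h) *\<^sub>R (cr True ^^ (p + n)) ?x"
    by (subst R_an_cr_pow) (simp_all add: x Gam_B bcl_simps[OF bcl_pow(1)] bcl_crs)
  finally show ?case
    using Suc by (simp add: bcl_simps[OF R.bcl_pow(2)] qf_Suc power_add mult_ac)
qed

text \<open>The tensor f^n e-bar^n v, normalized so that its norm is comparable to that of v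
  uniformly in n.\<close>

definition tau :: "nat \<Rightarrow> 'h \<Rightarrow> 'h" where
  "tau n v = (1 / kap q ^ (2 * n)) *\<^sub>R (cr True ^^ n) ((cr False ^^ n) v)"

lemma bcl_tau [intro, simp]: "bounded_clinear (tau n)"
  unfolding tau_def[abs_def] by (rule bounded_clinear_rmult[OF bounded_clinear_compose'[OF bcl_pow(1) bcl_pow(1)]])

lemma norm_tau: "norm (tau n v) \<le> U_bound q * norm v"
proof -
  have k: "kap q > 0" by (rule kap_pos[OF q1 q2])
  have U: "sqrt (U_bound q) * sqrt (U_bound q) = U_bound q" "U_bound q \<ge> 0" using U_ge_1[OF q1 q2] by auto
  have "norm ((cr True ^^ n) ((cr False ^^ n) v)) \<le> sqrt (U_bound q) * kap q ^ n * norm ((cr False ^^ n) v)"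
    by (rule cr_pow_upper)
  also have "\<dots> \<le> sqrt (U_bound q) * kap q ^ n * (sqrt (U_bound q) * kap q ^ n * norm v)"
    using k U by (intro mult_left_mono cr_pow_upper) auto
  also have "\<dots> = (sqrt (U_bound q) * sqrt (U_bound q)) * (kap q ^ n * kap q ^ n) * norm v"
    by (simp only: mult_ac)
  also have "\<dots> = U_bound q * norm v * kap q ^ (2 * n)"
    unfolding U(1) power_double by (simp only: mult_ac)
  finally show ?thesis using k unfolding tau_def by (simp add: divide_le_eq)
qed

lemma norm_tau_lower: "norm v \<le> C_const q * norm (tau n v)"
proof -
  have k: "kap q > 0" by (rule kap_pos[OF q1 q2])
  have C: "sqrt (C_const q) * sqrt (C_const q) = C_const q" "C_const q \<ge> 0" using C_const_ge_1[OF q1 q2] by auto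
  have "kap q ^ n * (kap q ^ n * norm v) \<le> kap q ^ n * (sqrt (C_const q) * norm ((cr False ^^ n) v))"
    using k by (intro mult_left_mono cr_pow_lower) auto
  also have "\<dots> = sqrt (C_const q) * (kap q ^ n * norm ((cr False ^^ n) v))" by simp
  also have "\<dots> \<le> sqrt (C_const q) * (sqrt (C_const q) * norm ((cr True ^^ n) ((cr False ^^ n) v)))"
    using C by (intro mult_left_mono cr_pow_lower) auto
  also have "\<dots> = (sqrt (C_const q) * sqrt (C_const q)) * norm ((cr True ^^ n) ((cr False ^^ n) v))"
    by simp
  finally have "kap q ^ (2 * n) * norm v \<le> C_const q * norm ((cr True ^^ n) ((cr False ^^ n) v))"
    unfolding C power_double by (simp only: mult_ac)
  then have "norm v * kap q ^ (2 * n) \<le> C_const q * norm ((cr True ^^ n) ((cr False ^^ n) v))"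
    by (simp only: mult.commute)
  then show ?thesis using k unfolding tau_def by (simp add: le_divide_eq)
qed

text \<open>The right vector ends with f^(n-p) e-bar^n. Its last n letters are moved to the other
  side as annihilators: if \<open>w\<close> contains f, they have to cross it and the result decays.
  If \<open>w\<close> is a power of e-bar, they find e-bar at no cost, and instead the letters
  f^(n-p) have to cross \<open>w\<close>.\<close>

lemma orth_term:
  assumes w: "w \<noteq> []"
  shows "(\<lambda>n. cinner (tau n (B w)) ((1 / kap q ^ (2 * n)) *\<^sub>R (R.cr True ^^ n) ((R.cr False ^^ (n - p)) v))) \<longlonglongrightarrow> 0"
    (is "?E \<longlonglongrightarrow> 0")
proof (rule LIMSEQ_offset[where k = p])
  have k: "kap q > 0" by (rule kap_pos[OF q1 q2])
  define c where "c n = 1 / kap q ^ (2 * n)" for n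
  have c: "c n \<ge> 0" for n using k by (simp add: c_def)
  \<comment> \<open>The index is already shifted by \<open>p\<close>, which turns the truncated
    \<open>n - p\<close> into n. The trailing letters e-bar have become right annihilators, and
    these commute with the creation of f on the left.\<close>
  have E: "?E (n + p) = c (n + p) * (c (n + p) * cinner ((cr True ^^ (n + p)) ((R.an True ^^ (n + p)) ((cr False ^^ (n + p)) (B w)))) ((R.cr False ^^ n) v))" for n
  proof -
    have "(R.an True ^^ m) ((cr True ^^ m) u) = (cr True ^^ m) ((R.an True ^^ m) u)" for m u
      by (rule funpow_commute) (simp add: R_an_cr)
    note sw = this
    have "?E (n + p) = c (n + p) * (c (n + p) * cinner ((cr True ^^ (n + p)) ((cr False ^^ (n + p)) (B w)))
        ((R.cr True ^^ (n + p)) ((R.cr False ^^ n) v)))"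
      unfolding tau_def c_def cinner_scaleR_left cinner_scaleR_right by simp
    then show ?thesis unfolding R.cinner_an_pow[symmetric] sw .
  qed
  consider "True \<in> set w" | "w = replicate (length w) False" "length w > 0"
  proof (cases "True \<in> set w")
    case False
    then have "\<forall>x\<in>set w. x = False" by auto
    then have "w = replicate (length w) False" by (metis replicate_length_same)
    then show ?thesis using that(2) w by blast
  qed
  then show "(\<lambda>n. ?E (n + p)) \<longlonglongrightarrow> 0"
  proof cases
    case 1
    define r where "r n = c n *\<^sub>R (R.an True ^^ n) ((cr False ^^ n) (B w))" for n
    have r: "(\<lambda>n. r (n + p)) \<longlonglongrightarrow> 0"
      using LIMSEQ_ignore_initial_segment[OF word_decays_LIMSEQ[OF 1], of p] by (simp add: r_def c_def)
    show ?thesis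
    proof (rule Lim_null_comparison)
      show "\<forall>\<^sub>F n in sequentially. cmod (?E (n + p)) \<le> U_bound q / kap q ^ p * norm v * norm (r (n + p))"
      proof (rule always_eventually, rule allI)
        fix n
        let ?N = "n + p"
        have U: "sqrt (U_bound q) * sqrt (U_bound q) = U_bound q" "U_bound q \<ge> 0" using U_ge_1[OF q1 q2] by auto
        have "?E ?N = c ?N * cinner ((cr True ^^ ?N) (r ?N)) ((R.cr False ^^ n) v)"
          unfolding E by (simp add: r_def bcl_simps[OF bcl_pow(1)] cinner_scaleR_left)
        then have "cmod (?E ?N) = c ?N * cmod (cinner ((cr True ^^ ?N) (r ?N)) ((R.cr False ^^ n) v))"
          using c by (simp add: norm_mult)
        also have "\<dots> \<le> c ?N * (norm ((cr True ^^ ?N) (r ?N)) * norm ((R.cr False ^^ n) v))"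
          using c by (intro mult_left_mono cinner_cauchy_schwarz) auto
        also have "\<dots> \<le> c ?N * ((sqrt (U_bound q) * kap q ^ ?N * norm (r ?N)) * (sqrt (U_bound q) * kap q ^ n * norm v))"
          using c k U by (intro mult_left_mono mult_mono cr_pow_upper R.cr_pow_upper) auto
        also have "\<dots> = (sqrt (U_bound q) * sqrt (U_bound q)) / kap q ^ p * norm v * norm (r ?N)"
        proof -
          have "c ?N * (kap q ^ ?N * kap q ^ n) = 1 / kap q ^ p"
            using k by (simp add: c_def power_double power_add)
          then have "c ?N * (kap q ^ ?N * kap q ^ n) * (sqrt (U_bound q) * sqrt (U_bound q) * norm v * norm (r ?N))
             = 1 / kap q ^ p * (sqrt (U_bound q) * sqrt (U_bound q) * norm v * norm (r ?N))" by (simp only:)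
          then show ?thesis by (simp only: mult_ac times_divide_eq_left times_divide_eq_right mult_1_left mult_1_right)
        qed
        finally show "cmod (?E ?N) \<le> U_bound q / kap q ^ p * norm v * norm (r ?N)" unfolding U .
      qed
      show "(\<lambda>n. U_bound q / kap q ^ p * norm v * norm (r (n + p))) \<longlonglongrightarrow> 0"
        using tendsto_mult[OF tendsto_const[of "U_bound q / kap q ^ p * norm v"] tendsto_norm[OF r]]
        by (simp only: norm_zero mult_zero_right)
    qed
  next
    case 2
    define h where "h = length w"
    have h: "h \<ge> 1" "w = replicate h False" using 2 by (auto simp: h_def Suc_le_eq)
    let ?x = "B (replicate h False)"
    have cF: "(cr False ^^ N) ?x = (R.cr True ^^ (h + N)) (B [])" for N
    proof -
      have "(R.cr True ^^ m) (B []) = B (replicate m False)" for m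
        using R.cr_pow_B[where x = True and n = m and w = "[]"] by (simp add: map_replicate_const)
      then show ?thesis by (simp add: cr_pow_B replicate_add[symmetric] add.commute)
    qed
    have xh: "(R.cr True ^^ h) (B []) = ?x" using cF[of 0] by simp
    have vac: "R.an True (B []) = 0" using R.an_vac[of True] by simp
    \<comment> \<open>All letters are e-bar, so this is a right creation power of the vacuum and no
      power of q appears.\<close>
    have ann: "(R.an True ^^ N) ((cr False ^^ N) ?x) = (qf q (h + N) / qf q h) *\<^sub>R ?x" for N
      unfolding cF R.an_pow_cr_pow[OF vac] xh ..
    define K where "K = cinner ((cr True ^^ p) ?x) v"
    have E2: "?E (n + p) = of_real (c (n + p) * (c (n + p) * (qf q (h + (n + p)) / qf q h * (q ^ (h * n) * (qf q (p + n) / qf q p))))) * K" for n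
    proof -
      have "cinner ((cr True ^^ (n + p)) ?x) ((R.cr False ^^ n) v) = of_real (q ^ (h * n) * (qf q (p + n) / qf q p)) * K"
        unfolding R.cinner_an_pow[symmetric] add.commute[of n p] R_an_pow_word K_def cinner_scaleR_left ..
      then show ?thesis
        unfolding E unfolding h(2) ann by (simp add: bcl_simps[OF bcl_pow(1)] cinner_scaleR_left)
    qed
    show ?thesis
    proof (rule Lim_null_comparison)
      show "\<forall>\<^sub>F n in sequentially. cmod (?E (n + p)) \<le> U_bound q * (U_bound q / qf q p) * cmod K * \<bar>q\<bar> ^ n"
      proof (rule always_eventually, rule allI)
        fix n
        let ?N = "n + p"
        have cN: "c ?N * kap q ^ (2 * ?N) = 1" using k by (simp add: c_def)
        have "c ?N * (qf q (h + ?N) / qf q h) \<le> c ?N * (U_bound q * kap q ^ (2 * ?N))"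
          using qf_upper[OF q1 q2, of h ?N] qf_pos[OF q1 q2, of h] c
          by (intro mult_left_mono) (auto simp: divide_le_eq)
        then have a: "c ?N * (qf q (h + ?N) / qf q h) \<le> U_bound q" using cN by (simp add: mult_ac)
        have "c ?N * qf q ?N \<le> c ?N * (U_bound q * kap q ^ (2 * ?N))"
          using qf_upper[OF q1 q2, of 0 ?N] c by (intro mult_left_mono) auto
        then have b: "c ?N * qf q ?N \<le> U_bound q" using cN by (simp add: mult_ac)
        have b': "c ?N * qf q ?N / qf q p \<le> U_bound q / qf q p"
          using b qf_pos[OF q1 q2, of p] by (intro divide_right_mono) auto
        have e: "\<bar>q\<bar> ^ (h * n) \<le> \<bar>q\<bar> ^ n"
          using abs_q[OF q1 q2] h by (intro power_decreasing) auto
        have "cmod (?E ?N) = (c ?N * (qf q (h + ?N) / qf q h)) * (c ?N * qf q ?N / qf q p) * cmod K * \<bar>q\<bar> ^ (h * n)"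
          unfolding E2 norm_mult norm_of_real
          using c[of ?N] qf_pos[OF q1 q2] by (simp add: abs_mult power_abs add.commute[of p n] less_imp_le mult_ac)
        also have "\<dots> \<le> U_bound q * (U_bound q / qf q p) * cmod K * \<bar>q\<bar> ^ n"
          using a b' e U_ge_1[OF q1 q2] c[of ?N] qf_pos[OF q1 q2, of p] qf_pos[OF q1 q2, of ?N] qf_pos[OF q1 q2, of h]
          by (intro mult_mono) (auto intro: less_imp_le intro!: divide_nonneg_pos mult_nonneg_nonneg)
        finally show "cmod (?E ?N) \<le> U_bound q * (U_bound q / qf q p) * cmod K * \<bar>q\<bar> ^ n" .
      qed
      have "(\<lambda>n. U_bound q * (U_bound q / qf q p) * cmod K * \<bar>q\<bar> ^ n) \<longlonglongrightarrow> U_bound q * (U_bound q / qf q p) * cmod K * 0"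
        by (intro tendsto_intros LIMSEQ_power_zero) (use abs_q[OF q1 q2] in auto)
      then show "(\<lambda>n. U_bound q * (U_bound q / qf q p) * cmod K * \<bar>q\<bar> ^ n) \<longlonglongrightarrow> 0" by simp
    qed
  qed
qed

end


section \<open>Uniform bounds and the relative commutant\<close>

lemma geometric_rev_le:
  fixes r :: real
  assumes "0 \<le> r" "r < 1"
  shows "(\<Sum>l\<le>n. r ^ (n - l)) \<le> 1 / (1 - r)"
proof -
  have "(\<Sum>l\<le>n. r ^ (n - l)) = (\<Sum>l\<le>n. r ^ l)"
    by (rule sum.reindex_bij_witness[of _ "\<lambda>l. n - l" "\<lambda>l. n - l"]) auto
  also have "\<dots> \<le> 1 / (1 - r)"
    using assms by (simp add: sum_gp0 divide_right_mono)
  finally show ?thesis .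
qed

lemma geometric_le: "0 \<le> r \<Longrightarrow> r < 1 \<Longrightarrow> (\<Sum>k\<le>n. r ^ k) \<le> 1 / (1 - r)" for r :: real
  by (simp add: sum_gp0 divide_right_mono)

text \<open>For small \<open>k\<close> and large \<open>l\<close> the power of mu alone is far
  bigger than mu^n; the factor Q^((n-k) l) has to supply the missing powers. This is what makes the
  normalized Wick operators uniformly bounded.\<close>

lemma mixed_sum_bound:
  fixes Q mu :: real
  assumes Q: "0 \<le> Q" "Q < 1" and mu: "0 < mu" "mu < 1"
  shows "\<exists>K\<ge>0. \<forall>n. (\<Sum>k\<le>n. \<Sum>l\<le>n. Q ^ ((n - k) * l) * mu ^ (k + (n - l))) \<le> K * mu ^ n"
proof -
  have "(\<lambda>n. Q ^ n) \<longlonglongrightarrow> 0" using Q by (intro LIMSEQ_power_zero) auto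
  then obtain N where N: "\<And>n. n \<ge> N \<Longrightarrow> Q ^ n < mu / 2"
    using LIMSEQ_D[of "\<lambda>n. Q ^ n" 0 "mu / 2"] mu Q by auto
  define b where "b = 1 / (mu ^ N * (1 - mu))"
  have b: "b \<ge> 0" using mu by (simp add: b_def)
  have inner: "(\<Sum>k\<le>n. Q ^ ((n - k) * l) * mu ^ (k + (n - l))) \<le> 2 * mu ^ n * mu ^ (n - l) + (if l < N then b * mu ^ n else 0)"
    if l: "l \<le> n" for n l
  proof (cases "l < N")
    case True
    have "(\<Sum>k\<le>n. Q ^ ((n - k) * l) * mu ^ (k + (n - l))) \<le> (\<Sum>k\<le>n. 1 * (mu ^ k * mu ^ (n - l)))"
      unfolding power_add using Q mu by (intro sum_mono mult_right_mono power_le_one) auto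
    also have "\<dots> = (\<Sum>k\<le>n. mu ^ k) * mu ^ (n - l)" by (simp add: sum_distrib_right)
    also have "\<dots> \<le> 1 / (1 - mu) * (mu ^ n / mu ^ N)"
    proof (intro mult_mono geometric_le)
      have "mu ^ (n - l) * mu ^ N \<le> mu ^ (n - l) * mu ^ l"
        using True mu by (intro mult_left_mono power_decreasing) auto
      also have "\<dots> = mu ^ n" using l by (simp flip: power_add)
      finally show "mu ^ (n - l) \<le> mu ^ n / mu ^ N" using mu by (simp add: le_divide_eq)
    qed (use mu in auto)
    also have "\<dots> = b * mu ^ n" by (simp add: b_def)
    finally show ?thesis using True mu by (simp add: add_increasing)
  next
    case False
    have "Q ^ ((n - k) * l) * mu ^ (k + (n - l)) \<le> (1/2) ^ (n - k) * (mu ^ n * mu ^ (n - l))" if k: "k \<le> n" for k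
    proof -
      have "Q ^ l \<le> mu / 2" using N[of l] False by simp
      then have "(Q ^ l) ^ (n - k) \<le> (mu / 2) ^ (n - k)" using Q by (intro power_mono) auto
      then have "Q ^ ((n - k) * l) \<le> (1/2) ^ (n - k) * mu ^ (n - k)"
        by (simp add: power_mult[symmetric] mult.commute power_divide)
      then have "Q ^ ((n - k) * l) * (mu ^ k * mu ^ (n - l)) \<le> (1/2) ^ (n - k) * mu ^ (n - k) * (mu ^ k * mu ^ (n - l))"
        using mu by (intro mult_right_mono) auto
      also have "\<dots> = (1/2) ^ (n - k) * (mu ^ (n - k) * mu ^ k) * mu ^ (n - l)" by (simp only: mult_ac)
      also have "mu ^ (n - k) * mu ^ k = mu ^ n" using k by (simp flip: power_add)
      finally show ?thesis by (simp add: power_add mult.assoc)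
    qed
    then have "(\<Sum>k\<le>n. Q ^ ((n - k) * l) * mu ^ (k + (n - l))) \<le> (\<Sum>k\<le>n. (1/2) ^ (n - k) * (mu ^ n * mu ^ (n - l)))"
      by (intro sum_mono) auto
    also have "\<dots> = (\<Sum>k\<le>n. (1/2) ^ (n - k)) * (mu ^ n * mu ^ (n - l))" by (simp add: sum_distrib_right)
    also have "\<dots> \<le> 2 * (mu ^ n * mu ^ (n - l))"
      using geometric_rev_le[of "1/2" n] mu by (intro mult_right_mono) auto
    finally show ?thesis using False by simp
  qed
  have "(\<Sum>k\<le>n. \<Sum>l\<le>n. Q ^ ((n - k) * l) * mu ^ (k + (n - l))) \<le> (2 / (1 - mu) + real N * b) * mu ^ n" for n
  proof -
    have "(\<Sum>k\<le>n. \<Sum>l\<le>n. Q ^ ((n - k) * l) * mu ^ (k + (n - l))) = (\<Sum>l\<le>n. \<Sum>k\<le>n. Q ^ ((n - k) * l) * mu ^ (k + (n - l)))"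
      by (rule sum.swap)
    also have "\<dots> \<le> (\<Sum>l\<le>n. 2 * mu ^ n * mu ^ (n - l) + (if l < N then b * mu ^ n else 0))"
      by (intro sum_mono inner) auto
    also have "\<dots> = 2 * mu ^ n * (\<Sum>l\<le>n. mu ^ (n - l)) + (\<Sum>l\<le>n. if l < N then b * mu ^ n else 0)"
      by (simp add: sum.distrib sum_distrib_left)
    also have "(\<Sum>l\<le>n. if l < N then b * mu ^ n else 0) = (\<Sum>l\<in>{..n} \<inter> {..<N}. b * mu ^ n)"
      by (subst sum.inter_restrict) auto
    also have "\<dots> = real (card ({..n} \<inter> {..<N})) * (b * mu ^ n)" by simp
    also have "\<dots> \<le> real N * (b * mu ^ n)"
      using b mu card_mono[of "{..<N}" "{..n} \<inter> {..<N}"] by (intro mult_right_mono) auto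
    also have "2 * mu ^ n * (\<Sum>l\<le>n. mu ^ (n - l)) \<le> 2 * mu ^ n * (1 / (1 - mu))"
      using mu by (intro mult_left_mono geometric_rev_le) auto
    finally show ?thesis by (simp add: algebra_simps)
  qed
  then show ?thesis using b mu by (intro exI[of _ "2 / (1 - mu) + real N * b"]) auto
qed

context q_aw
begin

lemma norm_normal_term:
  "norm ((cr True ^^ a) ((cr False ^^ b) ((an False ^^ c) ((an True ^^ d) v)))) \<le> (U_bound q)\<^sup>2 * kap q ^ (a + b + c + d) * norm v"
proof -
  have k: "kap q > 0" by (rule kap_pos[OF q1 q2])
  define s where "s = sqrt (U_bound q)"
  have s: "s \<ge> 0" "s ^ 4 = (U_bound q)\<^sup>2" using U_ge_1[OF q1 q2]
    by (simp_all add: s_def) (metis numeral_Bit0 power2_eq_square power_add real_sqrt_pow2 order.trans zero_le_one power4_eq_xxxx mult.assoc)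
  have "norm ((cr True ^^ a) ((cr False ^^ b) ((an False ^^ c) ((an True ^^ d) v))))
      \<le> s * kap q ^ a * (s * kap q ^ b * (s * kap q ^ c * (s * kap q ^ d * norm v)))"
    using k s(1) unfolding s_def
    by (intro order.trans[OF cr_pow_upper] order.trans[OF an_pow_upper] mult_left_mono order.refl) auto
  also have "\<dots> = s ^ 4 * kap q ^ (a + b + c + d) * norm v"
    by (simp add: power_add power4_eq_xxxx mult_ac)
  finally show ?thesis unfolding s(2) .
qed

definition wterm :: "nat \<Rightarrow> nat \<Rightarrow> nat \<Rightarrow> nat \<Rightarrow> 'h \<Rightarrow> 'h" where
  "wterm n m k l v = (qbin q n k * qbin q m l * q ^ ((n - k) * l) * mu ^ (k + (m - l))) *\<^sub>R
     (cr True ^^ k) ((cr False ^^ l) ((an False ^^ (n - k)) ((an True ^^ (m - l)) v)))"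

lemma W_wterm: "W n m v = (\<Sum>k\<le>n. \<Sum>l\<le>m. wterm n m k l v)"
  by (simp add: W_def wterm_def)

lemma norm_wterm:
  assumes "k \<le> n" "l \<le> m"
  shows "norm (wterm n m k l v) \<le> (C_const q)\<^sup>2 * (U_bound q)\<^sup>2 * kap q ^ (n + m) * norm v * (\<bar>q\<bar> ^ ((n - k) * l) * mu ^ (k + (m - l)))"
proof -
  have k: "kap q > 0" by (rule kap_pos[OF q1 q2])
  let ?X = "(cr True ^^ k) ((cr False ^^ l) ((an False ^^ (n - k)) ((an True ^^ (m - l)) v)))"
  have X: "norm ?X \<le> (U_bound q)\<^sup>2 * kap q ^ (n + m) * norm v"
  proof -
    have "k + l + (n - k) + (m - l) = n + m" using assms by simp
    then show ?thesis using norm_normal_term[of k l "n - k" "m - l" v] by metis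
  qed
  have b: "qbin q n k * qbin q m l \<le> C_const q * C_const q"
    using qbin_le[OF q1 q2] qbin_nonneg[OF q1 q2] C_const_ge_1[OF q1 q2] by (intro mult_mono) auto
  have "norm (wterm n m k l v) = (qbin q n k * qbin q m l) * (\<bar>q\<bar> ^ ((n - k) * l) * mu ^ (k + (m - l))) * norm ?X"
    using qbin_nonneg[OF q1 q2] mu1 by (simp add: wterm_def abs_mult power_abs mult.assoc)
  also have "\<dots> \<le> (C_const q * C_const q) * (\<bar>q\<bar> ^ ((n - k) * l) * mu ^ (k + (m - l))) * ((U_bound q)\<^sup>2 * kap q ^ (n + m) * norm v)"
    using b X mu1 C_const_ge_1[OF q1 q2] qbin_le[OF q1 q2] qbin_nonneg[OF q1 q2] by (intro mult_mono) auto
  finally show ?thesis by (simp add: power2_eq_square mult_ac)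
qed

text \<open>Just the existence of \<open>K\<close> is wanted, for the density argument in
  \<open>FF_LIMSEQ\<close>; the smallness condition comes from \<open>norm_PP_tau\<close>.\<close>

lemma norm_W: "\<exists>K\<ge>0. \<forall>n v. norm (W n n v) \<le> K * (kap q ^ (2 * n) * mu ^ n) * norm v"
proof -
  obtain K where K: "K \<ge> 0" "\<And>n. (\<Sum>k\<le>n. \<Sum>l\<le>n. \<bar>q\<bar> ^ ((n - k) * l) * mu ^ (k + (n - l))) \<le> K * mu ^ n"
    using mixed_sum_bound[of "\<bar>q\<bar>" mu] abs_q[OF q1 q2] mu1 mu2 by auto
  define M where "M = (C_const q)\<^sup>2 * (U_bound q)\<^sup>2"
  have M: "M \<ge> 0" by (simp add: M_def)
  have k: "kap q > 0" by (rule kap_pos[OF q1 q2])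
  have "norm (W n n v) \<le> M * K * (kap q ^ (2 * n) * mu ^ n) * norm v" for n v
  proof -
    have "norm (W n n v) \<le> (\<Sum>k\<le>n. \<Sum>l\<le>n. norm (wterm n n k l v))"
      unfolding W_wterm by (intro order.trans[OF norm_sum] sum_mono norm_sum)
    also have "\<dots> \<le> (\<Sum>k\<le>n. \<Sum>l\<le>n. M * kap q ^ (n + n) * norm v * (\<bar>q\<bar> ^ ((n - k) * l) * mu ^ (k + (n - l))))"
      unfolding M_def by (intro sum_mono norm_wterm) auto
    also have "\<dots> = M * kap q ^ (n + n) * norm v * (\<Sum>k\<le>n. \<Sum>l\<le>n. \<bar>q\<bar> ^ ((n - k) * l) * mu ^ (k + (n - l)))"
      by (simp only: sum_distrib_left)
    also have "\<dots> \<le> M * kap q ^ (n + n) * norm v * (K * mu ^ n)"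
      using M k by (intro mult_left_mono K) auto
    finally show ?thesis unfolding mult_2 by (simp only: mult_ac)
  qed
  then show ?thesis using M K(1) by (intro exI[of _ "M * K"]) auto
qed

lemma W_0_wterm: "W 0 n v = (\<Sum>l\<le>n. wterm 0 n 0 l v)"
  by (simp add: W_wterm)

lemma norm_wterm_0: 
  assumes "l \<le> n"
  shows "norm (wterm 0 n 0 l v) \<le> C_const q * U_bound q * kap q ^ n * norm v * mu ^ (n - l)"
proof -
  have k: "kap q > 0" by (rule kap_pos[OF q1 q2])
  have U: "sqrt (U_bound q) * sqrt (U_bound q) = U_bound q" "U_bound q \<ge> 0" using U_ge_1[OF q1 q2] by auto
  have "norm ((cr False ^^ l) ((an True ^^ (n - l)) v)) \<le> sqrt (U_bound q) * kap q ^ l * (sqrt (U_bound q) * kap q ^ (n - l) * norm v)"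
    using k U by (intro order.trans[OF cr_pow_upper] mult_left_mono an_pow_upper) auto
  also have "\<dots> = (sqrt (U_bound q) * sqrt (U_bound q)) * (kap q ^ l * kap q ^ (n - l)) * norm v" by (simp only: mult_ac)
  also have "\<dots> = U_bound q * kap q ^ n * norm v" using assms unfolding U by (simp flip: power_add)
  finally have X: "norm ((cr False ^^ l) ((an True ^^ (n - l)) v)) \<le> U_bound q * kap q ^ n * norm v" .
  have "norm (wterm 0 n 0 l v) = qbin q n l * mu ^ (n - l) * norm ((cr False ^^ l) ((an True ^^ (n - l)) v))"
    using qbin_nonneg[OF q1 q2] mu1 q1 q2 by (simp add: wterm_def abs_mult)
  also have "\<dots> \<le> C_const q * mu ^ (n - l) * (U_bound q * kap q ^ n * norm v)"
    using X mu1 C_const_ge_1[OF q1 q2] qbin_le[OF q1 q2] by (intro mult_mono) auto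
  finally show ?thesis by (simp add: mult_ac)
qed

text \<open>The part \<open>k = n\<close> of the normalized Wick operator; its factor mu^n has been
  divided out.\<close>

definition PP :: "nat \<Rightarrow> 'h \<Rightarrow> 'h" where
  "PP n v = (1 / kap q ^ (2 * n)) *\<^sub>R (cr True ^^ n) ((ys ^^ n) v)"

lemma bcl_PP [intro, simp]: "bounded_clinear (PP n)"
  unfolding PP_def[abs_def]
  by (rule bounded_clinear_rmult[OF bounded_clinear_compose'[OF bcl_pow(1) bounded_clinear_funpow[OF bcl_ys]]])

lemma norm_cr_pow_kap: "norm ((1 / kap q ^ (2 * n)) *\<^sub>R (cr True ^^ n) u) \<le> sqrt (U_bound q) / kap q ^ n * norm u"
proof -
  have k: "kap q > 0" by (rule kap_pos[OF q1 q2])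
  have "norm ((1 / kap q ^ (2 * n)) *\<^sub>R (cr True ^^ n) u) \<le> (1 / kap q ^ (2 * n)) * (sqrt (U_bound q) * kap q ^ n * norm u)"
    using k cr_pow_upper[where x = True and n = n and v = u] by (simp add: divide_right_mono)
  also have "\<dots> = sqrt (U_bound q) / kap q ^ n * norm u" using k by (simp add: power_double)
  finally show ?thesis .
qed

text \<open>The source of the smallness condition. The constant collects the q-binomial bound
  \<open>C_const q\<close>, one square root of \<open>U_bound q\<close> for each of the three
  operator powers, and the geometric sum over mu^p with p \<ge> 1; the term p = 0 is
  \<open>tau n\<close>.\<close>

lemma norm_PP_tau:
  "norm (PP n v - tau n v) \<le> C_const q * (U_bound q * sqrt (U_bound q)) * (mu / (1 - mu)) * norm v"
proof -
  have k: "kap q > 0" by (rule kap_pos[OF q1 q2])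
  have "(ys ^^ n) v = (\<Sum>l<n. wterm 0 n 0 l v) + wterm 0 n 0 n v"
    unfolding W_0[symmetric] W_0_wterm by (simp add: lessThan_Suc_atMost[symmetric])
  also have "wterm 0 n 0 n v = (cr False ^^ n) v" using q1 q2 by (simp add: wterm_def)
  finally have "PP n v - tau n v = (1 / kap q ^ (2 * n)) *\<^sub>R (cr True ^^ n) (\<Sum>l<n. wterm 0 n 0 l v)"
    by (simp add: PP_def tau_def bounded_clinear_add[OF bcl_pow(1)] scaleR_add_right)
  then have "norm (PP n v - tau n v) \<le> sqrt (U_bound q) / kap q ^ n * norm (\<Sum>l<n. wterm 0 n 0 l v)"
    using norm_cr_pow_kap by metis
  also have "norm (\<Sum>l<n. wterm 0 n 0 l v) \<le> (\<Sum>l<n. C_const q * U_bound q * kap q ^ n * norm v * mu ^ (n - l))"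
    by (rule order.trans[OF norm_sum]) (intro sum_mono norm_wterm_0, auto)
  also have "\<dots> = C_const q * U_bound q * kap q ^ n * norm v * (\<Sum>l<n. mu ^ (n - l))"
    by (simp only: sum_distrib_left)
  also have "(\<Sum>l<n. mu ^ (n - l)) \<le> mu / (1 - mu)"
  proof -
    have "(\<Sum>l\<le>n. mu ^ (n - l)) = (\<Sum>l<n. mu ^ (n - l)) + 1"
      by (simp add: lessThan_Suc_atMost[symmetric])
    then have "(\<Sum>l<n. mu ^ (n - l)) \<le> 1 / (1 - mu) - 1"
      using geometric_rev_le[of mu n] mu1 mu2 by simp
    then show ?thesis using mu2 by (simp add: field_simps)
  qed
  finally have "norm (PP n v - tau n v) \<le> sqrt (U_bound q) / kap q ^ n * (C_const q * U_bound q * kap q ^ n * norm v * (mu / (1 - mu)))"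
    using k U_ge_1[OF q1 q2] C_const_ge_1[OF q1 q2] by (simp add: mult_left_mono divide_right_mono)
  also have "\<dots> = C_const q * (U_bound q * sqrt (U_bound q)) * (mu / (1 - mu)) * norm v" using k by simp
  finally show ?thesis .
qed

lemma norm_PP: "\<exists>K\<ge>0. \<forall>n v. norm (PP n v) \<le> K * norm v"
proof -
  define K where "K = C_const q * (U_bound q * sqrt (U_bound q)) * (mu / (1 - mu)) + U_bound q"
  have "norm (PP n v) \<le> K * norm v" for n v
    using norm_triangle_sub[of "PP n v" "tau n v"] norm_PP_tau[of n v] norm_tau[of n v]
    by (simp add: K_def distrib_right)
  moreover have "K \<ge> 0" using U_ge_1[OF q1 q2] C_const_ge_1[OF q1 q2] mu1 mu2 by (simp add: K_def)
  ultimately show ?thesis by blast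
qed

lemma W_split_top: "W n n v = (\<Sum>k<n. \<Sum>l\<le>n. wterm n n k l v) + mu ^ n *\<^sub>R (cr True ^^ n) ((ys ^^ n) v)"
proof -
  have "wterm n n n l v = mu ^ n *\<^sub>R (cr True ^^ n) (wterm 0 n 0 l v)" for l
    using q1 q2 by (simp add: wterm_def bcl_simps[OF bcl_pow(1)] power_add mult_ac)
  then have "(\<Sum>l\<le>n. wterm n n n l v) = mu ^ n *\<^sub>R (cr True ^^ n) (\<Sum>l\<le>n. wterm 0 n 0 l v)"
    by (simp add: bcl_simps[OF bcl_pow(1)] scaleR_sum_right)
  then show ?thesis
    by (simp add: W_wterm lessThan_Suc_atMost[symmetric] W_0[symmetric])
qed

text \<open>A word admits at most as many annihilations as it has letters, so \<open>k\<close> and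
  \<open>l\<close> are close to n; as k < n, the exponent (n - k) l is then at least n -
  \<open>length w\<close>.\<close>

lemma wterm_word_bound:
  assumes n: "length w \<le> n" and k: "k < n" and l: "l \<le> n"
  shows "norm (wterm n n k l (B w)) \<le> (if n - length w \<le> k \<and> n - length w \<le> l
    then (C_const q)\<^sup>2 * (U_bound q)\<^sup>2 * kap q ^ (n + n) * norm (B w) * (\<bar>q\<bar> ^ (n - length w) * mu ^ (n - length w)) else 0)"
proof -
  have kp: "kap q > 0" by (rule kap_pos[OF q1 q2])
  consider "n - length w > k" | "n - length w > l" | "n - length w \<le> k \<and> n - length w \<le> l" by linarith
  then show ?thesis
  proof cases
    case 1
    then have "wterm n n k l (B w) = 0" using an_pow_kill'[of w "n - k" False "n - l" True] n
      by (simp add: wterm_def bcl_simps[OF bcl_pow(1)])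
    then show ?thesis using 1 by simp
  next
    case 2
    then have "wterm n n k l (B w) = 0" using an_pow_kill[of w "n - l" True] n
      by (simp add: wterm_def bcl_simps[OF bcl_pow(1)] bcl_simps[OF bcl_pow(2)])
    then show ?thesis using 2 by simp
  next
    case 3
    have "n - length w \<le> (n - k) * l"
    proof -
      have "1 * l \<le> (n - k) * l" by (rule mult_le_mono1) (use k in simp)
      then show ?thesis using 3 by linarith
    qed
    then have "\<bar>q\<bar> ^ ((n - k) * l) * mu ^ (k + (n - l)) \<le> \<bar>q\<bar> ^ (n - length w) * mu ^ (n - length w)"
      using abs_q[OF q1 q2] mu1 mu2 3 by (intro mult_mono power_decreasing) auto
    then have "norm (wterm n n k l (B w)) \<le> (C_const q)\<^sup>2 * (U_bound q)\<^sup>2 * kap q ^ (n + n) * norm (B w) * (\<bar>q\<bar> ^ (n - length w) * mu ^ (n - length w))"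
      using k l kp by (intro order.trans[OF norm_wterm] mult_left_mono) auto
    then show ?thesis using 3 by simp
  qed
qed

definition FF :: "nat \<Rightarrow> 'h \<Rightarrow> 'h" where
  "FF n v = (1 / (kap q ^ (2 * n) * mu ^ n)) *\<^sub>R W n n v - PP n v"

lemma FF_LIMSEQ: "(\<lambda>n. FF n v) \<longlonglongrightarrow> 0"
proof -
  have kp: "kap q > 0" by (rule kap_pos[OF q1 q2])
  have bFF: "bounded_clinear (FF n)" for n
    unfolding FF_def[abs_def] by (intro bounded_clinear_sub bounded_clinear_rmult bcl_W bcl_PP)
  obtain K where K: "K \<ge> 0" "\<And>n v. norm (W n n v) \<le> K * (kap q ^ (2 * n) * mu ^ n) * norm v"
    using norm_W by blast
  obtain K' where K': "K' \<ge> 0" "\<And>n v. norm (PP n v) \<le> K' * norm v" using norm_PP by blast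
  have nFF: "norm (FF n v) \<le> (K + K') * norm v" for n v
  proof -
    have "norm ((1 / (kap q ^ (2 * n) * mu ^ n)) *\<^sub>R W n n v) \<le> K * norm v"
      using K(2)[of n v] kp mu1 by (simp add: divide_le_eq mult_ac)
    then show ?thesis
      unfolding FF_def using norm_triangle_ineq4[of "(1 / (kap q ^ (2 * n) * mu ^ n)) *\<^sub>R W n n v" "PP n v"] K'(2)[of n v]
      by (simp only: distrib_right)
  qed
  show ?thesis
  proof (rule tendsto_dense_clinear[OF bFF nFF])
  fix w :: "bool list"
  define d where "d = length w"
  define M where "M = (C_const q)\<^sup>2 * (U_bound q)\<^sup>2 * norm (B w)"
  have M: "M \<ge> 0" by (simp add: M_def)
  \<comment> \<open>After the shift of n by the word length d there remain d choices of
    \<open>k\<close> and d + 1 of \<open>l\<close>, each contributing a constant multiple of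
    |q|^n.\<close>
  have bound: "norm (FF (n + d) (B w)) \<le> real d * (real d + 1) * (M / mu ^ d) * \<bar>q\<bar> ^ n" for n
  proof -
    let ?n = "n + d"
    let ?b = "M * kap q ^ (?n + ?n) * (\<bar>q\<bar> ^ n * mu ^ n)"
    have b: "?b \<ge> 0" using M kp mu1 by simp
    have "norm (\<Sum>k<?n. \<Sum>l\<le>?n. wterm ?n ?n k l (B w)) \<le> (\<Sum>k<?n. \<Sum>l\<le>?n. norm (wterm ?n ?n k l (B w)))"
      by (intro order.trans[OF norm_sum] sum_mono norm_sum)
    also have "\<dots> \<le> (\<Sum>k<?n. \<Sum>l\<le>?n. if n \<le> k \<and> n \<le> l then ?b else 0)"
    proof (intro sum_mono)
      fix k l assume kl: "k \<in> {..<?n}" "l \<in> {..?n}"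
      have e: "(C_const q)\<^sup>2 * (U_bound q)\<^sup>2 * kap q ^ (?n + ?n) * norm (B w) * (\<bar>q\<bar> ^ (?n - length w) * mu ^ (?n - length w)) = ?b"
        by (simp add: M_def d_def)
      have "length w \<le> ?n" "k < ?n" "l \<le> ?n" using kl by (auto simp: d_def)
      from wterm_word_bound[OF this] show "norm (wterm ?n ?n k l (B w)) \<le> (if n \<le> k \<and> n \<le> l then ?b else 0)"
        unfolding e by (simp add: d_def)
    qed
    also have "\<dots> = (\<Sum>k<?n. if n \<le> k then \<Sum>l\<le>?n. if n \<le> l then ?b else 0 else 0)"
      by (intro sum.cong[OF refl]) auto
    also have "(\<Sum>l\<le>?n. if n \<le> l then ?b else 0) = (\<Sum>l\<in>{n..?n}. ?b)"
      by (rule sum.mono_neutral_cong_right) auto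
    also have "(\<Sum>k<?n. if n \<le> k then \<Sum>l\<in>{n..?n}. ?b else 0) = (\<Sum>k\<in>{n..<?n}. \<Sum>l\<in>{n..?n}. ?b)"
      by (rule sum.mono_neutral_cong_right) auto
    also have "\<dots> = real d * (real d + 1) * ?b" by simp
    finally have 1: "norm (\<Sum>k<?n. \<Sum>l\<le>?n. wterm ?n ?n k l (B w)) \<le> real d * (real d + 1) * ?b" .
    have "FF ?n (B w) = (1 / (kap q ^ (2 * ?n) * mu ^ ?n)) *\<^sub>R (\<Sum>k<?n. \<Sum>l\<le>?n. wterm ?n ?n k l (B w))"
    proof -
      have "(1 / (kap q ^ (2 * m) * mu ^ m)) * mu ^ m = 1 / kap q ^ (2 * m)" for m using mu1 by simp
      then show ?thesis unfolding FF_def PP_def W_split_top scaleR_add_right scaleR_scaleR using mu1 by simp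
    qed
    then have "norm (FF ?n (B w)) = (1 / (kap q ^ (2 * ?n) * mu ^ ?n)) * norm (\<Sum>k<?n. \<Sum>l\<le>?n. wterm ?n ?n k l (B w))"
      using kp mu1 by simp
    also have "\<dots> \<le> (1 / (kap q ^ (2 * ?n) * mu ^ ?n)) * (real d * (real d + 1) * ?b)"
      using 1 kp mu1 by (intro mult_left_mono) auto
    also have "\<dots> = (1 / kap q ^ (2 * ?n) * kap q ^ (?n + ?n)) * (mu ^ n / mu ^ ?n) * (real d * (real d + 1) * M * \<bar>q\<bar> ^ n)"
      by simp
    also have "1 / kap q ^ (2 * ?n) * kap q ^ (?n + ?n) = 1" using kp by (simp only: mult_2) simp
    also have "mu ^ n / mu ^ ?n = 1 / mu ^ d" using mu1 by (simp add: power_add)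
    finally show ?thesis by simp
  qed
  show "(\<lambda>n. FF n (B w)) \<longlonglongrightarrow> 0"
  proof (rule LIMSEQ_offset[where k = d], rule Lim_null_comparison)
    show "\<forall>\<^sub>F n in sequentially. norm (FF (n + d) (B w)) \<le> real d * (real d + 1) * (M / mu ^ d) * \<bar>q\<bar> ^ n"
      using bound by simp
    have "(\<lambda>n. real d * (real d + 1) * (M / mu ^ d) * \<bar>q\<bar> ^ n) \<longlonglongrightarrow> real d * (real d + 1) * (M / mu ^ d) * 0"
      by (intro tendsto_intros LIMSEQ_power_zero) (use abs_q[OF q1 q2] in auto)
    then show "(\<lambda>n. real d * (real d + 1) * (M / mu ^ d) * \<bar>q\<bar> ^ n) \<longlonglongrightarrow> 0" by simp
  qed
  qed
qed

text \<open>On a fixed word the number of summands does not grow with n, so limits can be taken term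
  by term.\<close>

lemma PP_word:
  assumes n: "length w \<le> n"
  shows "PP n (B w) = (\<Sum>p\<le>length w. (qbin q n (n - p) * mu ^ p) *\<^sub>R
    ((1 / kap q ^ (2 * n)) *\<^sub>R (cr True ^^ n) ((cr False ^^ (n - p)) ((an True ^^ p) (B w)))))"
proof -
  have "(ys ^^ n) (B w) = (\<Sum>l\<le>n. wterm 0 n 0 l (B w))"
    unfolding W_0[symmetric] W_0_wterm ..
  also have "\<dots> = (\<Sum>p\<le>n. wterm 0 n 0 (n - p) (B w))"
    by (rule sum.reindex_bij_witness[of _ "\<lambda>l. n - l" "\<lambda>l. n - l"]) auto
  also have "\<dots> = (\<Sum>p\<le>length w. (qbin q n (n - p) * mu ^ p) *\<^sub>R (cr False ^^ (n - p)) ((an True ^^ p) (B w)))"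
  proof (rule sum.mono_neutral_cong_right)
    show "\<forall>i\<in>{..n} - {..length w}. wterm 0 n 0 (n - i) (B w) = 0"
      by (auto simp: wterm_def an_pow_kill bcl_simps[OF bcl_pow(1)])
  qed (use n q1 q2 in \<open>auto simp: wterm_def\<close>)
  finally have "PP n (B w) = (1 / kap q ^ (2 * n)) *\<^sub>R (cr True ^^ n)
      (\<Sum>p\<le>length w. (qbin q n (n - p) * mu ^ p) *\<^sub>R (cr False ^^ (n - p)) ((an True ^^ p) (B w)))"
    by (simp only: PP_def)
  then show ?thesis
    by (simp only: bounded_clinear_sum[OF bcl_pow(1)] bounded_clinear_scaleR[OF bcl_pow(1)] scaleR_sum_right
        scaleR_scaleR mult.commute)
qed

end

section \<open>Comparison of the two actions and the relative commutant\<close>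

context q_aw
begin

interpretation R: q_aw q "\<lambda>w. B (flip w)" mu by (rule mirror_aw)

lemma tau_R_PP_word:
  assumes w: "w \<noteq> []"
  shows "(\<lambda>n. cinner (tau n (B w)) (R.PP n (B (flip u)))) \<longlonglongrightarrow> 0"
proof -
  define E where "E p n = cinner (tau n (B w)) ((1 / kap q ^ (2 * n)) *\<^sub>R (R.cr True ^^ n) ((R.cr False ^^ (n - p)) ((R.an True ^^ p) (B (flip u)))))"
    for p n
  have E: "E p \<longlonglongrightarrow> 0" for p unfolding E_def by (rule orth_term[OF w])
  have t: "(\<lambda>n. of_real (qbin q n (n - p) * mu ^ p) * E p n) \<longlonglongrightarrow> 0" for p
  proof (rule Lim_null_comparison)
    have "\<bar>qbin q n (n - p)\<bar> \<le> C_const q" for n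
      using qbin_le[OF q1 q2] qbin_nonneg[OF q1 q2] by simp
    then show "\<forall>\<^sub>F n in sequentially. norm (of_real (qbin q n (n - p) * mu ^ p) * E p n) \<le> C_const q * mu ^ p * norm (E p n)"
      using mu1 by (intro always_eventually allI) (simp add: norm_mult abs_mult norm_power mult_right_mono)
    show "(\<lambda>n. C_const q * mu ^ p * norm (E p n)) \<longlonglongrightarrow> 0"
      using tendsto_mult[OF tendsto_const[of "C_const q * mu ^ p"] tendsto_norm[OF E[of p]]] by (simp only: norm_zero mult_zero_right)
  qed
  have "(\<lambda>n. \<Sum>p\<le>length u. of_real (qbin q n (n - p) * mu ^ p) * E p n) \<longlonglongrightarrow> (\<Sum>p\<le>length u. 0)"
    by (intro tendsto_sum t)
  then have lim: "(\<lambda>n. \<Sum>p\<le>length u. of_real (qbin q n (n - p) * mu ^ p) * E p n) \<longlonglongrightarrow> 0" by simp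
  show ?thesis
  proof (rule Lim_transform_eventually[OF lim])
    show "\<forall>\<^sub>F n in sequentially. (\<Sum>p\<le>length u. of_real (qbin q n (n - p) * mu ^ p) * E p n) = cinner (tau n (B w)) (R.PP n (B (flip u)))"
    proof (rule eventually_sequentiallyI)
      fix n assume "length u \<le> n"
      from R.PP_word[OF this]
      show "(\<Sum>p\<le>length u. of_real (qbin q n (n - p) * mu ^ p) * E p n) = cinner (tau n (B w)) (R.PP n (B (flip u)))"
        by (simp only: cinner.sum_right cinner_scaleR_right[of _ "qbin q n _ * mu ^ _"] E_def)
    qed
  qed
qed

lemma tau_R_PP:
  assumes u: "cinner (B []) u = 0"
  shows "(\<lambda>n. cinner (tau n u) (R.PP n v)) \<longlonglongrightarrow> 0"
proof -
  obtain K where K: "K \<ge> 0" "\<And>n v. norm (R.PP n v) \<le> K * norm v" using R.norm_PP by blast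
  have U: "U_bound q \<ge> 0" using U_ge_1[OF q1 q2] by simp
  have bnd: "cmod (cinner (tau n u) (R.PP n v)) \<le> U_bound q * norm u * (K * norm v)" for n u v
    using U K by (intro order.trans[OF cinner_cauchy_schwarz] mult_mono norm_tau) auto
  have 1: "(\<lambda>n. cinner (tau n (B w)) (R.PP n v)) \<longlonglongrightarrow> 0" if w: "w \<noteq> []" for w v
  proof (rule R.tendsto_dense[where K = "U_bound q * norm (B w) * K"])
    show "norm (cinner (tau n (B w)) (R.PP n x) - cinner (tau n (B w)) (R.PP n y)) \<le> U_bound q * norm (B w) * K * norm (x - y)" for n x y
      using bnd[of n "B w" "x - y"] by (simp add: bcl_simps[OF R.bcl_PP] cinner_diff_right mult.assoc)
    show "(\<lambda>n. cinner (tau n (B w)) (R.PP n (lin (\<lambda>w. B (flip w)) c))) \<longlonglongrightarrow> 0" for c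
    proof (induction c)
      case (Cons p c)
      obtain z x where p: "p = (z, x)" by force
      have "(\<lambda>n. z * cinner (tau n (B w)) (R.PP n (B (flip x))) + cinner (tau n (B w)) (R.PP n (lin (\<lambda>w. B (flip w)) c))) \<longlonglongrightarrow> z * 0 + 0"
        by (intro tendsto_intros tau_R_PP_word[OF w] Cons)
      then show ?case by (simp add: p bcl_simps[OF R.bcl_PP] cinner_add_right cinner_scaleC_right)
    qed (simp add: bcl_simps[OF R.bcl_PP])
  qed
  \<comment> \<open>Composition with the projection off the vacuum lets the density argument run
    over all formal combinations, including those with a vacuum component.\<close>
  define pr where "pr u = u - cinner (B []) u *\<^sub>C B []" for u
  have bpr: "bounded_clinear pr"
  proof -
    have "bounded_clinear (\<lambda>u. cinner (B []) u *\<^sub>C B [])"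
      by (rule bounded_clinearI)
        (auto simp: cinner_scaleC_right scaleC_scaleC
          intro!: bounded_linear_compose[OF scaleC.bounded_linear_left] cinner.bounded_linear_right)
    then show ?thesis unfolding pr_def[abs_def] by (intro bounded_clinear_sub) auto
  qed
  obtain L where L: "L > 0" "\<And>x. norm (pr x) \<le> L * norm x" using bounded_clinear_bound[OF bpr] by blast
  have "(\<lambda>n. cinner (tau n (pr u)) (R.PP n v)) \<longlonglongrightarrow> 0"
  proof (rule tendsto_dense[where F = "\<lambda>n u. cinner (tau n (pr u)) (R.PP n v)" and K = "U_bound q * L * (K * norm v)"])
    show "norm (cinner (tau n (pr x)) (R.PP n v) - cinner (tau n (pr y)) (R.PP n v)) \<le> U_bound q * L * (K * norm v) * norm (x - y)" for n x y
    proof -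
      have "norm (cinner (tau n (pr x)) (R.PP n v) - cinner (tau n (pr y)) (R.PP n v)) = cmod (cinner (tau n (pr (x - y))) (R.PP n v))"
        by (simp add: bcl_simps[OF bcl_tau] bcl_simps[OF bpr] cinner_diff_left)
      also have "\<dots> \<le> U_bound q * norm (pr (x - y)) * (K * norm v)" by (rule bnd)
      also have "\<dots> \<le> U_bound q * (L * norm (x - y)) * (K * norm v)"
        using U K L(2) by (intro mult_right_mono mult_left_mono) auto
      finally show ?thesis by (simp add: mult_ac)
    qed
    show "(\<lambda>n. cinner (tau n (pr (lin B c))) (R.PP n v)) \<longlonglongrightarrow> 0" for c
    proof (induction c)
      case (Cons p c)
      obtain z x where p: "p = (z, x)" by force
      have "(\<lambda>n. cinner (tau n (pr (B x))) (R.PP n v)) \<longlonglongrightarrow> 0"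
      proof (cases "x = []")
        case True
        then show ?thesis by (simp add: pr_def cinner_B bcl_simps[OF bcl_tau])
      next
        case False
        then have "cinner (B []) (B x) = 0" by (simp add: cinner_B)
        then show ?thesis using 1[OF False] by (simp add: pr_def)
      qed
      then have "(\<lambda>n. cnj z * cinner (tau n (pr (B x))) (R.PP n v) + cinner (tau n (pr (lin B c))) (R.PP n v)) \<longlonglongrightarrow> cnj z * 0 + 0"
        by (intro tendsto_intros Cons)
      then show ?case by (simp add: p bcl_simps[OF bcl_tau] bcl_simps[OF bpr] cinner_add_left cinner_scaleC_left)
    qed (simp add: bcl_simps[OF bcl_tau] bcl_simps[OF bpr])
  qed
  moreover have "pr u = u" using u by (simp add: pr_def)
  ultimately show ?thesis by simp
qed

theorem relative_commutant_scalar: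
  assumes small: "(C_const q)\<^sup>2 * (U_bound q * sqrt (U_bound q)) * (mu / (1 - mu)) < 1"
    and x: "x \<in> Malg" and comm: "\<And>n v. x (W n n v) = W n n (x v)"
  shows "\<exists>c. x = (\<lambda>v. c *\<^sub>C v)"
proof -
  have bx: "bounded_clinear x" by (rule Malg_bcl[OF x])
  have C: "C_const q \<ge> 1" and U: "U_bound q \<ge> 1" by (rule C_const_ge_1[OF q1 q2], rule U_ge_1[OF q1 q2])
  define c where "c = cinner (B []) (x (B []))"
  define z where "z = x (B []) - c *\<^sub>C B []"
  have vac: "cinner (B []) (B []) = 1" by (simp add: cinner_B)
  have z0: "cinner (B []) z = 0" by (simp add: z_def cinner_diff_right cinner_scaleC_right vac c_def)
  \<comment> \<open>\<open>x\<close> commutes with the left Wick operator by assumption and with the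
    right one because it lies in the algebra; on the vacuum both give the same vector.\<close>
  have WR: "W n n z = R.W n n z" for n
  proof -
    have "W n n (x (B [])) = x (R.W n n (B []))" by (simp add: comm[symmetric] R_W_vac)
    also have "\<dots> = R.W n n (x (B []))"
      by (rule R.W_commute[OF bx]) (simp_all add: Malg_R_gens[OF x])
    finally show ?thesis
      by (simp add: z_def bcl_simps[OF bcl_W] bcl_simps[OF R.bcl_W] R_W_vac)
  qed
  have FPP: "PP n z - R.PP n z = R.FF n z - FF n z" for n
    by (simp add: FF_def R.FF_def WR)
  have d0: "(\<lambda>n. PP n z - R.PP n z) \<longlonglongrightarrow> 0"
    unfolding FPP using tendsto_diff[OF R.FF_LIMSEQ[of z] FF_LIMSEQ[of z]] by simp
  have "(\<lambda>n. cinner (tau n z) (PP n z - R.PP n z)) \<longlonglongrightarrow> 0"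
  proof (rule Lim_null_comparison)
    show "\<forall>\<^sub>F n in sequentially. norm (cinner (tau n z) (PP n z - R.PP n z)) \<le> U_bound q * norm z * norm (PP n z - R.PP n z)"
      using norm_tau by (intro always_eventually allI order.trans[OF cinner_cauchy_schwarz] mult_right_mono) auto
    show "(\<lambda>n. U_bound q * norm z * norm (PP n z - R.PP n z)) \<longlonglongrightarrow> 0"
      using tendsto_mult[OF tendsto_const[of "U_bound q * norm z"] tendsto_norm[OF d0]] by (simp only: norm_zero mult_zero_right)
  qed
  then have "(\<lambda>n. cinner (tau n z) (PP n z - R.PP n z) + cinner (tau n z) (R.PP n z)) \<longlonglongrightarrow> 0 + 0"
    by (intro tendsto_add tau_R_PP z0)
  then have lim: "(\<lambda>n. cmod (cinner (tau n z) (PP n z))) \<longlonglongrightarrow> 0"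
    by (simp add: cinner_diff_right tendsto_norm_zero_iff)
  define e where "e = C_const q * (U_bound q * sqrt (U_bound q)) * (mu / (1 - mu))"
  have e: "C_const q * e < 1" using small by (simp add: e_def power2_eq_square mult_ac)
  \<comment> \<open>With t = norm (tau n z) the pairing is at least t (t - e norm z) in modulus, and
    t is at least norm z / C.\<close>
  define g where "g = (1 / C_const q) * (1 / C_const q - e)"
  have g: "g > 0"
  proof -
    have "e < 1 / C_const q" using e C by (simp add: less_divide_eq mult.commute)
    then show ?thesis using C by (simp add: g_def)
  qed
  have low: "g * (norm z)\<^sup>2 \<le> cmod (cinner (tau n z) (PP n z))" for n
  proof -
    let ?t = "norm (tau n z)"
    have t: "norm z / C_const q \<le> ?t" using norm_tau_lower[of z n] C by (simp add: divide_le_eq mult.commute)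
    have "cinner (tau n z) (PP n z) = of_real (?t\<^sup>2) + cinner (tau n z) (PP n z - tau n z)"
      by (simp add: cinner_diff_right cinner_self)
    then have "cmod (cinner (tau n z) (PP n z)) \<ge> ?t\<^sup>2 - cmod (cinner (tau n z) (PP n z - tau n z))"
      by (metis norm_diff_ineq norm_of_real abs_power2)
    moreover have "cmod (cinner (tau n z) (PP n z - tau n z)) \<le> ?t * (e * norm z)"
      unfolding e_def using norm_PP_tau[of n z]
      by (intro order.trans[OF cinner_cauchy_schwarz] mult_left_mono) auto
    ultimately have 1: "cmod (cinner (tau n z) (PP n z)) \<ge> ?t * (?t - e * norm z)"
      by (simp add: power2_eq_square right_diff_distrib)
    have "1 / C_const q - e > 0" using e C by (simp add: less_divide_eq mult.commute)
    then have "0 \<le> (1 / C_const q - e) * norm z" by simp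
    moreover have "(1 / C_const q - e) * norm z \<le> ?t - e * norm z" using t by (simp add: left_diff_distrib)
    ultimately have "norm z / C_const q * ((1 / C_const q - e) * norm z) \<le> ?t * (?t - e * norm z)"
      using t by (intro mult_mono) auto
    then show ?thesis using 1 by (simp add: g_def power2_eq_square mult_ac)
  qed
  have "g * (norm z)\<^sup>2 \<le> 0"
    by (rule LIMSEQ_le_const[OF lim]) (use low in auto)
  then have "z = 0" using g by (simp add: mult_le_0_iff)
  then have xv: "x (B []) = c *\<^sub>C B []" by (simp add: z_def)
  \<comment> \<open>Both sides commute with the right generators and agree on the vacuum, which is
    cyclic for the right action.\<close>
  have "x = (\<lambda>v. c *\<^sub>C v)"
    by (rule R.separating)
      (use bx xv in \<open>auto simp: Malg_R_gens[OF x] bcl_simps[OF R.bcl_yl] bcl_simps[OF R.bcl_ys]\<close>)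
  then show ?thesis by blast
qed

end


section \<open>Spectral measures\<close>

lemma projD:
  assumes "orthogonal_projection P"
  shows "bounded_clinear P" "P (P x) = P x" "cinner (P x) y = cinner x (P y)"
  using assms by (auto simp: orthogonal_projection_def fun_eq_iff)

lemma norm_proj_sq: "orthogonal_projection P \<Longrightarrow> complex_of_real ((norm (P x))\<^sup>2) = cinner x (P x)"
  by (metis cinner_self projD(2) projD(3))

lemma spectral_measureD:
  assumes "spectral_measure E"
  shows "A \<in> sets borel \<Longrightarrow> orthogonal_projection (E A)" "E UNIV = id"
    "range B \<subseteq> sets borel \<Longrightarrow> disjoint_family B \<Longrightarrow> (\<lambda>n::nat. E (B n) x) sums E (\<Union>n. B n) x"
  using assms by (auto simp: spectral_measure_def)

lemma spectral_empty:
  assumes E: "spectral_measure E"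
  shows "E {} x = 0"
proof -
  have "(\<lambda>n::nat. E {} x) sums E (\<Union>n::nat. {}) x"
    using spectral_measureD(3)[OF E, of "\<lambda>_. {}" x] by (simp add: disjoint_family_on_def)
  then have "(\<lambda>n::nat. E {} x) \<longlonglongrightarrow> 0" using sums_summable summable_LIMSEQ_zero by blast
  then show ?thesis by (simp add: LIMSEQ_const_iff)
qed

lemma spectral_Un:
  assumes E: "spectral_measure E" and AB: "A \<in> sets borel" "B \<in> sets borel" "A \<inter> B = {}"
  shows "E (A \<union> B) x = E A x + E B x"
proof -
  have "(\<lambda>n. E (binaryset A B n) x) sums E (\<Union>n. binaryset A B n) x"
    by (rule spectral_measureD(3)[OF E])
      (use AB in \<open>auto simp: disjoint_family_on_def binaryset_def\<close>)
  then have 1: "(\<lambda>n. E (binaryset A B n) x) sums E (A \<union> B) x" by (simp add: UN_binaryset_eq)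
  have "(\<lambda>n. E (binaryset A B n) x) sums (\<Sum>n\<in>{0,1}. E (binaryset A B n) x)"
    by (rule sums_finite) (auto simp: binaryset_def spectral_empty[OF E])
  then show ?thesis using sums_unique2[OF 1] by (simp add: binaryset_def)
qed

text \<open>Forced by \<open>E (A \<union> B)\<close> being a projection too: for y in the range of
  \<open>E B\<close>, the square of norm (E (A \<union> B) y), computed directly and as an inner
  product, gives two values that differ by twice the square of norm (E A y).\<close>

lemma spectral_disjoint:
  assumes E: "spectral_measure E" and AB: "A \<in> sets borel" "B \<in> sets borel" "A \<inter> B = {}"
  shows "E A (E B x) = 0"
proof -
  let ?y = "E B x"
  note P = spectral_measureD(1)[OF E AB(1)] and Q = spectral_measureD(1)[OF E AB(2)]
  note PQ = spectral_measureD(1)[OF E, of "A \<union> B"]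
  have "orthogonal_projection (E (A \<union> B))" using AB by (intro PQ) auto
  then have "complex_of_real ((norm (E (A \<union> B) ?y))\<^sup>2) = cinner ?y (E (A \<union> B) ?y)" by (rule norm_proj_sq)
  also have "\<dots> = cinner ?y (E A ?y) + cinner ?y ?y"
    by (simp add: spectral_Un[OF E AB] cinner_add_right projD(2)[OF Q])
  finally have 1: "(norm (E A ?y + ?y))\<^sup>2 = (norm (E A ?y))\<^sup>2 + (norm ?y)\<^sup>2"
    unfolding norm_proj_sq[OF P, symmetric] cinner_self spectral_Un[OF E AB] projD(2)[OF Q] of_real_add[symmetric] of_real_eq_iff .
  have "complex_of_real ((norm (E A ?y))\<^sup>2) = cnj (cinner (E A ?y) ?y)"
    using norm_proj_sq[OF P, of ?y] cinner_commute[of ?y "E A ?y"] by simp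
  then have "Re (cinner (E A ?y) ?y) = (norm (E A ?y))\<^sup>2"
    by (metis Re_complex_of_real complex_cnj_cancel_iff complex_cnj_complex_of_real)
  then have "(norm (E A ?y))\<^sup>2 = 0" using 1 norm_add_sq[of "E A ?y" ?y] by simp
  then show ?thesis by simp
qed

lemma spectral_Int:
  assumes E: "spectral_measure E" and AB: "A \<in> sets borel" "B \<in> sets borel"
  shows "E A (E B x) = E (A \<inter> B) x"
proof -
  have A: "E A y = E (A \<inter> B) y + E (A - B) y" for y
  proof -
    have "A \<inter> B \<in> sets borel" "A - B \<in> sets borel" "(A \<inter> B) \<inter> (A - B) = {}" using AB by auto
    from spectral_Un[OF E this] show ?thesis by (simp add: Int_Diff_Un)
  qed
  have B: "E B x = E (A \<inter> B) x + E (B - A) x"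
  proof -
    have "A \<inter> B \<in> sets borel" "B - A \<in> sets borel" "(A \<inter> B) \<inter> (B - A) = {}" "A \<inter> B \<union> (B - A) = B" using AB by auto
    from spectral_Un[OF E this(1-3)] this(4) show ?thesis by simp
  qed
  have "E (A \<inter> B) (E B x) = E (A \<inter> B) x"
  proof -
    have *: "A \<inter> B \<in> sets borel" "B - A \<in> sets borel" "(A \<inter> B) \<inter> (B - A) = {}" using AB by auto
    note P = spectral_measureD(1)[OF E *(1)]
    show ?thesis
      unfolding B using spectral_disjoint[OF E *, of x]
      by (simp add: bounded_clinear_add[OF projD(1)[OF P]] projD(2)[OF P])
  qed
  moreover have "E (A - B) (E B x) = 0" by (rule spectral_disjoint[OF E]) (use AB in auto)
  ultimately show ?thesis using A[of "E B x"] by simp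
qed

lemma sets_scalar_measure [simp, measurable_cong]: "sets (scalar_measure E x) = sets borel"
  and space_scalar_measure [simp]: "space (scalar_measure E x) = UNIV"
proof -
  have "sets (scalar_measure E x) = sigma_sets UNIV (sets borel)"
    unfolding scalar_measure_def by (rule sets_measure_of) simp
  then show "sets (scalar_measure E x) = sets borel"
    using sets.sigma_sets_eq[of "borel :: real measure"] by simp
  show "space (scalar_measure E x) = UNIV" unfolding scalar_measure_def by (rule space_measure_of) simp
qed

lemma sums_norm_sq:
  fixes f :: "nat \<Rightarrow> 'h::complex_hilbert"
  assumes s: "f sums y" and orth: "\<And>i j. i \<noteq> j \<Longrightarrow> cinner (f i) (f j) = 0"
  shows "(\<lambda>n. (norm (f n))\<^sup>2) sums (norm y)\<^sup>2"
proof -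
  have "(\<lambda>n. (norm (\<Sum>i<n. f i))\<^sup>2) \<longlonglongrightarrow> (norm y)\<^sup>2"
    using s unfolding sums_def by (intro tendsto_intros)
  moreover have "(norm (\<Sum>i<n. f i))\<^sup>2 = (\<Sum>i<n. (norm (f i))\<^sup>2)" for n
    by (rule pythagoras) (auto simp: orth)
  ultimately show ?thesis by (simp add: sums_def)
qed

lemma emeasure_scalar_measure:
  assumes E: "spectral_measure E" and A: "A \<in> sets borel"
  shows "emeasure (scalar_measure E x) A = ennreal ((norm (E A x))\<^sup>2)"
proof -
  have "emeasure (scalar_measure E x) A = (\<lambda>B. ennreal ((norm (E B x))\<^sup>2)) A"
    unfolding scalar_measure_def
  proof (rule emeasure_measure_of_sigma)
    show "sigma_algebra UNIV (sets borel :: real set set)" using sets.sigma_algebra_axioms[of "borel :: real measure"] by simp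
    show "positive (sets borel) (\<lambda>B. ennreal ((norm (E B x))\<^sup>2))" by (simp add: positive_def spectral_empty[OF E])
    show "countably_additive (sets borel) (\<lambda>B. ennreal ((norm (E B x))\<^sup>2))"
    proof (rule countably_additiveI)
      fix F :: "nat \<Rightarrow> real set"
      assume F: "range F \<subseteq> sets borel" "disjoint_family F"
      have "(\<lambda>n. (norm (E (F n) x))\<^sup>2) sums (norm (E (\<Union>n. F n) x))\<^sup>2"
      proof (rule sums_norm_sq[OF spectral_measureD(3)[OF E F]])
        fix i j :: nat assume "i \<noteq> j"
        have Fi: "F i \<in> sets borel" "F j \<in> sets borel" "F i \<inter> F j = {}"
          using F \<open>i \<noteq> j\<close> by (auto simp: disjoint_family_on_def)
        show "cinner (E (F i) x) (E (F j) x) = 0"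
          unfolding projD(3)[OF spectral_measureD(1)[OF E Fi(1)]] spectral_disjoint[OF E Fi] by simp
      qed
      then show "(\<Sum>i. ennreal ((norm (E (F i) x))\<^sup>2)) = ennreal ((norm (E (\<Union> (range F)) x))\<^sup>2)"
        by (intro suminf_ennreal_eq) auto
    qed
    show "A \<in> sets borel" by (rule A)
  qed
  then show ?thesis .
qed

lemma finite_scalar_measure:
  assumes "spectral_measure E"
  shows "finite_measure (scalar_measure E x)"
  by (rule finite_measureI) (simp add: emeasure_scalar_measure[OF assms])

lemma sq_integrable_imp_integrable:
  fixes f :: "'a \<Rightarrow> complex"
  assumes M: "finite_measure M" and f: "f \<in> borel_measurable M" and sq: "integrable M (\<lambda>r. (cmod (f r))\<^sup>2)"
  shows "integrable M f"
proof (rule Bochner_Integration.integrable_bound)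
  show "integrable M (\<lambda>r. 1 + (cmod (f r))\<^sup>2)"
    using finite_measure.integrable_const[OF M, of "1::real"] sq by (rule Bochner_Integration.integrable_add)
  have "cmod z \<le> 1 + (cmod z)\<^sup>2" for z
  proof -
    have "0 \<le> (cmod z - 1)\<^sup>2" by simp
    then have "2 * cmod z \<le> 1 + (cmod z)\<^sup>2" by (simp add: power2_diff)
    moreover have "0 \<le> cmod z" by simp
    ultimately show ?thesis by linarith
  qed
  then show "AE r in M. norm (f r) \<le> norm (1 + (cmod (f r))\<^sup>2)" by auto
qed (rule f)

text \<open>Perturbing \<open>x\<close> by a multiple of its own spectral component \<open>E C x\<close> only rescales the scalar
  measure on \<open>C\<close>.\<close>

lemma scalar_measure_perturb:
  assumes E: "spectral_measure E" and C: "C \<in> sets borel"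
  shows "scalar_measure E (x + c *\<^sub>C E C x)
    = density (scalar_measure E x) (\<lambda>r. ennreal (if r \<in> C then (cmod (1 + c))\<^sup>2 else 1))"
proof (rule measure_eqI)
  fix A assume "A \<in> sets (scalar_measure E (x + c *\<^sub>C E C x))"
  then have A: "A \<in> sets borel" by simp
  have AC: "A \<inter> C \<in> sets borel" "A - C \<in> sets borel" using A C by auto
  let ?M = "scalar_measure E x"
  have pA: "bounded_clinear (E A)" using projD(1)[OF spectral_measureD(1)[OF E A]] .
  have "E A (x + c *\<^sub>C E C x) = E (A - C) x + (1 + c) *\<^sub>C E (A \<inter> C) x"
  proof -
    have "E A x = E (A \<inter> C) x + E (A - C) x"
    proof -
      have "(A \<inter> C) \<inter> (A - C) = {}" by auto
      from spectral_Un[OF E AC this] show ?thesis by (simp add: Int_Diff_Un)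
    qed
    then show ?thesis by (simp add: bcl_simps[OF pA] spectral_Int[OF E A C] scaleC_add_left)
  qed
  moreover have "cinner (E (A - C) x) ((1 + c) *\<^sub>C E (A \<inter> C) x) = 0"
  proof -
    have "(A - C) \<inter> (A \<inter> C) = {}" by auto
    from spectral_disjoint[OF E AC(2,1) this] show ?thesis
      unfolding cinner_scaleC_right projD(3)[OF spectral_measureD(1)[OF E AC(2)]] by simp
  qed
  ultimately have "(norm (E A (x + c *\<^sub>C E C x)))\<^sup>2 = (norm (E (A - C) x))\<^sup>2 + (cmod (1 + c))\<^sup>2 * (norm (E (A \<inter> C) x))\<^sup>2"
    by (simp add: norm_add_sq power_mult_distrib)
  then have lhs: "emeasure (scalar_measure E (x + c *\<^sub>C E C x)) A
      = emeasure ?M (A - C) + ennreal ((cmod (1 + c))\<^sup>2) * emeasure ?M (A \<inter> C)"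
    by (simp add: emeasure_scalar_measure[OF E] A AC ennreal_mult)
  have "emeasure (density ?M (\<lambda>r. ennreal (if r \<in> C then (cmod (1 + c))\<^sup>2 else 1))) A
      = (\<integral>\<^sup>+ r. ennreal (if r \<in> C then (cmod (1 + c))\<^sup>2 else 1) * indicator A r \<partial>?M)"
    by (rule emeasure_density) (use A C in auto)
  also have "\<dots> = (\<integral>\<^sup>+ r. indicator (A - C) r + ennreal ((cmod (1 + c))\<^sup>2) * indicator (A \<inter> C) r \<partial>?M)"
    by (intro nn_integral_cong) (auto split: split_indicator)
  also have "\<dots> = emeasure ?M (A - C) + ennreal ((cmod (1 + c))\<^sup>2) * emeasure ?M (A \<inter> C)"
    using AC by (subst nn_integral_add) (auto simp: nn_integral_cmult)
  finally show "emeasure (scalar_measure E (x + c *\<^sub>C E C x)) A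
      = emeasure (density ?M (\<lambda>r. ennreal (if r \<in> C then (cmod (1 + c))\<^sup>2 else 1))) A"
    by (simp add: lhs)
qed simp

lemma spectral_domain_component:
  assumes E: "spectral_measure E" and C: "C \<in> sets borel" and x: "x \<in> spectral_domain E complex_of_real"
  shows "E C x \<in> spectral_domain E complex_of_real"
proof -
  let ?M = "scalar_measure E x"
  have "scalar_measure E (E C x) = density ?M (\<lambda>r. ennreal (indicator C r))"
  proof (rule measure_eqI)
    fix A assume "A \<in> sets (scalar_measure E (E C x))"
    then have A: "A \<in> sets borel" by simp
    then have AC: "A \<inter> C \<in> sets borel" using C by auto
    have "emeasure (density ?M (\<lambda>r. ennreal (indicator C r))) A = (\<integral>\<^sup>+ r. ennreal (indicator C r) * indicator A r \<partial>?M)"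
      by (rule emeasure_density) (use A C in auto)
    also have "\<dots> = (\<integral>\<^sup>+ r. indicator (A \<inter> C) r \<partial>?M)"
      by (intro nn_integral_cong) (auto split: split_indicator)
    also have "\<dots> = emeasure ?M (A \<inter> C)" using AC by simp
    finally show "emeasure (scalar_measure E (E C x)) A = emeasure (density ?M (\<lambda>r. ennreal (indicator C r))) A"
      using A AC by (simp add: emeasure_scalar_measure[OF E] spectral_Int[OF E A C])
  qed simp
  moreover have "integrable (density ?M (\<lambda>r. ennreal (indicator C r))) (\<lambda>r. (cmod (complex_of_real r))\<^sup>2)"
  proof (subst integrable_real_density)
    show "integrable ?M (\<lambda>r. indicator C r * (cmod (complex_of_real r))\<^sup>2)"
    proof (rule Bochner_Integration.integrable_bound)
      show "integrable ?M (\<lambda>r. (cmod (complex_of_real r))\<^sup>2)" using x by (simp add: spectral_domain_def)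
    qed (use C in \<open>auto split: split_indicator\<close>)
  qed (use C in auto)
  ultimately show ?thesis by (simp add: spectral_domain_def)
qed

text \<open>An eigenvector of the operator lies in the spectral subspace of the eigenvalue; testing the
  quadratic form against \<open>E C x\<close> localizes the eigenvalue equation to \<open>C\<close>.\<close>

lemma spectral_eigenvector:
  assumes E: "spectral_measure E" and x: "(x, complex_of_real m *\<^sub>C x) \<in> spectral_integral E complex_of_real"
    and A: "A \<in> sets borel"
  shows "E A x = (if m \<in> A then x else 0)"
proof -
  let ?M = "scalar_measure E x"
  have dom: "x \<in> spectral_domain E complex_of_real"
    and form: "\<And>z. z \<in> spectral_domain E complex_of_real \<Longrightarrow>
      cinner z (complex_of_real m *\<^sub>C x) = spectral_form E complex_of_real z x"
    using x by (auto simp: spectral_integral_def)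
  have M: "finite_measure ?M" by (rule finite_scalar_measure[OF E])
  have sq: "integrable ?M (\<lambda>r. (cmod (complex_of_real r))\<^sup>2)" using dom by (simp add: spectral_domain_def)
  have int: "integrable ?M complex_of_real"
    by (rule sq_integrable_imp_integrable[OF M _ sq]) measurable
  then have intr: "integrable ?M (\<lambda>r. r)" by (simp add: complex_of_real_integrable_eq)
  have loc: "(\<integral>r. indicator C r * (r - m) \<partial>?M) = 0" if C: "C \<in> sets borel" for C
  proof -
    have w: "(\<integral>r. complex_of_real r \<partial>scalar_measure E (x + c *\<^sub>C E C x))
      = (\<integral>r. (if r \<in> C then (cmod (1 + c))\<^sup>2 else 1) *\<^sub>R complex_of_real r \<partial>?M)" for c
      unfolding scalar_measure_perturb[OF E C] by (rule integral_density) (use C in auto)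
    have wi: "integrable ?M (\<lambda>r. (if r \<in> C then (cmod (1 + c))\<^sup>2 else 1) *\<^sub>R complex_of_real r)" for c
    proof (rule Bochner_Integration.integrable_bound)
      show "integrable ?M (\<lambda>r. ((cmod (1 + c))\<^sup>2 + 1) *\<^sub>R complex_of_real r)"
        by (intro integrable_scaleR_right) (use int in simp)
      show "AE r in ?M. norm ((if r \<in> C then (cmod (1 + c))\<^sup>2 else 1) *\<^sub>R complex_of_real r) \<le> norm (((cmod (1 + c))\<^sup>2 + 1) *\<^sub>R complex_of_real r)"
        by (intro AE_I2) (auto simp: abs_mult distrib_right)
    qed (use C in measurable)
    \<comment> \<open>On C the weights |1 + i^k|^2 are 4, 2, 0, 2, and their sum against i^k is 4;
      off C all weights are 1 and the powers of i cancel.\<close>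
    have "4 * spectral_form E complex_of_real (E C x) x
       = (\<Sum>k<4. \<i> ^ k * (\<integral>r. (if r \<in> C then (cmod (1 + \<i> ^ k))\<^sup>2 else 1) *\<^sub>R complex_of_real r \<partial>?M))"
      unfolding spectral_form_def w by simp
    also have "\<dots> = (\<Sum>k<4. (\<integral>r. \<i> ^ k * ((if r \<in> C then (cmod (1 + \<i> ^ k))\<^sup>2 else 1) *\<^sub>R complex_of_real r) \<partial>?M))"
      by (simp only: integral_mult_right_zero)
    also have "\<dots> = (\<integral>r. (\<Sum>k<4. \<i> ^ k * ((if r \<in> C then (cmod (1 + \<i> ^ k))\<^sup>2 else 1) *\<^sub>R complex_of_real r)) \<partial>?M)"
      by (rule Bochner_Integration.integral_sum[symmetric]) (intro integrable_mult_right wi)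
    also have "\<dots> = (\<integral>r. complex_of_real (4 * (indicator C r * r)) \<partial>?M)"
      by (intro Bochner_Integration.integral_cong refl)
        (simp add: numeral_eq_Suc cmod_def power2_eq_square scaleR_conv_of_real algebra_simps split: split_indicator)
    also have "\<dots> = complex_of_real (4 * (\<integral>r. indicator C r * r \<partial>?M))"
      by (simp only: integral_complex_of_real) simp
    finally have f: "spectral_form E complex_of_real (E C x) x = complex_of_real (\<integral>r. indicator C r * r \<partial>?M)"
      by (simp add: field_simps)
    have "cinner (E C x) (complex_of_real m *\<^sub>C x) = complex_of_real (m * (norm (E C x))\<^sup>2)"
      using norm_proj_sq[OF spectral_measureD(1)[OF E C], of x] projD(3)[OF spectral_measureD(1)[OF E C], of x x]
      by (simp add: cinner_scaleC_right)
    then have "complex_of_real (m * (norm (E C x))\<^sup>2) = complex_of_real (\<integral>r. indicator C r * r \<partial>?M)"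
      using form[OF spectral_domain_component[OF E C dom]] f by simp
    then have eq: "m * (norm (E C x))\<^sup>2 = (\<integral>r. indicator C r * r \<partial>?M)" using of_real_eq_iff by blast
    have mC: "measure ?M C = (norm (E C x))\<^sup>2"
      using emeasure_scalar_measure[OF E C, of x] by (simp add: measure_def)
    have i1: "integrable ?M (\<lambda>r. indicator C r * r)"
      using integrable_mult_indicator[OF _ intr, of C] C by simp
    have i2: "integrable ?M (\<lambda>r. indicator C r * m)"
      using C M by (intro integrable_mult_left) (auto simp: finite_measure.emeasure_finite less_top[symmetric])
    have "(\<integral>r. indicator C r * (r - m) \<partial>?M) = (\<integral>r. indicator C r * r \<partial>?M) - (\<integral>r. indicator C r * m \<partial>?M)"
      unfolding right_diff_distrib by (rule Bochner_Integration.integral_diff[OF i1 i2])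
    also have "(\<integral>r. indicator C r * m \<partial>?M) = m * measure ?M C" using C by simp
    finally show ?thesis using eq mC by simp
  qed
  have null: "emeasure ?M C = 0" if C: "C \<in> sets borel" and s: "(\<forall>r\<in>C. r > m) \<or> (\<forall>r\<in>C. r < m)" for C
  proof -
    \<comment> \<open>The sign of r - m on C, so that the vanishing integral has a nonnegative
      integrand.\<close>
    define s where "s = (if \<forall>r\<in>C. r > m then 1 else - 1 :: real)"
    have i: "integrable ?M (\<lambda>r. indicator C r * (r - m))"
    proof -
      have "integrable ?M (\<lambda>r. r - m)"
        by (intro Bochner_Integration.integrable_diff intr finite_measure.integrable_const[OF M])
      then show ?thesis using integrable_mult_indicator[of C ?M "\<lambda>r. r - m"] C by simp
    qed
    have "(\<integral>r. s * (indicator C r * (r - m)) \<partial>?M) = 0" using loc[OF C] by simp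
    moreover have nn: "s * (indicator C r * (r - m)) \<ge> 0" for r using s by (auto simp: s_def intro: less_imp_le split: split_indicator)
    ultimately have "AE r in ?M. s * (indicator C r * (r - m)) = 0"
      using integral_nonneg_eq_0_iff_AE[of ?M "\<lambda>r. s * (indicator C r * (r - m))"] i by simp
    then have "AE r in ?M. r \<notin> C"
    proof (eventually_elim)
      case (elim r)
      then show ?case using s by (auto simp: s_def split: if_splits)
    qed
    then show ?thesis using C AE_iff_measurable[of C ?M "\<lambda>r. r \<notin> C"] by simp
  qed
  have zero: "E C x = 0" if C: "C \<in> sets borel" and s: "(\<forall>r\<in>C. r > m) \<or> (\<forall>r\<in>C. r < m)" for C
    using null[OF that] emeasure_scalar_measure[OF E C, of x] by (simp add: ennreal_eq_0_iff)
  have sm: "{m} \<in> sets borel" "{m<..} \<in> sets borel" "{..<m} \<in> sets borel" by auto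
  have "x = E UNIV x" using spectral_measureD(2)[OF E] by simp
  also have "UNIV = {m} \<union> ({m<..} \<union> {..<m})" by auto
  also have "E \<dots> x = E {m} x + E ({m<..} \<union> {..<m}) x"
    by (rule spectral_Un[OF E]) auto
  also have "E ({m<..} \<union> {..<m}) x = E {m<..} x + E {..<m} x"
    by (rule spectral_Un[OF E]) auto
  also have "E {m<..} x = 0" by (rule zero) auto
  also have "E {..<m} x = 0" by (rule zero) auto
  finally have xm: "E {m} x = x" by simp
  have "E A (E {m} x) = E (A \<inter> {m}) x" by (rule spectral_Int[OF E A]) auto
  then show ?thesis using xm spectral_empty[OF E, of x] by (auto simp: Int_insert_right)
qed

lemma spectral_integral_cong:
  assumes "\<And>A. A \<in> sets borel \<Longrightarrow> E A = E' A"
  shows "spectral_integral E f = spectral_integral E' f"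
proof -
  have "scalar_measure E x = scalar_measure E' x" for x
    unfolding scalar_measure_def
    by (rule measure_of_eq) (use assms sets.sigma_sets_eq[of "borel :: real measure"] in auto)
  then show ?thesis by (simp add: spectral_integral_def spectral_domain_def spectral_form_def)
qed


section \<open>Diagonal spectral measures\<close>

context q_fock
begin

context
  fixes ev :: "nat \<times> nat \<Rightarrow> real"
begin

text \<open>The spectral measure of the diagonal operator with eigenvalue \<open>ev (key w)\<close>
  at \<open>B w\<close>.\<close>

definition Esp :: "real set \<Rightarrow> 'h \<Rightarrow> 'h" where
  "Esp A = dg (\<lambda>\<kappa>. if ev \<kappa> \<in> A then 1 else 0)"

lemma bdd_ind: "bdd (\<lambda>\<kappa>. if ev \<kappa> \<in> A then 1 else 0)"
  by (rule bddI[of _ 1]) auto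

lemma bcl_Esp [intro, simp]: "bounded_clinear (Esp A)"
  unfolding Esp_def by (rule bcl_dg[OF bdd_ind])

lemma Esp_B: "Esp A (B w) = (if ev (key w) \<in> A then B w else 0)"
  by (simp add: Esp_def dg_B[OF bdd_ind])

lemma norm_Esp: "norm (Esp A x) \<le> norm x"
proof -
  have "cmod (if ev \<kappa> \<in> A then 1 else 0) \<le> 1" for \<kappa> by simp
  from norm_dg[where x = x, OF this] show ?thesis by (simp add: Esp_def)
qed

lemma cinner_Esp: "cinner (Esp A x) y = cinner x (Esp A y)"
  unfolding Esp_def by (subst cinner_dg[OF bdd_ind]) (simp add: if_distrib cong: if_cong)

lemma Esp_Int: "Esp A (Esp A' x) = Esp (A \<inter> A') x"
  by (rule bcl_eqI'[where f = "\<lambda>x. Esp A (Esp A' x)"]) (auto simp: Esp_B bounded_clinear_zero[OF bcl_Esp])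

lemma Esp_sum_disjoint:
  assumes "finite I" "disjoint_family_on F I"
  shows "(\<Sum>i\<in>I. Esp (F i) x) = Esp (\<Union>i\<in>I. F i) x"
proof (rule bcl_eqI'[where f = "\<lambda>x. \<Sum>i\<in>I. Esp (F i) x"])
  fix w
  show "(\<Sum>i\<in>I. Esp (F i) (B w)) = Esp (\<Union>i\<in>I. F i) (B w)"
  proof (cases "\<exists>j\<in>I. ev (key w) \<in> F j")
    case True
    then obtain j where j: "j \<in> I" "ev (key w) \<in> F j" by blast
    then have "(\<Sum>i\<in>I. Esp (F i) (B w)) = (\<Sum>i\<in>I. if i = j then B w else 0)"
      using assms(2) by (intro sum.cong) (auto simp: Esp_B disjoint_family_on_def)
    then show ?thesis using j assms(1) by (auto simp: Esp_B)
  qed (auto simp: Esp_B)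
qed auto

lemma spectral_measure_Esp: "spectral_measure Esp"
  unfolding spectral_measure_def
proof (intro conjI ballI allI impI)
  fix A :: "real set"
  show "orthogonal_projection (Esp A)"
    by (auto simp: orthogonal_projection_def fun_eq_iff Esp_Int cinner_Esp)
next
  show "Esp UNIV = id" by (auto simp: fun_eq_iff Esp_def)
next
  fix F :: "nat \<Rightarrow> real set" and x
  assume F: "range F \<subseteq> sets borel" "disjoint_family F"
  have "(\<lambda>n. Esp (\<Union>i<n. F i) x - Esp (\<Union>i. F i) x) \<longlonglongrightarrow> 0"
  proof (rule tendsto_dense_clinear[where F = "\<lambda>n x. Esp (\<Union>i<n. F i) x - Esp (\<Union>i. F i) x" and K = 2])
    show "bounded_clinear (\<lambda>x. Esp (\<Union>i<n. F i) x - Esp (\<Union>i. F i) x)" for n by auto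
    show "norm (Esp (\<Union>i<n. F i) x - Esp (\<Union>i. F i) x) \<le> 2 * norm x" for n x
      using norm_triangle_ineq4[of "Esp (\<Union>i<n. F i) x" "Esp (\<Union>i. F i) x"] norm_Esp[of _ x] by (smt (verit))
    fix w
    show "(\<lambda>n. Esp (\<Union>i<n. F i) (B w) - Esp (\<Union>i. F i) (B w)) \<longlonglongrightarrow> 0"
    proof (cases "\<exists>i. ev (key w) \<in> F i")
      case True
      then obtain i where i: "ev (key w) \<in> F i" by blast
      have "\<forall>\<^sub>F n in sequentially. 0 = Esp (\<Union>i<n. F i) (B w) - Esp (\<Union>i. F i) (B w)"
        by (rule eventually_sequentiallyI[of "Suc i"]) (use i in \<open>auto simp: Esp_B\<close>)
      then show ?thesis by (rule Lim_transform_eventually[OF tendsto_const])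
    qed (simp add: Esp_B)
  qed
  moreover have "disjoint_family_on F {..<n}" for n
    using F(2) by (rule disjoint_family_on_mono[rotated]) simp
  ultimately have "(\<lambda>n. (\<Sum>i<n. Esp (F i) x) - Esp (\<Union>i. F i) x) \<longlonglongrightarrow> 0"
    by (simp add: Esp_sum_disjoint)
  then show "(\<lambda>n. Esp (F n) x) sums Esp (\<Union>n. F n) x"
    unfolding sums_def by (rule LIM_zero_cancel)
qed

text \<open>There are countably many bidegrees, so the measure is purely atomic and spectral
  integrals become sums over the eigenvalues.\<close>

lemma scalar_measure_Esp:
  "scalar_measure Esp x = distr (density (count_space (range ev)) (\<lambda>k. ennreal ((norm (Esp {k} x))\<^sup>2))) borel (\<lambda>k. k)"
  (is "?M = ?N")
proof (rule measure_eqI)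
  show "sets ?M = sets ?N" by simp
  fix A assume "A \<in> sets ?M"
  then have A: "A \<in> sets borel" by simp
  have cnt: "countable (range ev)" by simp
  have "range ev \<in> sets borel" by (rule sets.countable[OF _ cnt]) auto
  then have K: "range ev \<in> sets borel" "A \<inter> range ev \<in> sets borel" "A - range ev \<in> sets borel"
    using A by auto
  have "Esp (A - range ev) x = 0"
  proof -
    have "Esp (A - range ev) x = (\<lambda>x. 0) x"
      by (rule bcl_eqI') (auto simp: Esp_B)
    then show ?thesis by simp
  qed
  then have "emeasure ?M (A - range ev) = 0"
    by (simp add: emeasure_scalar_measure[OF spectral_measure_Esp K(3)])
  then have "emeasure ?M A = emeasure ?M (A \<inter> range ev)"
    using emeasure_Un_null_set[of "A \<inter> range ev" ?M "A - range ev"] K by (simp add: Int_Diff_Un null_setsI)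
  also have "\<dots> = (\<integral>\<^sup>+ k. emeasure ?M {k} \<partial>count_space (A \<inter> range ev))"
    by (rule emeasure_countable_singleton) (auto intro: countable_Int2)
  also have "\<dots> = (\<integral>\<^sup>+ k. ennreal ((norm (Esp {k} x))\<^sup>2) \<partial>count_space (A \<inter> range ev))"
    by (intro nn_integral_cong emeasure_scalar_measure[OF spectral_measure_Esp]) auto
  also have "\<dots> = (\<integral>\<^sup>+ k. ennreal ((norm (Esp {k} x))\<^sup>2) * indicator A k \<partial>count_space (range ev))"
    by (subst nn_integral_count_space_indicator, simp, subst (2) nn_integral_count_space_indicator, simp)
      (intro nn_integral_cong, auto split: split_indicator)
  also have "\<dots> = emeasure (density (count_space (range ev)) (\<lambda>k. ennreal ((norm (Esp {k} x))\<^sup>2))) (A \<inter> range ev)"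
    by (subst emeasure_density) (auto intro!: nn_integral_cong split: split_indicator)
  also have "\<dots> = emeasure ?N A"
    using A by (subst emeasure_distr) (auto intro!: arg_cong2[where f = emeasure])
  finally show "emeasure ?M A = emeasure ?N A" .
qed

lemma integral_Esp:
  fixes f :: "real \<Rightarrow> complex"
  assumes "f \<in> borel_measurable borel"
  shows "(\<integral>r. f r \<partial>scalar_measure Esp x) = (\<integral>k. (norm (Esp {k} x))\<^sup>2 *\<^sub>R f k \<partial>count_space (range ev))"
    "integrable (scalar_measure Esp x) f \<longleftrightarrow> integrable (count_space (range ev)) (\<lambda>k. (norm (Esp {k} x))\<^sup>2 *\<^sub>R f k)"
  unfolding scalar_measure_Esp using assms
  by (simp_all add: integral_distr integrable_distr_eq integral_density integrable_density)

lemma integrable_Esp_real: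
  fixes f :: "real \<Rightarrow> real"
  assumes "f \<in> borel_measurable borel"
  shows "integrable (scalar_measure Esp x) f \<longleftrightarrow> integrable (count_space (range ev)) (\<lambda>k. (norm (Esp {k} x))\<^sup>2 *\<^sub>R f k)"
  unfolding scalar_measure_Esp using assms
  by (simp add: integrable_distr_eq integrable_density)

lemma spectral_domain_perturb:
  assumes f: "f \<in> borel_measurable borel" and x: "x \<in> spectral_domain Esp f" and u: "u \<in> spectral_domain Esp f"
  shows "x + c *\<^sub>C u \<in> spectral_domain Esp f"
proof -
  have m: "(\<lambda>r. (cmod (f r))\<^sup>2) \<in> borel_measurable borel" using f by measurable
  have "integrable (count_space (range ev)) (\<lambda>k. (norm (Esp {k} (x + c *\<^sub>C u)))\<^sup>2 *\<^sub>R (cmod (f k))\<^sup>2)"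
  proof (rule Bochner_Integration.integrable_bound)
    show "integrable (count_space (range ev)) (\<lambda>k. 2 * ((norm (Esp {k} x))\<^sup>2 *\<^sub>R (cmod (f k))\<^sup>2) + 2 * (cmod c)\<^sup>2 * ((norm (Esp {k} u))\<^sup>2 *\<^sub>R (cmod (f k))\<^sup>2))"
      using x u unfolding spectral_domain_def mem_Collect_eq integrable_Esp_real[OF m]
      by (intro Bochner_Integration.integrable_add integrable_mult_right)
    have "(norm (Esp {k} (x + c *\<^sub>C u)))\<^sup>2 \<le> 2 * (norm (Esp {k} x))\<^sup>2 + 2 * (cmod c)\<^sup>2 * (norm (Esp {k} u))\<^sup>2" for k
    proof -
      have "norm (Esp {k} (x + c *\<^sub>C u)) \<le> norm (Esp {k} x) + cmod c * norm (Esp {k} u)"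
        by (simp add: bcl_simps[OF bcl_Esp]) (metis norm_scaleC norm_triangle_ineq)
      then have "(norm (Esp {k} (x + c *\<^sub>C u)))\<^sup>2 \<le> (norm (Esp {k} x) + cmod c * norm (Esp {k} u))\<^sup>2"
        by (rule power_mono) simp
      also have "\<dots> \<le> 2 * (norm (Esp {k} x))\<^sup>2 + 2 * (cmod c * norm (Esp {k} u))\<^sup>2"
        using sum_squares_bound[of "norm (Esp {k} x)" "cmod c * norm (Esp {k} u)"] by (simp add: power2_sum)
      finally show ?thesis by (simp add: power_mult_distrib)
    qed
    then have "norm ((norm (Esp {k} (x + c *\<^sub>C u)))\<^sup>2 *\<^sub>R (cmod (f k))\<^sup>2)
      \<le> (2 * (norm (Esp {k} x))\<^sup>2 + 2 * (cmod c)\<^sup>2 * (norm (Esp {k} u))\<^sup>2) * (cmod (f k))\<^sup>2" for k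
      by (simp add: mult_right_mono)
    then show "AE k in count_space (range ev). norm ((norm (Esp {k} (x + c *\<^sub>C u)))\<^sup>2 *\<^sub>R (cmod (f k))\<^sup>2)
      \<le> norm (2 * ((norm (Esp {k} x))\<^sup>2 *\<^sub>R (cmod (f k))\<^sup>2) + 2 * (cmod c)\<^sup>2 * ((norm (Esp {k} u))\<^sup>2 *\<^sub>R (cmod (f k))\<^sup>2))"
      by (intro AE_I2) (simp add: algebra_simps order.trans[OF _ abs_ge_self])
  qed simp
  then show ?thesis unfolding spectral_domain_def mem_Collect_eq integrable_Esp_real[OF m] .
qed

lemma spectral_form_Esp:
  assumes f: "f \<in> borel_measurable borel" and x: "x \<in> spectral_domain Esp f" and u: "u \<in> spectral_domain Esp f"
  shows "spectral_form Esp f u x = (\<integral>k. cinner (Esp {k} u) (Esp {k} x) * f k \<partial>count_space (range ev))"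
proof -
  let ?C = "count_space (range ev)"
  have i: "integrable ?C (\<lambda>k. (norm (Esp {k} (x + c *\<^sub>C u)))\<^sup>2 *\<^sub>R f k)" for c
    unfolding integral_Esp(2)[OF f, symmetric]
    by (rule sq_integrable_imp_integrable[OF finite_scalar_measure[OF spectral_measure_Esp]])
      (use f spectral_domain_perturb[OF f x u] in \<open>auto simp: spectral_domain_def\<close>)
  have "4 * spectral_form Esp f u x = (\<Sum>j<4. \<i> ^ j * (\<integral>k. (norm (Esp {k} (x + \<i> ^ j *\<^sub>C u)))\<^sup>2 *\<^sub>R f k \<partial>?C))"
    by (simp add: spectral_form_def integral_Esp(1)[OF f])
  also have "\<dots> = (\<Sum>j<4. (\<integral>k. \<i> ^ j * ((norm (Esp {k} (x + \<i> ^ j *\<^sub>C u)))\<^sup>2 *\<^sub>R f k) \<partial>?C))"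
    by (simp only: integral_mult_right_zero)
  also have "\<dots> = (\<integral>k. (\<Sum>j<4. \<i> ^ j * ((norm (Esp {k} (x + \<i> ^ j *\<^sub>C u)))\<^sup>2 *\<^sub>R f k)) \<partial>?C)"
    by (rule Bochner_Integration.integral_sum[symmetric]) (intro integrable_mult_right i)
  also have "\<dots> = (\<integral>k. 4 * (cinner (Esp {k} u) (Esp {k} x) * f k) \<partial>?C)"
  proof (intro Bochner_Integration.integral_cong refl)
    fix k
    have "(\<Sum>j<4. \<i> ^ j * ((norm (Esp {k} (x + \<i> ^ j *\<^sub>C u)))\<^sup>2 *\<^sub>R f k))
      = (\<Sum>j<4. \<i> ^ j * complex_of_real ((norm (Esp {k} x + \<i> ^ j *\<^sub>C Esp {k} u))\<^sup>2)) * f k"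
      by (simp only: bcl_simps[OF bcl_Esp] scaleR_conv_of_real sum_distrib_right mult.assoc)
    then show "(\<Sum>j<4. \<i> ^ j * ((norm (Esp {k} (x + \<i> ^ j *\<^sub>C u)))\<^sup>2 *\<^sub>R f k)) = 4 * (cinner (Esp {k} u) (Esp {k} x) * f k)"
      by (simp only: polarization mult.assoc)
  qed
  also have "\<dots> = 4 * (\<integral>k. cinner (Esp {k} u) (Esp {k} x) * f k \<partial>?C)"
    by (simp only: integral_mult_right_zero)
  finally show ?thesis by simp
qed

text \<open>Parseval's identity for the eigenspace components, obtained as the spectral form of the
  constant function 1.\<close>

lemma Esp_total_form: "(\<integral>k. cinner (Esp {k} u) (Esp {k} x) \<partial>count_space (range ev)) = cinner u x"
proof -
  have all: "v \<in> spectral_domain Esp (\<lambda>_. 1)" for v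
    using finite_measure.integrable_const[OF finite_scalar_measure[OF spectral_measure_Esp]]
    by (simp add: spectral_domain_def)
  have "(\<integral>k. cinner (Esp {k} u) (Esp {k} x) \<partial>count_space (range ev)) = spectral_form Esp (\<lambda>_. 1) u x"
    using spectral_form_Esp[OF _ all all] by simp
  also have "\<dots> = (\<Sum>k<4. \<i> ^ k * complex_of_real ((norm (x + \<i> ^ k *\<^sub>C u))\<^sup>2)) / 4"
  proof -
    have "(\<integral>r. 1 \<partial>scalar_measure Esp v) = complex_of_real ((norm v)\<^sup>2)" for v
      using emeasure_scalar_measure[OF spectral_measure_Esp, of UNIV v]
      by (simp add: measure_def spectral_measureD(2)[OF spectral_measure_Esp] scaleR_conv_of_real)
    then show ?thesis by (simp only: spectral_form_def)
  qed
  also have "\<dots> = cinner u x" by (simp only: polarization) simp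
  finally show ?thesis .
qed

lemma B_in_spectral_domain:
  assumes f: "f \<in> borel_measurable borel"
  shows "B w \<in> spectral_domain Esp f"
proof -
  have m: "(\<lambda>r. (cmod (f r))\<^sup>2) \<in> borel_measurable borel" using f by measurable
  have e: "(\<lambda>k. (norm (Esp {k} (B w)))\<^sup>2 *\<^sub>R (cmod (f k))\<^sup>2)
    = (\<lambda>k. ((norm (B w))\<^sup>2 * (cmod (f (ev (key w))))\<^sup>2) * indicator {ev (key w)} k)"
    by (auto simp: Esp_B fun_eq_iff split: split_indicator)
  show ?thesis
    unfolding spectral_domain_def mem_Collect_eq integrable_Esp_real[OF m] e
    by (intro integrable_mult_right integrable_real_indicator) auto
qed

text \<open>A weak description of the possibly unbounded diagonal operator. Membership of x in the
  domain is automatic on the right-hand side: the components of z are those of x times the values of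
  f, and they are square summable because z is a vector.\<close>

theorem spectral_integral_Esp:
  assumes f: "f \<in> borel_measurable borel"
  shows "spectral_integral Esp f = {(x, z). \<forall>w. cinner (B w) z = f (ev (key w)) * cinner (B w) x}"
proof (intro set_eqI iffI)
  fix p assume "p \<in> spectral_integral Esp f"
  then obtain x z where p: "p = (x, z)" and x: "x \<in> spectral_domain Esp f"
    and z: "\<And>u. u \<in> spectral_domain Esp f \<Longrightarrow> cinner u z = spectral_form Esp f u x"
    by (auto simp: spectral_integral_def)
  have "cinner (B w) z = f (ev (key w)) * cinner (B w) x" for w
  proof -
    let ?m = "ev (key w)"
    have s: "{k \<in> range ev. cinner (Esp {k} (B w)) (Esp {k} x) * f k \<noteq> 0} \<subseteq> {?m}"
      by (auto simp: Esp_B)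
    have "cinner (B w) z = (\<integral>k. cinner (Esp {k} (B w)) (Esp {k} x) * f k \<partial>count_space (range ev))"
      using z[OF B_in_spectral_domain[OF f]] spectral_form_Esp[OF f x B_in_spectral_domain[OF f]] by simp
    also have "\<dots> = (\<Sum>k | k \<in> range ev \<and> cinner (Esp {k} (B w)) (Esp {k} x) * f k \<noteq> 0. cinner (Esp {k} (B w)) (Esp {k} x) * f k)"
      by (rule lebesgue_integral_count_space_finite_support) (rule finite_subset[OF s], simp)
    also have "\<dots> = (\<Sum>k\<in>{?m}. cinner (Esp {k} (B w)) (Esp {k} x) * f k)"
      by (rule sum.mono_neutral_left) (use s in auto)
    also have "\<dots> = f ?m * cinner (B w) x"
      using cinner_Esp[of "{?m}" "B w" "x"] by (simp add: cinner_Esp[symmetric] Esp_Int Esp_B)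
    finally show ?thesis .
  qed
  then show "p \<in> {(x, z). \<forall>w. cinner (B w) z = f (ev (key w)) * cinner (B w) x}" by (simp add: p)
next
  fix p assume "p \<in> {(x, z). \<forall>w. cinner (B w) z = f (ev (key w)) * cinner (B w) x}"
  then obtain x z where p: "p = (x, z)" and xz: "\<And>w. cinner (B w) z = f (ev (key w)) * cinner (B w) x"
    by auto
  have m: "(\<lambda>r. (cmod (f r))\<^sup>2) \<in> borel_measurable borel" using f by measurable
  have comp: "Esp {k} z = f k *\<^sub>C Esp {k} x" for k
  proof (rule ext_B)
    fix w
    show "cinner (B w) (Esp {k} z) = cinner (B w) (f k *\<^sub>C Esp {k} x)"
      by (simp add: cinner_scaleC_right cinner_Esp[symmetric] Esp_B xz)
  qed
  have x: "x \<in> spectral_domain Esp f"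
  proof -
    have "integrable (count_space (range ev)) (\<lambda>k. (norm (Esp {k} z))\<^sup>2 *\<^sub>R (1::real))"
      using finite_measure.integrable_const[OF finite_scalar_measure[OF spectral_measure_Esp, of z], of "1::real"]
      by (subst (asm) integrable_Esp_real) auto
    then show ?thesis
      unfolding spectral_domain_def mem_Collect_eq integrable_Esp_real[OF m]
      by (simp add: comp power_mult_distrib mult.commute)
  qed
  moreover have "cinner u z = spectral_form Esp f u x" if u: "u \<in> spectral_domain Esp f" for u
  proof -
    have "spectral_form Esp f u x = (\<integral>k. cinner (Esp {k} u) (Esp {k} z) \<partial>count_space (range ev))"
      by (simp add: spectral_form_Esp[OF f x u] comp cinner_scaleC_right mult.commute)
    then show ?thesis by (simp add: Esp_total_form)
  qed
  ultimately show "p \<in> spectral_integral Esp f" by (simp add: p spectral_integral_def)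
qed

lemma measurable_of_real: "complex_of_real \<in> borel_measurable borel"
  by measurable

text \<open>Words are eigenvectors of the common operator, so \<open>spectral_eigenvector\<close>
  fixes \<open>E A\<close> on a total set. This is the uniqueness behind the definite description in
  \<open>imaginary_power\<close>.\<close>

lemma spectral_measure_unique:
  assumes E: "spectral_measure E" and D: "spectral_integral E complex_of_real = spectral_integral Esp complex_of_real"
    and A: "A \<in> sets borel"
  shows "E A = Esp A"
proof (rule bcl_eqI)
  show "bounded_clinear (E A)" using projD(1)[OF spectral_measureD(1)[OF E A]] .
  fix w
  have "(B w, complex_of_real (ev (key w)) *\<^sub>C B w) \<in> spectral_integral E complex_of_real"
    unfolding D spectral_integral_Esp[OF measurable_of_real]
    by (auto simp: cinner_scaleC_right cinner_B intro: qi_key)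
  from spectral_eigenvector[OF E this A] show "E A (B w) = Esp A (B w)" by (simp add: Esp_B)
qed auto

end

end


section \<open>The modular operator\<close>

lemma real_ann: "(z, u) \<in> set (ann q x w) \<Longrightarrow> cnj z = z"
proof (induction w arbitrary: z u)
  case (Cons c w)
  then show ?case by (auto simp: ann.simps(2) split: if_splits)
qed simp

lemma commutant_plus: "x \<in> commutant S \<Longrightarrow> y \<in> commutant S \<Longrightarrow> (\<And>s. s \<in> S \<Longrightarrow> bounded_clinear s)
    \<Longrightarrow> (\<lambda>v. x v + y v) \<in> commutant S"
  by (auto intro!: commutantI bounded_clinear_plus dest: commutant_bcl simp: fun_eq_iff commutantD' bounded_clinear_add)

lemma commutant_scale: "x \<in> commutant S \<Longrightarrow> (\<And>s. s \<in> S \<Longrightarrow> bounded_clinear s)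
    \<Longrightarrow> (\<lambda>v. c *\<^sub>C x v) \<in> commutant S"
  by (auto intro!: commutantI bounded_clinear_cmult dest: commutant_bcl simp: fun_eq_iff commutantD' bounded_clinear_scaleC)

lemma commutant_compose: "x \<in> commutant S \<Longrightarrow> y \<in> commutant S \<Longrightarrow> x \<circ> y \<in> commutant S"
  by (auto intro!: commutantI dest: commutant_bcl simp: fun_eq_iff commutantD')

context q_aw
begin

text \<open>The eigenvalue of the square root of the modular operator: each f contributes 1/mu, each
  e-bar contributes mu.\<close>

definition nu :: "nat \<times> nat \<Rightarrow> real" where "nu \<kappa> = mu ^ snd \<kappa> / mu ^ fst \<kappa>"

lemma nu_pos: "nu \<kappa> > 0" using mu1 by (simp add: nu_def)

lemma nu_0 [simp]: "nu (0, 0) = 1" by (simp add: nu_def)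

lemma nu_Cons: "nu (key (x # v)) = (if x then nu (key v) / mu else mu * nu (key v))"
  by (simp add: nu_def key_Cons)

lemma nu_ann: "(z, u) \<in> set (ann q x v) \<Longrightarrow> nu (key u) = (if x then mu * nu (key v) else nu (key v) / mu)"
proof -
  assume "(z, u) \<in> set (ann q x v)"
  then have "key v = key (x # u)" by (intro key_eq_mset) (simp add: mset_ann)
  then have "nu (key v) = nu (key (x # u))" by simp
  then show ?thesis using mu1 by (auto simp: nu_Cons)
qed

lemma Malg_plus: "x \<in> Malg \<Longrightarrow> y \<in> Malg \<Longrightarrow> (\<lambda>v. x v + y v) \<in> Malg"
  and Malg_scale: "x \<in> Malg \<Longrightarrow> (\<lambda>v. c *\<^sub>C x v) \<in> Malg"
  and Malg_compose: "x \<in> Malg \<Longrightarrow> y \<in> Malg \<Longrightarrow> x \<circ> y \<in> Malg"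
  unfolding Malg_def by (auto intro: commutant_plus commutant_scale commutant_compose commutant_bcl)

lemma gens_Malg: "yl \<in> Malg" "ys \<in> Malg"
  using subset_bicommutant[of "{yl, ys}"] by (auto simp: Malg_def)

lemma zero_Malg: "(\<lambda>v. 0) \<in> Malg"
  using Malg_scale[OF gens_Malg(1), of 0] by simp

end

section \<open>The Tomita operator on words\<close>

context q_aw
begin

interpretation R: q_aw q "\<lambda>w. B (flip w)" mu by (rule mirror_aw)

text \<open>Membership in the graph of the Tomita operator before closure.\<close>

definition has_wick :: "'h \<Rightarrow> 'h \<Rightarrow> bool" where
  "has_wick v v' \<longleftrightarrow> (\<exists>a\<in>Malg. a (B []) = v \<and> cadjoint a (B []) = v')"

lemma has_wick_0: "has_wick 0 0"
  unfolding has_wick_def by (rule bexI[OF _ zero_Malg]) (auto simp: cadjoint_eqI[of "\<lambda>_. 0" "\<lambda>_. 0"] bounded_clinear_0)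

lemma has_wick_add: "has_wick v v' \<Longrightarrow> has_wick u u' \<Longrightarrow> has_wick (v + u) (v' + u')"
  unfolding has_wick_def
proof (elim bexE conjE)
  fix a b assume "a \<in> Malg" "b \<in> Malg" "a (B []) = v" "cadjoint a (B []) = v'" "b (B []) = u" "cadjoint b (B []) = u'"
  then show "\<exists>a\<in>Malg. a (B []) = v + u \<and> cadjoint a (B []) = v' + u'"
    by (intro bexI[of _ "\<lambda>v. a v + b v"] Malg_plus) (auto simp: cadjoint_plus Malg_bcl)
qed

lemma has_wick_scale: "has_wick v v' \<Longrightarrow> has_wick (c *\<^sub>C v) (cnj c *\<^sub>C v')"
  unfolding has_wick_def
proof (elim bexE conjE)
  fix a assume "a \<in> Malg" "a (B []) = v" "cadjoint a (B []) = v'"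
  then show "\<exists>a\<in>Malg. a (B []) = c *\<^sub>C v \<and> cadjoint a (B []) = cnj c *\<^sub>C v'"
    by (intro bexI[of _ "\<lambda>v. c *\<^sub>C a v"] Malg_scale) (auto simp: cadjoint_cmult Malg_bcl)
qed

lemma has_wick_scaleR: "has_wick v v' \<Longrightarrow> has_wick (r *\<^sub>R v) (r *\<^sub>R v')"
  using has_wick_scale[of v v' "of_real r"] by (simp add: scaleC_of_real)

lemma has_wick_lin:
  assumes "\<And>z u. (z, u) \<in> set c \<Longrightarrow> cnj z = z \<and> has_wick (f u) (g u)"
  shows "has_wick (lin f c) (lin g c)"
  using assms
proof (induction c)
  case (Cons p c)
  obtain z u where p: "p = (z, u)" by force
  have zu: "cnj z = z" "has_wick (f u) (g u)" using Cons.prems[of z u] by (auto simp: p)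
  have "has_wick (z *\<^sub>C f u) (z *\<^sub>C g u)" using has_wick_scale[OF zu(2), of z] unfolding zu(1) .
  moreover have "has_wick (lin f c) (lin g c)" using Cons by auto
  ultimately show ?case by (simp add: p has_wick_add)
qed (simp add: has_wick_0)

text \<open>On the vacuum each left generator is a multiple of the opposite right generator, and the
  latter can be pulled through \<open>a\<close>. This evaluates the adjoint of a product on the
  vacuum.\<close>

lemma Malg_vac_swap: 
  assumes a: "a \<in> Malg"
  shows "a (yl (B [])) = mu *\<^sub>R R.ys (a (B []))" "a (ys (B [])) = (1 / mu) *\<^sub>R R.yl (a (B []))"
proof -
  have "yl (B []) = mu *\<^sub>R R.ys (B [])" "ys (B []) = (1 / mu) *\<^sub>R R.yl (B [])"
    using mu1 R.cr_B[of False "[]"] R.cr_B[of True "[]"] R.an_vac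
    by (simp_all add: yl_def ys_def R.yl_def R.ys_def)
  then show "a (yl (B [])) = mu *\<^sub>R R.ys (a (B []))" "a (ys (B [])) = (1 / mu) *\<^sub>R R.yl (a (B []))"
    by (simp_all add: bcl_simps[OF Malg_bcl[OF a]] Malg_R_gens[OF a])
qed

text \<open>A longer word is obtained from a generator applied to the shorter word by subtracting
  still shorter ones and rescaling. Taking adjoints moves the generator to the right end, which
  explains the flip; the weights of \<open>Malg_vac_swap\<close> build up \<open>nu\<close>.\<close>

lemma has_wick_word: "has_wick (B w) (nu (key w) *\<^sub>R B (flip w))"
proof (induction "length w" arbitrary: w rule: less_induct)
  case less
  show ?case
  proof (cases w)
    case Nil
    have "id \<in> Malg" unfolding Malg_def by (auto intro!: commutantI)
    then show ?thesis unfolding has_wick_def Nil by (intro bexI[of _ id]) auto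
  next
    case (Cons x v)
    obtain a where a: "a \<in> Malg" "a (B []) = B v" "cadjoint a (B []) = nu (key v) *\<^sub>R B (flip v)"
      using less[of v] Cons by (auto simp: has_wick_def)
    have ba: "bounded_clinear a" by (rule Malg_bcl[OF a(1)])
    have a': "cadjoint a \<in> Malg" by (rule Malg_cadjoint[OF a(1)])
    have sub: "has_wick (lin B (ann q y v)) (lin (\<lambda>u. nu (key u) *\<^sub>R B (flip u)) (ann q y v))" for y
    proof (rule has_wick_lin)
      fix z u assume zu: "(z, u) \<in> set (ann q y v)"
      then show "cnj z = z \<and> has_wick (B u) (nu (key u) *\<^sub>R B (flip u))"
        using less[of u] length_ann[OF zu] real_ann[OF zu] Cons by simp
    qed
    have sub': "lin (\<lambda>u. nu (key u) *\<^sub>R B (flip u)) (ann q y v)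
        = (if y then mu * nu (key v) else nu (key v) / mu) *\<^sub>R lin (\<lambda>u. B (flip u)) (ann q y v)" for y
    proof -
      have "lin (\<lambda>u. nu (key u) *\<^sub>R B (flip u)) (ann q y v)
        = lin (\<lambda>u. of_real (if y then mu * nu (key v) else nu (key v) / mu) *\<^sub>C B (flip u)) (ann q y v)"
        by (rule lin_cong) (drule nu_ann, simp add: scaleC_of_real)
      then show ?thesis unfolding lin_scale unfolding scaleC_of_real .
    qed
    note wick = sub[unfolded sub']
    have Ran: "R.an y (B (flip v)) = lin (\<lambda>u. B (flip u)) (ann q y v)" for y by (rule R.an_B)
    have Rcr: "R.cr y (B (flip v)) = B (flip (y # v))" for y by (rule R.cr_B)
    show ?thesis
    proof (cases x)
      case False
      have "has_wick (ys (B v)) (cadjoint a (yl (B [])))"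
        unfolding has_wick_def
        by (rule bexI[of _ "ys \<circ> a"]) (use a ba gens_Malg in \<open>auto simp: cadjoint_compose cadjoint_ys intro: Malg_compose\<close>)
      then have 1: "has_wick (ys (B v)) (mu *\<^sub>R R.ys (nu (key v) *\<^sub>R B (flip v)))"
        by (simp add: Malg_vac_swap[OF a'] a)
      have "has_wick (ys (B v) + (- mu) *\<^sub>R lin B (ann q True v))
         (mu *\<^sub>R R.ys (nu (key v) *\<^sub>R B (flip v)) + (- mu) *\<^sub>R ((mu * nu (key v)) *\<^sub>R lin (\<lambda>u. B (flip u)) (ann q True v)))"
        using wick[of True] by (intro has_wick_add 1 has_wick_scaleR) simp
      moreover have "ys (B v) + (- mu) *\<^sub>R lin B (ann q True v) = B w"
        using Cons False by (simp add: ys_def an_B)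
      moreover have "mu *\<^sub>R R.ys (nu (key v) *\<^sub>R B (flip v)) + (- mu) *\<^sub>R ((mu * nu (key v)) *\<^sub>R lin (\<lambda>u. B (flip u)) (ann q True v))
         = nu (key w) *\<^sub>R B (flip w)"
      proof -
        have "R.ys (B (flip v)) = mu *\<^sub>R lin (\<lambda>u. B (flip u)) (ann q True v) + B (flip w)"
          unfolding R.ys_def Ran Rcr using Cons False by simp
        then show ?thesis
          by (simp add: bcl_simps[OF R.bcl_ys] nu_Cons Cons False scaleR_add_right mult_ac)
      qed
      ultimately show ?thesis by simp
    next
      case True
      have "has_wick (yl (B v)) (cadjoint a (ys (B [])))"
        unfolding has_wick_def
        by (rule bexI[of _ "yl \<circ> a"]) (use a ba gens_Malg in \<open>auto simp: cadjoint_compose cadjoint_yl intro: Malg_compose\<close>)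
      then have 1: "has_wick (yl (B v)) ((1 / mu) *\<^sub>R R.yl (nu (key v) *\<^sub>R B (flip v)))"
        by (simp add: Malg_vac_swap[OF a'] a)
      have "has_wick ((1 / mu) *\<^sub>R (yl (B v) + (- 1) *\<^sub>R lin B (ann q False v)))
         ((1 / mu) *\<^sub>R ((1 / mu) *\<^sub>R R.yl (nu (key v) *\<^sub>R B (flip v)) + (- 1) *\<^sub>R ((nu (key v) / mu) *\<^sub>R lin (\<lambda>u. B (flip u)) (ann q False v))))"
        using wick[of False] by (intro has_wick_add 1 has_wick_scaleR) simp
      moreover have "(1 / mu) *\<^sub>R (yl (B v) + (- 1) *\<^sub>R lin B (ann q False v)) = B w"
        using Cons True mu1 by (simp add: yl_def an_B)
      moreover have "(1 / mu) *\<^sub>R ((1 / mu) *\<^sub>R R.yl (nu (key v) *\<^sub>R B (flip v)) + (- 1) *\<^sub>R ((nu (key v) / mu) *\<^sub>R lin (\<lambda>u. B (flip u)) (ann q False v)))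
         = nu (key w) *\<^sub>R B (flip w)"
      proof -
        have "R.yl (B (flip v)) = mu *\<^sub>R B (flip w) + lin (\<lambda>u. B (flip u)) (ann q False v)"
          unfolding R.yl_def Ran Rcr using Cons True by simp
        then show ?thesis
          using mu1 by (simp add: bcl_simps[OF R.bcl_yl] nu_Cons Cons True scaleR_add_right)
      qed
      ultimately show ?thesis by simp
    qed
  qed
qed

end

section \<open>Closed graphs of the Tomita operator and of the modular operator\<close>

context q_aw
begin

interpretation R: q_aw q "\<lambda>w. B (flip w)" mu by (rule mirror_aw)

text \<open>The weak form of the action on words, which defines a closed graph at once;
  \<open>tomita_S_eq\<close> identifies it with the closure.\<close>

definition Sgraph :: "('h \<times> 'h) set" where
  "Sgraph = {(x, e). \<forall>w. cinner (B (flip w)) e = of_real (nu (key w)) * cinner x (B w)}"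

lemma closed_Sgraph: "closed Sgraph"
proof -
  have "Sgraph = (\<Inter>w. {p. cinner (B (flip w)) (snd p) = of_real (nu (key w)) * cinner (fst p) (B w)})"
    by (auto simp: Sgraph_def)
  also have "closed \<dots>"
    by (intro closed_INT ballI closed_Collect_eq continuous_intros cinner.continuous_on)
  finally show ?thesis .
qed

lemma R_Malg_commute: "x \<in> Malg \<Longrightarrow> a \<in> R.Malg \<Longrightarrow> x (a v) = a (x v)"
proof -
  assume x: "x \<in> Malg" and a: "a \<in> R.Malg"
  have "x \<in> commutant {R.yl, R.ys}"
    by (rule commutantI) (use Malg_bcl[OF x] Malg_R_gens[OF x] in \<open>auto simp: fun_eq_iff\<close>)
  then show ?thesis using a commutantD'[of a "commutant {R.yl, R.ys}" x v] by (simp add: R.Malg_def)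
qed

definition G0 :: "('h \<times> 'h) set" where
  "G0 = {(x (B []), cadjoint x (B [])) | x. x \<in> Malg}"

lemma G0_eq: "(v, v') \<in> G0 \<longleftrightarrow> has_wick v v'"
  by (auto simp: G0_def has_wick_def)

text \<open>Each flipped word is the vacuum vector of an operator \<open>a\<close> in the right
  algebra, which commutes with \<open>x\<close>. Moving both across the inner product leaves the
  vacuum value of the adjoint of \<open>a\<close>, known from the mirrored
  \<open>has_wick_word\<close>.\<close>

lemma G0_Sgraph: "G0 \<subseteq> Sgraph"
proof
  fix p assume "p \<in> G0"
  then obtain x where x: "x \<in> Malg" and p: "p = (x (B []), cadjoint x (B []))" by (auto simp: G0_def)
  have bx: "bounded_clinear x" by (rule Malg_bcl[OF x])
  have "cinner (B (flip w)) (cadjoint x (B [])) = of_real (nu (key w)) * cinner (x (B [])) (B w)" for w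
  proof -
    obtain a where a: "a \<in> R.Malg" "a (B []) = B (flip w)" "cadjoint a (B []) = nu (key w) *\<^sub>R B w"
      using R.has_wick_word[of w] unfolding R.has_wick_def flip_flip by auto
    have ba: "bounded_clinear a" by (rule R.Malg_bcl[OF a(1)])
    have "cinner (B (flip w)) (cadjoint x (B [])) = cinner (a (x (B []))) (B [])"
      unfolding a(2)[symmetric] cinner_cadjoint'[OF bx] R_Malg_commute[OF x a(1)] ..
    also have "\<dots> = cinner (x (B [])) (cadjoint a (B []))"
      by (simp add: cinner_cadjoint'[OF ba])
    finally show ?thesis by (simp add: a(3) cinner_scaleR_right)
  qed
  then show "p \<in> Sgraph" by (simp add: p Sgraph_def)
qed

definition J :: "'h \<Rightarrow> 'h" where
  "J = (SOME J. bounded_linear J \<and> (\<forall>c x. J (c *\<^sub>C x) = cnj c *\<^sub>C J x) \<and> (\<forall>w. J (B w) = B (flip w))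
    \<and> (\<forall>x y. cinner (J x) (J y) = cinner y x))"

lemma J: "bounded_linear J" "J (c *\<^sub>C x) = cnj c *\<^sub>C J x" "J (B w) = B (flip w)" "cinner (J x) (J y) = cinner y x"
proof -
  have "bounded_linear J \<and> (\<forall>c x. J (c *\<^sub>C x) = cnj c *\<^sub>C J x) \<and> (\<forall>w. J (B w) = B (flip w))
    \<and> (\<forall>x y. cinner (J x) (J y) = cinner y x)"
    unfolding J_def by (rule someI_ex[OF antilinear_mirror_exists])
  then show "bounded_linear J" "J (c *\<^sub>C x) = cnj c *\<^sub>C J x" "J (B w) = B (flip w)" "cinner (J x) (J y) = cinner y x"
    by blast+
qed

definition cutoff :: "nat \<Rightarrow> nat \<times> nat \<Rightarrow> complex" where
  "cutoff N \<kappa> = (if fst \<kappa> + snd \<kappa> < N then 1 else 0)"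

text \<open>The truncated square root of the modular operator, bounded because finitely many
  bidegrees remain.\<close>

definition nucut :: "nat \<Rightarrow> nat \<times> nat \<Rightarrow> complex" where
  "nucut N \<kappa> = (if fst \<kappa> + snd \<kappa> < N then of_real (nu \<kappa>) else 0)"

lemma bdd_cut: "bdd (cutoff N)"
  by (rule bddI[of _ 1]) (simp add: cutoff_def)

lemma bdd_nucut: "bdd (nucut N)"
proof (rule bddI)
  show "cmod (nucut N \<kappa>) \<le> 1 / mu ^ N" for \<kappa>
  proof (cases "fst \<kappa> + snd \<kappa> < N")
    case True
    have "nu \<kappa> \<le> 1 / mu ^ fst \<kappa>"
      using mu1 mu2 by (simp add: nu_def divide_right_mono power_le_one)
    also have "\<dots> \<le> 1 / mu ^ N"
      using True mu1 mu2 by (intro divide_left_mono power_decreasing) auto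
    finally show ?thesis using True nu_pos[of \<kappa>] by (simp add: nucut_def)
  qed (use mu1 in \<open>simp add: nucut_def\<close>)
qed

lemma cinner_dg_word: 
  assumes "bdd g"
  shows "cinner (B w) (dg g x) = g (key w) * cinner (B w) x"
proof -
  have "bdd (\<lambda>\<kappa>. cnj (g \<kappa>))" using assms by (simp add: bdd_def)
  from cinner_dg[OF this, of "B w" x] show ?thesis
    using assms \<open>bdd (\<lambda>\<kappa>. cnj (g \<kappa>))\<close> by (simp add: dg_B cinner_scaleC_left)
qed

lemma cinner_dg_word': "bdd g \<Longrightarrow> cinner (dg g x) (B w) = cnj (g (key w)) * cinner x (B w)"
  using cinner_dg_word[of g w x] cinner_commute[of "dg g x" "B w"] cinner_commute[of x "B w"] by simp

text \<open>For formal combinations this is \<open>has_wick_word\<close> and antilinearity; both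
  truncated maps are bounded, so arbitrary vectors follow by continuity.\<close>

lemma cut_pair_closure: "(dg (cutoff N) u, J (dg (nucut N) u)) \<in> closure G0"
proof (rule dense_induct[where P = "\<lambda>u. (dg (cutoff N) u, J (dg (nucut N) u)) \<in> closure G0"])
  have "continuous_on UNIV (\<lambda>u. (dg (cutoff N) u, J (dg (nucut N) u)))"
    by (intro continuous_on_Pair linear_continuous_on bounded_linear_compose[OF J(1)] bounded_clinear_bl bcl_dg bdd_cut bdd_nucut)
  then have "closed ((\<lambda>u. (dg (cutoff N) u, J (dg (nucut N) u))) -` closure G0)"
    by (intro closed_vimage closed_closure)
  then show "closed {u. (dg (cutoff N) u, J (dg (nucut N) u)) \<in> closure G0}" by (simp add: vimage_def)
  fix c
  have "has_wick (dg (cutoff N) (lin B c)) (J (dg (nucut N) (lin B c)))"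
  proof (induction c)
    case Nil
    show ?case by (simp add: bcl_simps[OF bcl_dg[OF bdd_cut]] bcl_simps[OF bcl_dg[OF bdd_nucut]] linear_simps[OF J(1)] has_wick_0)
  next
    case (Cons p c)
    obtain z w where p: "p = (z, w)" by force
    have "has_wick (dg (cutoff N) (B w)) (J (dg (nucut N) (B w)))"
      using has_wick_word[of w] J(2)[of "of_real (nu (key w))" "B w"]
      by (simp add: dg_B bdd_cut bdd_nucut cutoff_def nucut_def has_wick_0 linear_simps[OF J(1)] J(3) scaleC_of_real)
    then show ?case
      using Cons by (simp add: p bcl_simps[OF bcl_dg[OF bdd_cut]] bcl_simps[OF bcl_dg[OF bdd_nucut]] linear_simps[OF J(1)] J(2)
          has_wick_add has_wick_scale)
  qed
  then show "(dg (cutoff N) (lin B c), J (dg (nucut N) (lin B c))) \<in> closure G0"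
    using closure_subset G0_eq by blast
qed

lemma cut_LIMSEQ: "(\<lambda>N. dg (cutoff N) x) \<longlonglongrightarrow> x"
proof -
  have "(\<lambda>N. dg (cutoff N) x - x) \<longlonglongrightarrow> 0"
  proof (rule tendsto_dense_clinear[where F = "\<lambda>N x. dg (cutoff N) x - x" and K = 2])
    show "bounded_clinear (\<lambda>x. dg (cutoff N) x - x)" for N by (intro bounded_clinear_sub bcl_dg bdd_cut bounded_clinear_id)
    show "norm (dg (cutoff N) x - x) \<le> 2 * norm x" for N x
    proof -
      have "cmod (cutoff N \<kappa>) \<le> 1" for \<kappa> by (simp add: cutoff_def)
      from norm_dg[where x = x, OF this] have "norm (dg (cutoff N) x) \<le> norm x" by simp
      then show ?thesis using norm_triangle_ineq4[of "dg (cutoff N) x" x] by simp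
    qed
    fix w
    have "\<forall>\<^sub>F N in sequentially. 0 = dg (cutoff N) (B w) - B w"
      by (rule eventually_sequentiallyI[of "Suc (length w)"]) (simp add: dg_B bdd_cut cutoff_def key_length)
    then show "(\<lambda>N. dg (cutoff N) (B w) - B w) \<longlonglongrightarrow> 0" by (rule Lim_transform_eventually[OF tendsto_const])
  qed
  then show ?thesis by (rule LIM_zero_cancel)
qed

lemma Sgraph_cut:
  assumes "(x, e) \<in> Sgraph"
  shows "dg (cutoff N) e = J (dg (nucut N) x)"
proof (rule ext_B)
  fix v
  define w where "w = flip v"
  have v: "v = flip w" by (simp only: w_def flip_flip)
  have k: "cutoff N (key (flip w)) = cutoff N (key w)" by (simp add: cutoff_def add.commute)
  have "cinner (B (flip w)) (dg (cutoff N) e) = cutoff N (key w) * (of_real (nu (key w)) * cinner x (B w))"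
    unfolding cinner_dg_word[OF bdd_cut] k using assms by (simp add: Sgraph_def)
  also have "\<dots> = nucut N (key w) * cinner x (B w)" by (simp add: cutoff_def nucut_def)
  also have "\<dots> = cinner (dg (nucut N) x) (B w)"
    by (simp add: cinner_dg_word'[OF bdd_nucut]) (simp add: nucut_def)
  also have "\<dots> = cinner (B (flip w)) (J (dg (nucut N) x))"
    using J(4)[of "B w" "dg (nucut N) x"] by (simp add: J(3))
  finally show "cinner (B v) (dg (cutoff N) e) = cinner (B v) (J (dg (nucut N) x))" unfolding v .
qed

text \<open>The truncated pairs form a core. This serves both to identify the closure and to test
  the antilinear adjoint on truncated vectors only.\<close>

lemma Sgraph_subset_closure:
  assumes X: "closed X" "\<And>N u. (dg (cutoff N) u, J (dg (nucut N) u)) \<in> X"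
  shows "Sgraph \<subseteq> X"
proof
  fix p assume p: "p \<in> Sgraph"
  obtain x e where xe: "p = (x, e)" by force
  have lim: "(\<lambda>N. (dg (cutoff N) x, dg (cutoff N) e)) \<longlonglongrightarrow> (x, e)"
    by (intro tendsto_Pair cut_LIMSEQ)
  have "(dg (cutoff N) x, dg (cutoff N) e) \<in> X" for N
    using X(2)[of N x] Sgraph_cut[of x e N] p by (simp add: xe)
  then show "p \<in> X" unfolding xe by (rule closed_sequentially[OF X(1) _ lim])
qed

lemma tomita_S_eq: "tomita_S Malg (B []) = Sgraph"
proof -
  have "tomita_S Malg (B []) = closure G0" by (simp add: tomita_S_def G0_def)
  moreover have "closure G0 \<subseteq> Sgraph" by (rule closure_minimal[OF G0_Sgraph closed_Sgraph])
  moreover have "Sgraph \<subseteq> closure G0" by (rule Sgraph_subset_closure) (auto intro: cut_pair_closure)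
  ultimately show ?thesis by blast
qed

definition ev :: "nat \<times> nat \<Rightarrow> real" where "ev \<kappa> = (nu \<kappa>)\<^sup>2"

definition Dgraph :: "('h \<times> 'h) set" where
  "Dgraph = {(x, z). \<forall>w. cinner (B w) z = complex_of_real (ev (key w)) * cinner (B w) x}"

lemma word_Sgraph: "(B w, nu (key w) *\<^sub>R B (flip w)) \<in> Sgraph"
  using has_wick_word[of w] G0_Sgraph by (auto simp: G0_eq[symmetric])

lemma modular_subset: "modular_operator Malg (B []) \<subseteq> Dgraph"
proof
  fix p assume "p \<in> modular_operator Malg (B [])"
  then obtain x e z where p: "p = (x, z)" and xe: "(x, e) \<in> Sgraph" and ez: "(e, z) \<in> antilinear_adjoint Sgraph"
    by (auto simp: modular_operator_def tomita_S_eq)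
  have "cinner (B w) z = complex_of_real (ev (key w)) * cinner (B w) x" for w
  proof -
    have "cinner z (B w) = cinner (nu (key w) *\<^sub>R B (flip w)) e"
      using ez word_Sgraph[of w] by (auto simp: antilinear_adjoint_def)
    also have "\<dots> = of_real (nu (key w)) * (of_real (nu (key w)) * cinner x (B w))"
      using xe by (simp add: cinner_scaleR_left Sgraph_def)
    finally have "cinner z (B w) = of_real (ev (key w)) * cinner x (B w)"
      by (simp add: ev_def power2_eq_square)
    then show ?thesis
      using cinner_commute[of "B w" z] cinner_commute[of "B w" x] by simp
  qed
  then show "p \<in> Dgraph" by (simp add: p Dgraph_def)
qed

lemma Dgraph_subset: "Dgraph \<subseteq> modular_operator Malg (B [])"
proof
  fix p assume "p \<in> Dgraph"
  then obtain x z where p: "p = (x, z)" and xz: "\<And>w. cinner (B w) z = complex_of_real (ev (key w)) * cinner (B w) x"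
    by (auto simp: Dgraph_def)
  \<comment> \<open>\<open>v\<close> is to be the square root of the modular operator applied to x.
    Where \<open>nu\<close> is at most 1 it is \<open>nu\<close> times x, elsewhere it is z divided
    by \<open>nu\<close>; both multipliers are bounded.\<close>
  define g1 where "g1 \<kappa> = (if nu \<kappa> \<le> 1 then complex_of_real (nu \<kappa>) else 0)" for \<kappa>
  define g2 where "g2 \<kappa> = (if nu \<kappa> \<le> 1 then 0 else complex_of_real (1 / nu \<kappa>))" for \<kappa>
  have b1: "bdd g1" by (rule bddI[of _ 1]) (use nu_pos in \<open>auto simp: g1_def less_imp_le\<close>)
  have b2: "bdd g2" by (rule bddI[of _ 1]) (use nu_pos in \<open>auto simp: g2_def norm_divide less_imp_le divide_le_eq\<close>)
  define v where "v = dg g1 x + dg g2 z"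
  have v: "cinner (B w) v = of_real (nu (key w)) * cinner (B w) x" for w
    using nu_pos[of "key w"]
    by (auto simp: v_def cinner_add_right cinner_dg_word b1 b2 xz g1_def g2_def ev_def power2_eq_square)
  then have v': "cinner v (B w) = of_real (nu (key w)) * cinner x (B w)" for w
    using cinner_commute[of v "B w"] cinner_commute[of x "B w"] by simp
  have xe: "(x, J v) \<in> Sgraph"
    unfolding Sgraph_def
  proof (clarsimp)
    fix w
    show "cinner (B (flip w)) (J v) = of_real (nu (key w)) * cinner x (B w)"
      using J(4)[of "B w" v] v'[of w] by (simp add: J(3))
  qed
  have cutz: "dg (cutoff N) z = dg (nucut N) v" for N
    by (rule ext_B) (auto simp: cinner_dg_word bdd_cut bdd_nucut xz v cutoff_def nucut_def ev_def power2_eq_square)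
  have "Sgraph \<subseteq> {(a, a'). cinner z a = cinner a' (J v)}"
  proof (rule Sgraph_subset_closure)
    have "closed {p. cinner z (fst p) = cinner (snd p) (J v)}"
      by (intro closed_Collect_eq continuous_intros cinner.continuous_on)
    then show "closed {(a, a'). cinner z a = cinner a' (J v)}" by (simp add: case_prod_unfold)
    fix N u
    have c: "(\<lambda>\<kappa>. cnj (cutoff N \<kappa>)) = cutoff N" "(\<lambda>\<kappa>. cnj (nucut N \<kappa>)) = nucut N"
      by (auto simp: cutoff_def nucut_def fun_eq_iff)
    have "cinner z (dg (cutoff N) u) = cinner (dg (cutoff N) z) u" using cinner_dg[OF bdd_cut, of N z u] c by simp
    also have "\<dots> = cinner v (dg (nucut N) u)" unfolding cutz using cinner_dg[OF bdd_nucut, of N v u] c by simp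
    also have "\<dots> = cinner (J (dg (nucut N) u)) (J v)" by (simp add: J(4))
    finally show "(dg (cutoff N) u, J (dg (nucut N) u)) \<in> {(a, a'). cinner z a = cinner a' (J v)}" by simp
  qed
  then have "(J v, z) \<in> antilinear_adjoint Sgraph" by (auto simp: antilinear_adjoint_def)
  then show "p \<in> modular_operator Malg (B [])"
    using xe by (auto simp: p modular_operator_def tomita_S_eq)
qed

lemma modular_operator_eq: "modular_operator Malg (B []) = Dgraph"
  using modular_subset Dgraph_subset by blast


section \<open>The modular group and the centralizer\<close>

definition phase :: "real \<Rightarrow> real \<Rightarrow> complex" where
  "phase t r = complex_of_real r powr (\<i> * complex_of_real t)"

text \<open>The eigenvalues are positive, but measurability is required on the whole line; a
  negative r has logarithm ln (-r) + i pi, and 0 is sent to 0.\<close>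

lemma measurable_phase: "phase t \<in> borel_measurable borel"
proof -
  have "phase t = (\<lambda>r. if r = 0 then 0 else if r > 0 then exp (\<i> * complex_of_real t * complex_of_real (ln r))
      else exp (\<i> * complex_of_real t * (complex_of_real (ln (- r)) + \<i> * complex_of_real pi)))"
  proof
    fix r :: real
    consider "r = 0" | "r > 0" | "r < 0" by linarith
    then show "phase t r = (if r = 0 then 0 else if r > 0 then exp (\<i> * complex_of_real t * complex_of_real (ln r))
      else exp (\<i> * complex_of_real t * (complex_of_real (ln (- r)) + \<i> * complex_of_real pi)))"
    proof cases
      case 2
      then show ?thesis by (simp add: phase_def powr_def Ln_of_real)
    next
      case 3
      have "Ln (complex_of_real r) = complex_of_real (ln (- r)) + \<i> * complex_of_real pi"
        using Ln_minus[of "complex_of_real (- r)"] 3 Ln_of_real[of "- r"] by (simp add: mult.commute)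
      then show ?thesis using 3 by (simp add: phase_def powr_def)
    qed (simp add: phase_def)
  qed
  then show ?thesis by (simp only:) measurable
qed

lemma phase_unit: "r > 0 \<Longrightarrow> cmod (phase t r) = 1"
  by (simp add: phase_def norm_powr_real_powr)

lemma phase_mult: "r > 0 \<Longrightarrow> s > 0 \<Longrightarrow> phase t (r * s) = phase t r * phase t s"
  by (simp add: phase_def powr_times_real)

lemma phase_minus: "r > 0 \<Longrightarrow> phase t r * phase (- t) r = 1"
  by (simp add: phase_def powr_add[symmetric])

lemma phase_cnj: "r > 0 \<Longrightarrow> cnj (phase t r) = phase (- t) r"
  using phase_unit[of r t] phase_minus[of r t] complex_norm_square[of "phase t r"]
  by (metis mult_cancel_left norm_zero of_real_1 one_power2 zero_neq_one)

definition Vt :: "real \<Rightarrow> 'h \<Rightarrow> 'h" where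
  "Vt t = dg (\<lambda>\<kappa>. phase t (ev \<kappa>))"

lemma ev_pos: "ev \<kappa> > 0" using nu_pos[of \<kappa>] by (simp add: ev_def)

lemma bdd_Vt: "bdd (\<lambda>\<kappa>. phase t (ev \<kappa>))"
  by (rule bddI[of _ 1]) (simp add: phase_unit ev_pos)

lemma bcl_Vt [intro, simp]: "bounded_clinear (Vt t)"
  unfolding Vt_def by (rule bcl_dg[OF bdd_Vt])

lemma Vt_B: "Vt t (B w) = phase t (ev (key w)) *\<^sub>C B w"
  by (simp add: Vt_def dg_B[OF bdd_Vt])

lemma Vt_inverse: "Vt t (Vt (- t) x) = x" "Vt (- t) (Vt t x) = x"
  by (rule bcl_eqI'[where f = "\<lambda>x. Vt t (Vt (- t) x)" and g = "\<lambda>x. x"],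
      auto simp: Vt_B bcl_simps[OF bcl_Vt] scaleC_scaleC phase_minus ev_pos mult.commute)
    (rule bcl_eqI'[where f = "\<lambda>x. Vt (- t) (Vt t x)" and g = "\<lambda>x. x"],
      auto simp: Vt_B bcl_simps[OF bcl_Vt] scaleC_scaleC phase_minus ev_pos mult.commute)

lemma cadjoint_Vt: "cadjoint (Vt t) = Vt (- t)"
proof (rule cadjoint_eqI[OF bcl_Vt])
  have c: "(\<lambda>\<kappa>. cnj (phase (- t) (ev \<kappa>))) = (\<lambda>\<kappa>. phase t (ev \<kappa>))"
    by (simp add: phase_cnj ev_pos)
  show "cinner (Vt (- t) x) y = cinner x (Vt t y)" for x y
    using cinner_dg[OF bdd_Vt[of "- t"], of x y] unfolding c by (simp add: Vt_def)
qed

lemma Dgraph_spectral: "Dgraph = spectral_integral (Esp ev) complex_of_real"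
  unfolding spectral_integral_Esp[OF measurable_of_real] by (simp add: Dgraph_def)

lemma Vt_spectral: "{(x, Vt t x) | x. True} = spectral_integral (Esp ev) (\<lambda>r. complex_of_real r powr (\<i> * complex_of_real t))"
proof -
  have "spectral_integral (Esp ev) (phase t) = {(x, z). \<forall>w. cinner (B w) z = cinner (B w) (Vt t x)}"
    unfolding spectral_integral_Esp[OF measurable_phase] Vt_def by (simp add: cinner_dg_word bdd_Vt)
  also have "\<dots> = {(x, Vt t x) | x. True}"
    using ext_B by auto
  finally show ?thesis by (simp add: phase_def[abs_def])
qed

text \<open>A competing spectral measure represents the same operator, hence is the diagonal one on
  Borel sets and yields the same unitary.\<close>

lemma imaginary_power_eq: "imaginary_power (modular_operator Malg (B [])) t = Vt t"
  unfolding imaginary_power_def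
proof (rule the_equality)
  show "\<exists>E. spectral_measure E \<and> modular_operator Malg (B []) = spectral_integral E complex_of_real \<and>
      {(x, Vt t x) |x. True} = spectral_integral E (\<lambda>r. complex_of_real r powr (\<i> * complex_of_real t))"
    using spectral_measure_Esp[of ev] Dgraph_spectral Vt_spectral modular_operator_eq by blast
next
  fix V :: "'h \<Rightarrow> 'h"
  assume "\<exists>E. spectral_measure E \<and> modular_operator Malg (B []) = spectral_integral E complex_of_real \<and>
      {(x, V x) |x. True} = spectral_integral E (\<lambda>r. complex_of_real r powr (\<i> * complex_of_real t))"
  then obtain E where E: "spectral_measure E" "spectral_integral E complex_of_real = spectral_integral (Esp ev) complex_of_real"
    and V: "{(x, V x) |x. True} = spectral_integral E (\<lambda>r. complex_of_real r powr (\<i> * complex_of_real t))"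
    using modular_operator_eq Dgraph_spectral by auto
  have "spectral_integral E f = spectral_integral (Esp ev) f" for f
    by (rule spectral_integral_cong) (rule spectral_measure_unique[OF E])
  then have "{(x, V x) |x. True} = {(x, Vt t x) | x. True}" unfolding V Vt_spectral by simp
  then show "V = Vt t" by (auto simp: fun_eq_iff set_eq_iff)
qed

text \<open>Invariance under the modular group means commuting with the unitaries
  \<open>Vt t\<close>. Written as the commutant of a set closed under adjoints, the centralizer is
  seen to be a von Neumann algebra.\<close>

lemma centralizer_eq: "centralizer Malg (B []) = commutant (commutant {yl, ys} \<union> range Vt)"
proof (intro set_eqI iffI)
  fix x assume "x \<in> centralizer Malg (B [])"
  then have x: "x \<in> Malg" and c: "\<And>t. Vt t \<circ> x \<circ> Vt (- t) = x"
    by (auto simp: centralizer_def modular_automorphism_def imaginary_power_eq)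
  have "x (Vt t v) = Vt t (x v)" for t v
    using fun_cong[OF c[of t], of "Vt t v"] by (simp add: Vt_inverse)
  then show "x \<in> commutant (commutant {yl, ys} \<union> range Vt)"
    using x by (auto intro!: commutantI dest: commutant_bcl commutantD simp: Malg_def fun_eq_iff)
next
  fix x assume x: "x \<in> commutant (commutant {yl, ys} \<union> range Vt)"
  then have "x \<in> Malg" using commutant_antimono[of "commutant {yl, ys}"] by (auto simp: Malg_def)
  moreover have "Vt t \<circ> x \<circ> Vt (- t) = x" for t
  proof
    fix v
    have "x (Vt t (Vt (- t) v)) = Vt t (x (Vt (- t) v))" by (rule commutantD'[OF x]) simp
    then show "(Vt t \<circ> x \<circ> Vt (- t)) v = x v" by (simp add: Vt_inverse)
  qed
  ultimately show "x \<in> centralizer Malg (B [])"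
    by (simp add: centralizer_def modular_automorphism_def imaginary_power_eq)
qed

lemma Vt_cr: "Vt t (cr x v) = phase t (if x then 1 / mu\<^sup>2 else mu\<^sup>2) *\<^sub>C cr x (Vt t v)"
proof -
  have e: "ev (key (x # w)) = (if x then 1 / mu\<^sup>2 else mu\<^sup>2) * ev (key w)" for w
    by (simp add: ev_def nu_Cons power_mult_distrib power_divide)
  have p: "phase t (ev (key (x # w))) = phase t (if x then 1 / mu\<^sup>2 else mu\<^sup>2) * phase t (ev (key w))" for w
    unfolding e by (rule phase_mult) (use mu1 ev_pos in auto)
  show ?thesis
    by (rule bcl_eqI'[where f = "\<lambda>v. Vt t (cr x v)"])
      (auto simp: Vt_B p bcl_simps[OF bcl_cr] scaleC_scaleC mult.commute intro!: bounded_clinear_cmult)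
qed

lemma phase_inverse_arg: "r > 0 \<Longrightarrow> phase t (1 / r) = phase (- t) r"
proof -
  assume r: "r > 0"
  have "phase t (1 / r) * phase t r = 1" using phase_mult[of "1 / r" r t] r by (simp add: phase_def)
  then show ?thesis using phase_minus[OF r, of t]
    by (metis mult.commute mult.left_commute mult.right_neutral)
qed

lemma Vt_an: "Vt t (an x v) = phase (- t) (if x then 1 / mu\<^sup>2 else mu\<^sup>2) *\<^sub>C an x (Vt t v)"
proof -
  let ?r = "if x then 1 / mu\<^sup>2 else mu\<^sup>2"
  have r: "?r > 0" using mu1 by simp
  have "cinner z (Vt t (an x v)) = cinner z (phase (- t) ?r *\<^sub>C an x (Vt t v))" for z
  proof -
    have "cinner z (Vt t (an x v)) = cinner (cr x (Vt (- t) z)) v"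
      using cinner_cadjoint[OF bcl_Vt, of t z "an x v"] by (simp add: cadjoint_Vt cinner_cr)
    also have "cr x (Vt (- t) z) = phase t ?r *\<^sub>C Vt (- t) (cr x z)"
      unfolding Vt_cr using phase_minus[OF r, of t] by (simp add: scaleC_scaleC)
    also have "cinner \<dots> v = phase (- t) ?r * cinner (cr x z) (Vt t v)"
      using cinner_cadjoint[OF bcl_Vt, of t "cr x z" v] phase_cnj[OF r, of t] by (simp add: cinner_scaleC_left cadjoint_Vt)
    finally show ?thesis by (simp add: cinner_scaleC_right cinner_cr)
  qed
  then show ?thesis by (rule cinner_ext)
qed

text \<open>The generators are scaled by inverse phases, and the Wick word contains equally many
  letters of each kind.\<close>

lemma Vt_W: "Vt t (W n n v) = W n n (Vt t v)"
proof -
  have m: "mu\<^sup>2 > 0" using mu1 by simp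
  let ?a = "phase (- t) (mu\<^sup>2)"
  have "Vt t (yl v) = ?a *\<^sub>C yl (Vt t v)" for v
    using m by (simp add: yl_def bcl_simps[OF bcl_Vt] Vt_cr Vt_an phase_inverse_arg scaleC_add_right scaleC_scaleR)
  moreover have "Vt t (ys v) = phase t (mu\<^sup>2) *\<^sub>C ys (Vt t v)" for v
    using m by (simp add: ys_def bcl_simps[OF bcl_Vt] Vt_cr Vt_an phase_inverse_arg scaleC_add_right scaleC_scaleR)
  moreover have ab: "?a * phase t (mu\<^sup>2) = 1" using phase_minus[OF m, of t] by (simp add: mult.commute)
  ultimately have "Vt t (W n n v) = (?a ^ n * phase t (mu\<^sup>2) ^ n) *\<^sub>C W n n (Vt t v)"
    by (intro W_covariant) auto
  then show ?thesis using ab by (simp add: power_mult_distrib[symmetric])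
qed

lemma W_centralizer: "W n n \<in> centralizer Malg (B [])"
  unfolding centralizer_eq
proof (rule commutantI)
  fix y assume "y \<in> commutant {yl, ys} \<union> range Vt"
  then show "W n n \<circ> y = y \<circ> W n n"
    using commutantD[of "W n n" "commutant {yl, ys}" y] W_in_Malg[of n n]
    by (auto simp: Malg_def fun_eq_iff Vt_W)
qed simp

text \<open>The centers of the centralizer and of the whole algebra both lie in the relative
  commutant, so the two factor statements follow from the first one.\<close>

theorem factor_centralizer:
  assumes small: "(C_const q)\<^sup>2 * (U_bound q * sqrt (U_bound q)) * (mu / (1 - mu)) < 1"
  defines "N \<equiv> centralizer Malg (B [])"
  shows "commutant N \<inter> Malg = scalar_operators \<and> factor N \<and> factor Malg"
proof -
  let ?X = "commutant {yl, ys} \<union> range Vt"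
  have X: "bounded_clinear x \<and> cadjoint x \<in> ?X" if "x \<in> ?X" for x
    using that commutant_gens_closed by (auto simp: cadjoint_Vt)
  have vN: "von_neumann_algebra N" unfolding N_def centralizer_eq by (rule von_neumann_algebra_commutant[OF X])
  have NM: "N \<subseteq> Malg" by (auto simp: N_def centralizer_def)
  have sN: "scalar_operators \<subseteq> N" unfolding N_def centralizer_eq
    by (rule scalar_operators_subset_commutant) (use X in blast)
  have sN': "scalar_operators \<subseteq> commutant N"
    by (rule scalar_operators_subset_commutant) (use NM Malg_bcl in blast)
  have sM': "scalar_operators \<subseteq> commutant Malg"
    by (rule scalar_operators_subset_commutant) (use Malg_bcl in blast)
  have "commutant N \<inter> Malg \<subseteq> scalar_operators"
  proof
    fix x assume x: "x \<in> commutant N \<inter> Malg"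
    have "x (W n n v) = W n n (x v)" for n v
      using x W_centralizer[of n] commutantD'[of x N "W n n" v] by (auto simp: N_def)
    then obtain c where "x = (\<lambda>v. c *\<^sub>C v)"
      using relative_commutant_scalar[OF small, of x] x by blast
    then show "x \<in> scalar_operators" by (auto simp: scalar_operators_def)
  qed
  then have main: "commutant N \<inter> Malg = scalar_operators" using sN sN' NM by blast
  have "N \<inter> commutant N = scalar_operators" using main NM sN sN' by blast
  moreover have "Malg \<inter> commutant Malg = scalar_operators"
    using main commutant_antimono[OF NM] sM' sN NM by blast
  ultimately show ?thesis using main vN von_neumann_Malg by (simp add: factor_def)
qed

end


section \<open>The permutation formula for the q-inner product\<close>

text \<open>The increasing enumeration of the natural numbers other than \<open>j\<close>; it
  relabels the values of a permutation once the value \<open>j\<close> is taken.\<close>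

definition skip :: "nat \<Rightarrow> nat \<Rightarrow> nat" where "skip j m = (if m < j then m else Suc m)"
definition unskip :: "nat \<Rightarrow> nat \<Rightarrow> nat" where "unskip j m = (if m < j then m else m - 1)"

lemma unskip_skip [simp]: "unskip j (skip j m) = m"
  by (auto simp: skip_def unskip_def)

lemma skip_unskip: "m \<noteq> j \<Longrightarrow> skip j (unskip j m) = m"
  by (auto simp: skip_def unskip_def)

lemma skip_less_iff: "skip j a < skip j b \<longleftrightarrow> a < b"
  by (auto simp: skip_def)

text \<open>The permutation with first value \<open>j\<close> whose remaining values are ordered
  like \<open>s\<close>; together with \<open>perm_tl\<close> this is the bijection behind the
  expansion along the first position.\<close>

definition perm_cons :: "nat \<Rightarrow> (nat \<Rightarrow> nat) \<Rightarrow> nat \<Rightarrow> nat" where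
  "perm_cons j s k = (case k of 0 \<Rightarrow> j | Suc i \<Rightarrow> skip j (s i))"

definition perm_tl :: "(nat \<Rightarrow> nat) \<Rightarrow> nat \<Rightarrow> nat" where
  "perm_tl p i = unskip (p 0) (p (Suc i))"

lemma perm_cons_0 [simp]: "perm_cons j s 0 = j"
  and perm_cons_Suc [simp]: "perm_cons j s (Suc i) = skip j (s i)"
  by (simp_all add: perm_cons_def)

lemma permutesI_inj:
  fixes p :: "nat \<Rightarrow> nat"
  assumes "\<And>x. x < n \<Longrightarrow> p x < n" "\<And>x. x \<ge> n \<Longrightarrow> p x = x" "inj_on p {..<n}"
  shows "p permutes {..<n}"
proof (rule bij_imp_permutes)
  have "p ` {..<n} = {..<n}" by (rule endo_inj_surj) (use assms in auto)
  then show "bij_betw p {..<n} {..<n}" using assms(3) by (simp add: bij_betw_def)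
qed (use assms(2) in auto)

lemma perm_cons_permutes:
  assumes j: "j < Suc n" and s: "s permutes {..<n}"
  shows "perm_cons j s permutes {..<Suc n}"
proof (rule permutesI_inj)
  have sn: "i < n \<Longrightarrow> s i < n" and sid: "i \<ge> n \<Longrightarrow> s i = i" for i
    using permutes_in_image[OF s, of i] permutes_not_in[OF s, of i] by auto
  show "perm_cons j s x < Suc n" if "x < Suc n" for x
    using that j sn by (cases x) (auto simp: skip_def less_SucI)
  show "perm_cons j s x = x" if "x \<ge> Suc n" for x
    using that j sid by (cases x) (auto simp: skip_def)
  have inj: "s i = s k \<longleftrightarrow> i = k" for i k using permutes_inj[OF s] by (auto simp: inj_eq)
  have ne: "skip j m \<noteq> j" and sk: "skip j m = skip j m' \<longleftrightarrow> m = m'" for m m' by (auto simp: skip_def)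
  show "inj_on (perm_cons j s) {..<Suc n}"
  proof (rule inj_onI)
    fix x y assume "perm_cons j s x = perm_cons j s y"
    then show "x = y" by (cases x; cases y) (simp_all add: sk inj ne ne[symmetric])
  qed
qed

lemma perm_tl_permutes:
  assumes p: "p permutes {..<Suc n}"
  shows "perm_tl p permutes {..<n}" "p 0 < Suc n" "perm_cons (p 0) (perm_tl p) = p"
proof -
  have pn: "i < Suc n \<Longrightarrow> p i < Suc n" and pid: "i \<ge> Suc n \<Longrightarrow> p i = i" for i
    using permutes_in_image[OF p, of i] permutes_not_in[OF p, of i] by auto
  have inj: "p i = p k \<longleftrightarrow> i = k" for i k using permutes_inj[OF p] by (auto simp: inj_eq)
  show p0: "p 0 < Suc n" by (rule pn) simp
  have ne: "p (Suc i) \<noteq> p 0" for i by (simp add: inj)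
  show c: "perm_cons (p 0) (perm_tl p) = p"
    by (rule ext) (auto simp: perm_cons_def perm_tl_def skip_unskip ne split: nat.splits)
  show "perm_tl p permutes {..<n}"
  proof (rule permutesI_inj)
    fix x assume "x < n"
    then have "p (Suc x) < Suc n" by (intro pn) simp
    then show "perm_tl p x < n" using ne[of x] p0 by (auto simp: perm_tl_def unskip_def)
  next
    fix x assume "x \<ge> n"
    then show "perm_tl p x = x" using pid[of "Suc x"] p0 by (auto simp: perm_tl_def unskip_def)
  next
    show "inj_on (perm_tl p) {..<n}"
    proof (rule inj_onI)
      fix x y assume "perm_tl p x = perm_tl p y"
      then have "p (Suc x) = p (Suc y)" using c by (metis perm_cons_Suc)
      then show "x = y" by (simp add: inj)
    qed
  qed
qed

lemma perm_tl_cons [simp]: "perm_tl (perm_cons j s) = s"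
  by (rule ext) (simp add: perm_tl_def)

text \<open>The first value \<open>j\<close> has exactly \<open>j\<close> smaller values after it,
  and \<open>skip\<close> preserves the order of the others.\<close>

lemma inversions_cons:
  assumes j: "j < Suc n" and s: "s permutes {..<n}"
  shows "inversions (Suc n) (perm_cons j s) = j + inversions n s"
proof -
  let ?p = "perm_cons j s"
  let ?A = "(\<lambda>i. (0, Suc i)) ` {i. i < n \<and> s i < j}"
  let ?I = "{(i, k). i < k \<and> k < n \<and> s k < s i}"
  have "{(i, k). i < k \<and> k < Suc n \<and> ?p k < ?p i} = ?A \<union> map_prod Suc Suc ` ?I"
  proof (intro set_eqI iffI)
    fix x assume "x \<in> {(i, k). i < k \<and> k < Suc n \<and> ?p k < ?p i}"
    then obtain i k where x: "x = (i, k)" "i < k" "k < Suc n" "?p k < ?p i" by auto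
    then obtain k' where k: "k = Suc k'" by (cases k) auto
    show "x \<in> ?A \<union> map_prod Suc Suc ` ?I"
    proof (cases i)
      case 0
      then show ?thesis using x k by (auto simp: skip_def split: if_splits)
    next
      case (Suc i')
      then have "(i', k') \<in> ?I" using x k by (simp add: skip_less_iff)
      then show ?thesis using x k Suc by force
    qed
  qed (auto simp: skip_less_iff, auto simp: skip_def)
  moreover have "finite ?I" by (rule finite_subset[of _ "{..<n} \<times> {..<n}"]) auto
  moreover have "card ?A = j"
  proof -
    have "card ?A = card {i. i < n \<and> s i < j}" by (rule card_image) (simp add: inj_on_def)
    also have "\<dots> = card (s ` {i. i < n \<and> s i < j})"
      by (rule card_image[symmetric]) (use permutes_inj[OF s] in \<open>auto intro: inj_on_subset\<close>)
    also have "s ` {i. i < n \<and> s i < j} = {..<j}"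
    proof (intro set_eqI iffI)
      fix y assume "y \<in> {..<j}"
      then have "y \<in> s ` {..<n}" using permutes_image[OF s] j by auto
      then show "y \<in> s ` {i. i < n \<and> s i < j}" using \<open>y \<in> {..<j}\<close> by auto
    qed auto
    finally show ?thesis by simp
  qed
  moreover have "card (map_prod Suc Suc ` ?I) = inversions n s"
    unfolding inversions_def by (rule card_image) (auto simp: inj_on_def)
  moreover have "?A \<inter> map_prod Suc Suc ` ?I = {}" by auto
  ultimately show ?thesis
    by (simp add: inversions_def[of "Suc n"] card_Un_disjoint)
qed

definition del_nth :: "nat \<Rightarrow> 'a list \<Rightarrow> 'a list" where
  "del_nth j w = take j w @ drop (Suc j) w"

lemma length_del_nth: "j < length w \<Longrightarrow> length (del_nth j w) = length w - 1"
  by (simp add: del_nth_def)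

lemma nth_del_nth: "j < length w \<Longrightarrow> m < length w - 1 \<Longrightarrow> del_nth j w ! m = w ! skip j m"
  by (auto simp: del_nth_def skip_def nth_append min_def)

lemma q_inner_Nil: "q_inner q U [] w = (if w = [] then 1 else 0)"
proof -
  have "{p. p permutes ({} :: nat set)} = {id}" by auto
  then show ?thesis by (auto simp: q_inner_def inversions_def)
qed

text \<open>The analogue of expanding a determinant along its first row, with \<open>q ^ j\<close>
  in place of the sign.\<close>

lemma q_inner_Cons:
  "q_inner q U (x # v) w = (\<Sum>j<length w. of_real (q ^ j) * U_inner U x (w ! j) * q_inner q U v (del_nth j w))"
proof (cases "length w = Suc (length v)")
  case False
  have "q_inner q U v (del_nth j w) = 0" if "j < length w" for j
    using that False by (auto simp: q_inner_def length_del_nth)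
  then have "(\<Sum>j<length w. of_real (q ^ j) * U_inner U x (w ! j) * q_inner q U v (del_nth j w)) = 0"
    by (intro sum.neutral) auto
  then show ?thesis using False by (simp add: q_inner_def[of q U "x # v"])
next
  case True
  define n where "n = length v"
  have w: "length w = Suc n" using True by (simp add: n_def)
  define P where "P p = complex_of_real (q ^ inversions (Suc n) p) * (\<Prod>k<Suc n. U_inner U ((x # v) ! k) (w ! p k))" for p
  define Q where "Q j s = complex_of_real (q ^ inversions n s) * (\<Prod>k<n. U_inner U (v ! k) (del_nth j w ! s k))" for j s
  have PQ: "P (perm_cons j s) = of_real (q ^ j) * U_inner U x (w ! j) * Q j s" if j: "j < Suc n" and s: "s permutes {..<n}" for j s
  proof -
    have "(\<Prod>k<Suc n. U_inner U ((x # v) ! k) (w ! perm_cons j s k)) = U_inner U x (w ! j) * (\<Prod>k<n. U_inner U (v ! k) (w ! skip j (s k)))"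
      unfolding prod.lessThan_Suc_shift by simp
    also have "(\<Prod>k<n. U_inner U (v ! k) (w ! skip j (s k))) = (\<Prod>k<n. U_inner U (v ! k) (del_nth j w ! s k))"
      using permutes_in_image[OF s] w j by (intro prod.cong refl) (auto simp: nth_del_nth)
    finally show ?thesis using inversions_cons[OF j s] by (simp add: P_def Q_def power_add)
  qed
  have "q_inner q U (x # v) w = (\<Sum>p | p permutes {..<Suc n}. P p)"
    using w by (simp add: q_inner_def P_def n_def)
  also have "\<dots> = (\<Sum>(j, s)\<in>{..<Suc n} \<times> {s. s permutes {..<n}}. of_real (q ^ j) * U_inner U x (w ! j) * Q j s)"
  proof (rule sum.reindex_bij_witness[where i = "\<lambda>(j, s). perm_cons j s" and j = "\<lambda>p. (p 0, perm_tl p)"])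
    fix p assume "p \<in> {p. p permutes {..<Suc n}}"
    then have p: "p permutes {..<Suc n}" by simp
    note t = perm_tl_permutes[OF p]
    show "(case (p 0, perm_tl p) of (j, s) \<Rightarrow> perm_cons j s) = p" using t(3) by simp
    show "(p 0, perm_tl p) \<in> {..<Suc n} \<times> {s. s permutes {..<n}}" using t(1,2) by simp
    show "(case (p 0, perm_tl p) of (j, s) \<Rightarrow> of_real (q ^ j) * U_inner U x (w ! j) * Q j s) = P p"
      using PQ[OF t(2,1)] unfolding t(3) by simp
  qed (auto simp: perm_cons_permutes)
  also have "\<dots> = (\<Sum>j<Suc n. of_real (q ^ j) * U_inner U x (w ! j) * (\<Sum>s | s permutes {..<n}. Q j s))"
    by (simp only: sum.cartesian_product[symmetric] sum_distrib_left)
  also have "\<dots> = (\<Sum>j<length w. of_real (q ^ j) * U_inner U x (w ! j) * q_inner q U v (del_nth j w))"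
    using w by (intro sum.cong) (auto simp: q_inner_def Q_def length_del_nth n_def)
  finally show ?thesis .
qed

lemma lin_ann_sum: "lin F (ann q x w) = (\<Sum>j<length w. if w ! j = x then of_real (q ^ j) * F (del_nth j w) else (0::complex))"
proof (induction w arbitrary: F)
  case (Cons c w)
  show ?case
    unfolding lin_ann_Cons Cons length_Cons sum.lessThan_Suc_shift
    by (auto simp: del_nth_def sum_distrib_left mult.assoc intro!: sum.cong)
qed simp

lemma q_inner_orthonormal:
  assumes L: "\<And>x y. U_inner U (L x) (L y) = (if x = y then 1 else 0)"
  shows "q_inner q U (map L v) (map L w) = qi q v w"
proof (induction v arbitrary: w)
  case (Cons x v)
  have "q_inner q U (map L (x # v)) (map L w) = (\<Sum>j<length w. of_real (q ^ j) * (if w ! j = x then 1 else 0) * q_inner q U (map L v) (map L (del_nth j w)))"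
    by (auto simp: q_inner_Cons L del_nth_def take_map drop_map intro!: sum.cong)
  also have "\<dots> = lin (qi q v) (ann q x w)"
    unfolding lin_ann_sum Cons by (intro sum.cong) auto
  finally show ?case by simp
qed (simp add: q_inner_Nil)

lemma U_inner_add: "U_inner U (a *s x + b *s y) z = cnj a * U_inner U x z + cnj b * U_inner U y z"
  by (simp add: U_inner_def Let_def matrix_vector_right_distrib vector_scalar_commute distrib_right
      sum.distrib sum_distrib_left mult.assoc)

lemma q_inner_linear:
  "q_inner q U (pre @ (a *s x + b *s y) # post) w
    = cnj a * q_inner q U (pre @ x # post) w + cnj b * q_inner q U (pre @ y # post) w"
proof (induction pre arbitrary: w)
  case Nil
  show ?case
    by (simp add: q_inner_Cons U_inner_add sum_distrib_left sum.distrib[symmetric] algebra_simps)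
next
  case (Cons c pre)
  show ?case
    by (simp add: q_inner_Cons Cons sum_distrib_left sum.distrib[symmetric] algebra_simps)
qed

text \<open>The inner products alone are prescribed, so multilinearity is deduced: the defect is a
  combination of vectors in the range of \<open>T\<close> and is orthogonal to that range, hence to
  itself.\<close>

lemma fock_multilinear:
  assumes T: "is_q_fock_space q U T"
  shows "T (pre @ (a *s x + b *s y) # post) = a *\<^sub>C T (pre @ x # post) + b *\<^sub>C T (pre @ y # post)"
proof -
  define d where "d = T (pre @ (a *s x + b *s y) # post) - (a *\<^sub>C T (pre @ x # post) + b *\<^sub>C T (pre @ y # post))"
  have "cinner d (T w) = 0" for w
    using T unfolding d_def is_q_fock_space_def
    by (simp add: cinner_diff_left cinner_add_left cinner_scaleC_left q_inner_linear)
  then have "cinner d d = 0"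
    by (subst (2) d_def) (simp add: cinner_diff_right cinner_add_right cinner_scaleC_right)
  then show ?thesis by (simp add: d_def)
qed


section \<open>The deformed one-particle space\<close>

text \<open>The commutative algebra spanned by the identity and a quarter turn; it contains the
  rotations, their analytic continuation and all inverses that occur.\<close>

definition hyp_matrix :: "complex \<Rightarrow> complex \<Rightarrow> complex^2^2" where
  "hyp_matrix a b = vector [vector [a, b], vector [- b, a]]"

lemma hyp_matrix_nth [simp]:
  "hyp_matrix a b $ 1 $ 1 = a" "hyp_matrix a b $ 1 $ 2 = b" "hyp_matrix a b $ 2 $ 1 = - b" "hyp_matrix a b $ 2 $ 2 = a"
  by (simp_all add: hyp_matrix_def)

lemma hyp_matrix_mult: "hyp_matrix a b ** hyp_matrix c d = hyp_matrix (a * c - b * d) (a * d + b * c)"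
  by (simp add: vec_eq_iff forall_2 matrix_matrix_mult_def sum_2 algebra_simps)

lemma hyp_matrix_one: "hyp_matrix 1 0 = mat 1"
  by (simp add: vec_eq_iff forall_2 mat_def)

lemma matrix_inv_unique:
  fixes A :: "complex^'n^'n"
  assumes "A ** A' = mat 1" "A' ** A = mat 1"
  shows "matrix_inv A = A'"
proof -
  have "A ** matrix_inv A = mat 1 \<and> matrix_inv A ** A = mat 1"
    unfolding matrix_inv_def by (rule someI[of _ A']) (use assms in auto)
  note inv = this
  have "matrix_inv A = (A' ** A) ** matrix_inv A" using assms by simp
  also have "\<dots> = A' ** (A ** matrix_inv A)" by (simp only: matrix_mul_assoc)
  also have "\<dots> = A'" using inv by simp
  finally show ?thesis .
qed

lemma hyp_matrix_inv:
  assumes "a\<^sup>2 + b\<^sup>2 \<noteq> 0"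
  shows "matrix_inv (hyp_matrix a b) = hyp_matrix (a / (a\<^sup>2 + b\<^sup>2)) (- b / (a\<^sup>2 + b\<^sup>2))"
proof (rule matrix_inv_unique)
  have e: "a * (a / (a\<^sup>2 + b\<^sup>2)) - b * (- b / (a\<^sup>2 + b\<^sup>2)) = 1"
    using assms by (simp add: add_divide_distrib[symmetric] power2_eq_square)
  show "hyp_matrix a b ** hyp_matrix (a / (a\<^sup>2 + b\<^sup>2)) (- b / (a\<^sup>2 + b\<^sup>2)) = mat 1"
    unfolding hyp_matrix_mult hyp_matrix_one[symmetric] e by simp
  show "hyp_matrix (a / (a\<^sup>2 + b\<^sup>2)) (- b / (a\<^sup>2 + b\<^sup>2)) ** hyp_matrix a b = mat 1"
    unfolding hyp_matrix_mult hyp_matrix_one[symmetric] using e by (simp add: mult.commute)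
qed

lemma hyp_matrix_add: "hyp_matrix a b + hyp_matrix c d = hyp_matrix (a + c) (b + d)"
  by (simp add: vec_eq_iff forall_2)

lemma analytic_generator_rotation:
  "analytic_generator (\<lambda>t. map_matrix complex_of_real (rotation_group lam t))
    = hyp_matrix (cos (- \<i> * complex_of_real (ln lam))) (- sin (- \<i> * complex_of_real (ln lam)))"
  unfolding analytic_generator_def
proof (rule the_equality)
  define F where "F z = hyp_matrix (cos (z * complex_of_real (ln lam))) (- sin (z * complex_of_real (ln lam)))" for z
  have hF: "(\<lambda>z. F z $ i $ j) holomorphic_on UNIV" for i j
    using exhaust_2[of i] exhaust_2[of j] by (auto simp: F_def intro!: holomorphic_intros)
  have FV: "F (complex_of_real t) = map_matrix complex_of_real (rotation_group lam t)" for t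
    by (simp add: F_def vec_eq_iff forall_2 rotation_group_def map_matrix_def cos_of_real sin_of_real flip: of_real_mult)
  show "\<exists>F. (\<forall>i j. (\<lambda>z. F z $ i $ j) holomorphic_on UNIV) \<and>
      (\<forall>t. F (complex_of_real t) = map_matrix complex_of_real (rotation_group lam t)) \<and>
      hyp_matrix (cos (- \<i> * complex_of_real (ln lam))) (- sin (- \<i> * complex_of_real (ln lam))) = F (- \<i>)"
    using hF FV by (intro exI[of _ F]) (simp add: F_def)
  fix A
  assume "\<exists>F. (\<forall>i j. (\<lambda>z. F z $ i $ j) holomorphic_on UNIV) \<and>
      (\<forall>t. F (complex_of_real t) = map_matrix complex_of_real (rotation_group lam t)) \<and> A = F (- \<i>)"
  then obtain G :: "complex \<Rightarrow> complex^2^2" where G: "\<And>i j. (\<lambda>z. G z $ i $ j) holomorphic_on UNIV"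
      "\<And>t. G (complex_of_real t) = F (complex_of_real t)" "A = G (- \<i>)"
    using FV by metis
  have "G (- \<i>) $ i $ j = F (- \<i>) $ i $ j" for i j
  proof -
    \<comment> \<open>The real line accumulates at 0, so any two entire extensions agree by the
      identity theorem.\<close>
    have "(0::complex) islimpt range complex_of_real"
      unfolding islimpt_sequential
      by (rule exI[of _ "\<lambda>n. complex_of_real (inverse (real (Suc n)))"])
        (auto intro!: tendsto_of_real[of _ 0, simplified] LIMSEQ_inverse_real_of_nat simp del: of_nat_Suc of_real_inverse)
    then have "G (- \<i>) $ i $ j - F (- \<i>) $ i $ j = 0"
      by (rule analytic_continuation[where f = "\<lambda>z. G z $ i $ j - F z $ i $ j" and S = UNIV and U = "range complex_of_real" and \<xi> = 0, rotated 5])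
        (auto intro!: holomorphic_intros hF G(1) simp: G(2))
    then show ?thesis by simp
  qed
  then show "A = hyp_matrix (cos (- \<i> * complex_of_real (ln lam))) (- sin (- \<i> * complex_of_real (ln lam)))"
    by (simp add: G(3) vec_eq_iff F_def)
qed

lemma cos_ln:
  assumes "lam > 0"
  shows "cos (- \<i> * complex_of_real (ln lam)) = complex_of_real ((lam + 1 / lam) / 2)"
    "- sin (- \<i> * complex_of_real (ln lam)) = \<i> * complex_of_real ((lam - 1 / lam) / 2)"
proof -
  have e: "exp (\<i> * (- \<i> * complex_of_real (ln lam))) = complex_of_real lam"
    "exp (- (\<i> * (- \<i> * complex_of_real (ln lam)))) = complex_of_real (1 / lam)"
    using assms by (simp_all add: exp_of_real exp_minus inverse_eq_divide)
  show "cos (- \<i> * complex_of_real (ln lam)) = complex_of_real ((lam + 1 / lam) / 2)"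
    unfolding cos_exp_eq e by simp
  show "- sin (- \<i> * complex_of_real (ln lam)) = \<i> * complex_of_real ((lam - 1 / lam) / 2)"
    unfolding sin_exp_eq e by (simp add: field_simps)
qed

lemma U_inner_rotation:
  assumes lam: "lam > 0"
  shows "U_inner (rotation_group lam) x y = (let M = hyp_matrix (complex_of_real 1) (\<i> * complex_of_real ((lam - 1) / (lam + 1)))
    in \<Sum>i\<in>UNIV. cnj ((M *v x) $ i) * y $ i)"
proof -
  \<comment> \<open>\<open>C\<close> and \<open>S\<close> are the hyperbolic cosine and sine of ln
    lam.\<close>
  define C where "C = complex_of_real ((lam + 1 / lam) / 2)"
  define S where "S = complex_of_real ((lam - 1 / lam) / 2)"
  have CS: "C\<^sup>2 - S\<^sup>2 = 1"
  proof -
    have "((lam + 1 / lam) / 2)\<^sup>2 - ((lam - 1 / lam) / 2)\<^sup>2 = 1" using lam by (simp add: power2_eq_square field_simps)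
    then show ?thesis unfolding C_def S_def by (metis of_real_1 of_real_diff of_real_power)
  qed
  have A: "analytic_generator (\<lambda>t. map_matrix complex_of_real (rotation_group lam t)) = hyp_matrix C (\<i> * S)"
    unfolding analytic_generator_rotation cos_ln[OF lam] C_def S_def ..
  have inv: "matrix_inv (hyp_matrix C (\<i> * S)) = hyp_matrix C (- \<i> * S)"
    by (subst hyp_matrix_inv) (use CS in \<open>simp_all add: power_mult_distrib\<close>)
  have d: "(1 + C)\<^sup>2 + (- \<i> * S)\<^sup>2 = 2 * (1 + C)" using CS by (simp add: power_mult_distrib power2_sum)
  have C1: "1 + C \<noteq> 0"
  proof -
    have "1 + C = complex_of_real (1 + (lam + 1 / lam) / 2)" by (simp add: C_def)
    moreover have "1 + (lam + 1 / lam) / 2 > 0" using lam by (simp add: add_pos_pos)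
    ultimately show ?thesis by (metis of_real_eq_0_iff less_numeral_extra(3))
  qed
  have "mat 1 + matrix_inv (hyp_matrix C (\<i> * S)) = hyp_matrix (1 + C) (- \<i> * S)"
    unfolding inv hyp_matrix_one[symmetric] hyp_matrix_add by simp
  then have "matrix_inv (mat 1 + matrix_inv (hyp_matrix C (\<i> * S))) = hyp_matrix ((1 + C) / (2 * (1 + C))) (- (- \<i> * S) / (2 * (1 + C)))"
  proof -
    have nz: "(1 + C)\<^sup>2 + (- \<i> * S)\<^sup>2 \<noteq> 0" unfolding d by (rule no_zero_divisors[OF _ C1]) simp
    show ?thesis unfolding \<open>mat 1 + matrix_inv (hyp_matrix C (\<i> * S)) = hyp_matrix (1 + C) (- \<i> * S)\<close> hyp_matrix_inv[OF nz] d ..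
  qed
  moreover have "S / (1 + C) = complex_of_real ((lam - 1) / (lam + 1))"
  proof -
    have "((lam - 1 / lam) / 2) / (1 + (lam + 1 / lam) / 2) = (lam - 1) / (lam + 1)"
    proof -
      have n: "lam + 1 \<noteq> 0" "1 + (lam + 1 / lam) / 2 \<noteq> 0" using lam by (simp_all add: add_pos_pos less_imp_neq[THEN not_sym])
      have "((lam - 1 / lam) / 2) * (lam + 1) = (lam - 1) * (1 + (lam + 1 / lam) / 2)"
        using lam by (simp add: field_simps)
      then show ?thesis by (rule frac_eq_eq[OF n(2,1), THEN iffD2])
    qed
    then show ?thesis unfolding C_def S_def by (metis of_real_1 of_real_add of_real_divide)
  qed
  ultimately have "2 *\<^sub>R matrix_inv (mat 1 + matrix_inv (hyp_matrix C (\<i> * S)))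
      = hyp_matrix (complex_of_real 1) (\<i> * complex_of_real ((lam - 1) / (lam + 1)))"
  proof -
    assume a: "matrix_inv (mat 1 + matrix_inv (hyp_matrix C (\<i> * S))) = hyp_matrix ((1 + C) / (2 * (1 + C))) (- (- \<i> * S) / (2 * (1 + C)))"
      and b: "S / (1 + C) = complex_of_real ((lam - 1) / (lam + 1))"
    have e: "(1 + C) / (2 * (1 + C)) = 1 / 2" "- (- \<i> * S) / (2 * (1 + C)) = \<i> * (S / (1 + C)) / 2"
      using nonzero_divide_mult_cancel_right[OF C1, of 2] by simp_all
    have "2 *\<^sub>R hyp_matrix (1 / 2) (\<i> * r / 2) = hyp_matrix 1 (\<i> * r)" for r
      by (simp add: vec_eq_iff forall_2 scaleR_conv_of_real)
    then show ?thesis unfolding a e b of_real_1 .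
  qed
  then show ?thesis by (simp add: U_inner_def A Let_def)
qed

text \<open>Eigenvectors of the generator, of unit length in the deformed inner product.
  \<open>sqrt lam\<close> times \<open>letter lam True\<close> is the complex conjugate of
  \<open>letter lam False\<close>: this is the vector e, and the origin of the weight mu in
  \<open>yl\<close>.\<close>

definition letter :: "real \<Rightarrow> bool \<Rightarrow> complex^2" where
  "letter lam x = (if x
     then vector [complex_of_real (sqrt (1 + lam) / (2 * sqrt lam)), - \<i> * complex_of_real (sqrt (1 + lam) / (2 * sqrt lam))]
     else vector [complex_of_real (sqrt (1 + lam) / 2), \<i> * complex_of_real (sqrt (1 + lam) / 2)])"

lemma letter_orthonormal:
  assumes lam: "lam > 0"
  shows "U_inner (rotation_group lam) (letter lam x) (letter lam y) = (if x = y then 1 else 0)"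
proof -
  define c where "c = sqrt (1 + lam) / 2"
  define s where "s = (lam - 1) / (lam + 1)"
  have c: "c * c = (1 + lam) / 4" using lam by (simp add: c_def)
  have l: "sqrt lam \<noteq> 0" "sqrt lam * sqrt lam = lam" using lam by auto
  have e1: "1 - s = 2 / (1 + lam)" "1 + s = 2 * lam / (1 + lam)" using lam by (simp_all add: s_def field_simps)
  have T: "2 * (1 + s) * (c / sqrt lam) * (c / sqrt lam) = 1"
  proof -
    have "2 * (1 + s) * (c / sqrt lam) * (c / sqrt lam) = 2 * (1 + s) * (c * c) / (sqrt lam * sqrt lam)" by simp
    also have "\<dots> = 1" unfolding e1 c l(2) using lam by (simp add: add_pos_pos less_imp_neq[THEN not_sym])
    finally show ?thesis .
  qed
  have F: "2 * (1 - s) * c * c = 1"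
  proof -
    have "2 * (1 - s) * c * c = 2 * (1 - s) * (c * c)" by simp
    also have "\<dots> = 1" unfolding e1 c using lam by (simp add: add_pos_pos less_imp_neq[THEN not_sym])
    finally show ?thesis .
  qed
  define a where "a = c / sqrt lam"
  have L: "letter lam True = vector [complex_of_real a, - \<i> * complex_of_real a]"
    "letter lam False = vector [complex_of_real c, \<i> * complex_of_real c]"
    by (simp_all add: letter_def c_def a_def)
  have "2 * (1 + complex_of_real s) * complex_of_real a * complex_of_real a = complex_of_real (2 * (1 + s) * a * a)"
    "2 * (1 - complex_of_real s) * complex_of_real c * complex_of_real c = complex_of_real (2 * (1 - s) * c * c)"
    by simp_all
  then have "2 * (1 + complex_of_real s) * complex_of_real a * complex_of_real a = 1"
    "2 * (1 - complex_of_real s) * complex_of_real c * complex_of_real c = 1"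
    unfolding T[folded a_def] F by simp_all
  then show ?thesis
    unfolding U_inner_rotation[OF lam] Let_def s_def[symmetric]
    by (cases x; cases y) (simp_all add: L matrix_vector_mult_def sum_2 algebra_simps)
qed


section \<open>The constants\<close>

context
  fixes q :: real
  assumes q: "- 1 < q" "q < 1"
begin

lemma d_inf_convergent: "convergent_prod (\<lambda>i. 1 - q ^ Suc i)"
proof (rule abs_convergent_prod_imp_convergent_prod, rule summable_imp_abs_convergent_prod)
  have "summable (\<lambda>i. \<bar>q\<bar> ^ Suc i)"
    using abs_q[OF q] by (simp add: summable_mult summable_geometric)
  then show "summable (\<lambda>i. norm (1 - q ^ Suc i - 1))" by (simp add: power_abs abs_mult)
qed

lemma d_inf_LIMSEQ: "(\<lambda>n. d_const q (Suc n)) \<longlonglongrightarrow> d_inf q"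
proof -
  have "(\<Prod>i\<le>n. 1 - q ^ Suc i) = d_const q (Suc n)" for n
  proof (induction n)
    case (Suc n)
    show ?case by (simp only: prod.atMost_Suc Suc d_const_Suc[of q "Suc n"])
  qed (simp add: d_const_def)
  then show ?thesis using convergent_prod_LIMSEQ[OF d_inf_convergent] by (simp add: d_inf_def)
qed

lemma d_inf_pos: "d_inf q > 0"
proof -
  have "d_inf q \<ge> 0"
    by (rule LIMSEQ_le_const[OF d_inf_LIMSEQ]) (use d_const_pos[OF q] in \<open>auto intro: less_imp_le\<close>)
  moreover have "d_inf q \<noteq> 0"
    unfolding d_inf_def
  proof (rule prodinf_nonzero[OF d_inf_convergent])
    show "1 - q ^ Suc i \<noteq> 0" for i using one_minus_pow_pos[OF q, of "Suc i"] by simp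
  qed
  ultimately show ?thesis by simp
qed

lemma d_inf_le_D: "d_inf q \<le> D_const q"
proof (rule LIMSEQ_le_const2[OF d_inf_LIMSEQ])
  have "bdd_above (range (d_const q))"
    using d_upper[OF q, of 0] by (intro bdd_aboveI[of _ "U_bound q"]) auto
  then have "d_const q (Suc n) \<le> D_const q" for n unfolding D_const_def by (rule cSUP_upper[rotated]) simp
  then show "\<exists>N. \<forall>n\<ge>N. d_const q (Suc n) \<le> D_const q" by blast
qed

lemma C_d_inf: "q > 0 \<Longrightarrow> C_const q * d_inf q = 1"
proof -
  assume "q > 0"
  then have "(\<lambda>n. 1 / d_const q (Suc n) * d_const q (Suc n)) \<longlonglongrightarrow> C_const q * d_inf q"
    using C_const_LIMSEQ[OF q] by (intro tendsto_mult d_inf_LIMSEQ) simp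
  then have "(\<lambda>n. 1) \<longlonglongrightarrow> C_const q * d_inf q" using d_const_pos[OF q] by (simp add: less_imp_neq[THEN not_sym])
  then show ?thesis by (simp add: LIMSEQ_const_iff)
qed

text \<open>With mu = sqrt lam the bound on \<open>lam\<close> reads mu (1 + K) < 1, that is K mu /
  (1 - mu) < 1.\<close>

lemma lam_small:
  assumes lam: "0 < lam" "lam < 1" and K: "0 \<le> K" "lam < (1 + K) powi (-2)"
    and le: "(C_const q)\<^sup>2 * (U_bound q * sqrt (U_bound q)) \<le> K"
  shows "(C_const q)\<^sup>2 * (U_bound q * sqrt (U_bound q)) * (sqrt lam / (1 - sqrt lam)) < 1"
proof -
  have "lam < (1 / (1 + K))\<^sup>2" using K(2) by (simp add: power_int_def power_one_over inverse_eq_divide)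
  then have "sqrt lam < 1 / (1 + K)" using K(1) real_sqrt_less_mono[of lam "(1 / (1 + K))\<^sup>2"] by simp
  then have "sqrt lam * (1 + K) < 1" using K(1) by (simp add: less_divide_eq)
  then have "K * sqrt lam < 1 - sqrt lam" by (simp add: algebra_simps)
  moreover have l: "sqrt lam < 1" using lam by simp
  ultimately have "K * (sqrt lam / (1 - sqrt lam)) < 1" by (simp add: divide_less_eq)
  moreover have "(C_const q)\<^sup>2 * (U_bound q * sqrt (U_bound q)) * (sqrt lam / (1 - sqrt lam)) \<le> K * (sqrt lam / (1 - sqrt lam))"
    using le lam l by (intro mult_right_mono) auto
  ultimately show ?thesis by linarith
qed

text \<open>For q > 0 the constant \<open>C_const q\<close> is 1/\<open>d_inf q\<close>, so its
  square is the quotient in the hypothesis, and \<open>U_bound q\<close> is 1.\<close>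

lemma small_pos:
  assumes "q > 0" "0 < lam" "lam < 1" "lam < (1 + C_const q / d_inf q) powi (-2)"
  shows "(C_const q)\<^sup>2 * (U_bound q * sqrt (U_bound q)) * (sqrt lam / (1 - sqrt lam)) < 1"
proof (rule lam_small[OF assms(2,3) _ assms(4)])
  show "0 \<le> C_const q / d_inf q" using C_const_ge_1[OF q] d_inf_pos by simp
  have "C_const q = 1 / d_inf q" using C_d_inf[OF assms(1)] d_inf_pos by (simp add: eq_divide_eq)
  then have "(C_const q)\<^sup>2 = C_const q / d_inf q" by (simp add: power2_eq_square)
  then show "(C_const q)\<^sup>2 * (U_bound q * sqrt (U_bound q)) \<le> C_const q / d_inf q"
    using assms(1) by (simp add: U_bound_def)
qed

text \<open>The power 3/2 of 1 - q \<ge> 1 is at most its square, and the quotient of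
  \<open>D_const q\<close> by \<open>d_inf q\<close> is at least 1.\<close>

lemma small_neg:
  assumes "q < 0" "0 < lam" "lam < 1" "lam < (1 + (C_const q * (1 - q))\<^sup>2 * D_const q / d_inf q) powi (-2)"
  shows "(C_const q)\<^sup>2 * (U_bound q * sqrt (U_bound q)) * (sqrt lam / (1 - sqrt lam)) < 1"
proof (rule lam_small[OF assms(2,3) _ assms(4)])
  have D: "D_const q / d_inf q \<ge> 1" using d_inf_pos d_inf_le_D by simp
  then have "0 \<le> (C_const q * (1 - q))\<^sup>2 * (D_const q / d_inf q)" by (intro mult_nonneg_nonneg) auto
  then show "0 \<le> (C_const q * (1 - q))\<^sup>2 * D_const q / d_inf q" by simp
  have U: "U_bound q = 1 - q" using assms(1) by (simp add: U_bound_def)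
  have "sqrt (1 - q) \<le> sqrt ((1 - q)\<^sup>2)"
    using assms(1) by (intro real_sqrt_le_mono self_le_power) auto
  then have "sqrt (1 - q) \<le> 1 - q" using assms(1) by simp
  then have "(C_const q)\<^sup>2 * (U_bound q * sqrt (U_bound q)) \<le> (C_const q)\<^sup>2 * ((1 - q) * (1 - q))"
    unfolding U using assms(1) by (intro mult_left_mono) auto
  also have "\<dots> = (C_const q * (1 - q))\<^sup>2 * 1" by (simp add: power2_eq_square mult_ac)
  also have "\<dots> \<le> (C_const q * (1 - q))\<^sup>2 * (D_const q / d_inf q)" by (intro mult_left_mono D) auto
  finally show "(C_const q)\<^sup>2 * (U_bound q * sqrt (U_bound q)) \<le> (C_const q * (1 - q))\<^sup>2 * D_const q / d_inf q" by simp
qed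

end


section \<open>The q-Araki-Woods algebra in orthonormal letters\<close>

text \<open>For a real vector the two coefficients are conjugate up to the factor
  \<open>sqrt lam\<close>, which is what makes its Gaussian a combination of \<open>yl\<close> and
  \<open>ys\<close>.\<close>

lemma letter_decomposition:
  fixes x :: "complex^2"
  assumes lam: "lam > 0"
  defines "c \<equiv> sqrt (1 + lam) / 2"
  shows "x = (complex_of_real (sqrt lam) * ((x $ 1 + \<i> * x $ 2) / (2 * complex_of_real c))) *s letter lam True
    + ((x $ 1 - \<i> * x $ 2) / (2 * complex_of_real c)) *s letter lam False"
proof -
  have c: "complex_of_real c \<noteq> 0" using lam by (simp add: c_def)
  have l: "complex_of_real (sqrt lam) \<noteq> 0" using lam by simp
  have L: "letter lam True = vector [complex_of_real c / complex_of_real (sqrt lam), - \<i> * (complex_of_real c / complex_of_real (sqrt lam))]"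
    "letter lam False = vector [complex_of_real c, \<i> * complex_of_real c]"
    by (simp_all add: letter_def c_def)
  have 1: "(complex_of_real (sqrt lam) * (u / (2 * complex_of_real c))) * (complex_of_real c / complex_of_real (sqrt lam)) = u / 2" for u
    using c l by simp
  have 2: "u / (2 * complex_of_real c) * complex_of_real c = u / 2" for u using c by simp
  have 3: "(complex_of_real (sqrt lam) * (u / (2 * complex_of_real c))) * (- \<i> * (complex_of_real c / complex_of_real (sqrt lam))) = - \<i> * u / 2" for u
    using c l by simp
  have 4: "u / (2 * complex_of_real c) * (\<i> * complex_of_real c) = \<i> * u / 2" for u using c by simp
  show ?thesis
    unfolding vec_eq_iff forall_2 L vector_add_component vector_smult_component vector_2 1 2 3 4
    by (simp add: field_simps)
qed

text \<open>Multilinearity replaces arbitrary vectors by letters one position at a time; the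
  induction keeps a prefix that already consists of letters.\<close>

lemma fock_words:
  fixes T :: "(complex^2) list \<Rightarrow> 'h::complex_hilbert"
  assumes T: "is_q_fock_space q (rotation_group lam) T" and lam: "lam > 0"
    and f: "bounded_clinear f" and g: "\<And>pre a x b y post. g (pre @ (a *s x + b *s y) # post) = a *\<^sub>C g (pre @ x # post) + b *\<^sub>C g (pre @ y # post)"
    and eq: "\<And>w. f (T (map (letter lam) w)) = g (map (letter lam) w)"
  shows "f (T v) = g v"
proof -
  have "f (T (map (letter lam) w @ v)) = g (map (letter lam) w @ v)" for w
  proof (induction v arbitrary: w)
    case (Cons x v)
    define a where "a = complex_of_real (sqrt lam) * ((x $ 1 + \<i> * x $ 2) / (2 * complex_of_real (sqrt (1 + lam) / 2)))"
    define b where "b = (x $ 1 - \<i> * x $ 2) / (2 * complex_of_real (sqrt (1 + lam) / 2))"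
    have x: "x = a *s letter lam True + b *s letter lam False"
      unfolding a_def b_def by (rule letter_decomposition[OF lam])
    have "f (T (map (letter lam) w @ letter lam y # v)) = g (map (letter lam) w @ letter lam y # v)" for y
      using Cons[of "w @ [y]"] by simp
    then show ?case
      by (subst (1 2) x) (simp only: fock_multilinear[OF T] g bcl_simps[OF f])
  qed (simp add: eq)
  from this[of "[]"] show ?thesis by simp
qed

lemma q_aw_letters:
  fixes T :: "(complex^2) list \<Rightarrow> 'h::complex_hilbert"
  assumes T: "is_q_fock_space q (rotation_group lam) T" and lam: "0 < lam" "lam < 1" and q: "- 1 < q" "q < 1"
  shows "q_aw q (\<lambda>w. T (map (letter lam) w)) (sqrt lam)"
proof
  show "cinner (T (map (letter lam) v)) (T (map (letter lam) w)) = qi q v w" for v w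
    using T q_inner_orthonormal[OF letter_orthonormal[OF lam(1)]] by (simp add: is_q_fock_space_def)
  let ?B = "\<lambda>w. T (map (letter lam) w)"
  have "T (map (letter lam) w @ v) \<in> cspan (range ?B)" for w v
  proof (induction v arbitrary: w)
    case Nil
    show ?case by (simp add: complex_vector.span_base)
  next
    case (Cons x v)
    define a where "a = complex_of_real (sqrt lam) * ((x $ 1 + \<i> * x $ 2) / (2 * complex_of_real (sqrt (1 + lam) / 2)))"
    define b where "b = (x $ 1 - \<i> * x $ 2) / (2 * complex_of_real (sqrt (1 + lam) / 2))"
    have x: "x = a *s letter lam True + b *s letter lam False"
      unfolding a_def b_def by (rule letter_decomposition[OF lam(1)])
    have "T (map (letter lam) w @ letter lam y # v) \<in> cspan (range ?B)" for y
      using Cons[of "w @ [y]"] by simp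
    then show ?case
      by (subst x) (simp only: fock_multilinear[OF T] complex_vector.span_add complex_vector.span_scale)
  qed
  from this[of "[]"] have "cspan (range T) \<subseteq> cspan (range ?B)"
    by (intro complex_vector.span_minimal complex_vector.subspace_span) auto
  then have "closure (cspan (range T)) \<subseteq> closure (cspan (range ?B))" by (rule closure_mono)
  then show "closure (cspan (range ?B)) = UNIV" using T by (auto simp: is_q_fock_space_def)
qed (use lam q in auto)

text \<open>Each Gaussian is a complex combination of \<open>yl\<close> and \<open>ys\<close>, and
  two suitable real vectors recover both generators, so the commutants agree.\<close>

lemma q_araki_woods_eq:
  fixes T :: "(complex^2) list \<Rightarrow> 'h::complex_hilbert"
  assumes T: "is_q_fock_space q (rotation_group lam) T" and lam: "0 < lam" "lam < 1" and q: "- 1 < q" "q < 1"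
  shows "q_araki_woods T = q_aw.Malg (\<lambda>w. T (map (letter lam) w)) (sqrt lam)"
proof -
  interpret q_aw q "\<lambda>w. T (map (letter lam) w)" "sqrt lam" by (rule q_aw_letters[OF assms])
  define c where "c = sqrt (1 + lam) / 2"
  have c0: "c > 0" using lam by (simp add: c_def)
  have crT: "cr y (T v) = T (letter lam y # v)" for y v
  proof (rule fock_words[OF T lam(1) bcl_cr, where g = "\<lambda>v. T (letter lam y # v)"])
    show "T (letter lam y # pre @ (a *s x + b *s z) # post) = a *\<^sub>C T (letter lam y # pre @ x # post) + b *\<^sub>C T (letter lam y # pre @ z # post)" for pre a x b z post
      using fock_multilinear[OF T, of "letter lam y # pre"] by simp
    show "cr y (T (map (letter lam) w)) = T (letter lam y # map (letter lam) w)" for w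
      using cr_B[of y w] by simp
  qed
  have creation: "q_creation T (a *s letter lam True + b *s letter lam False) = (\<lambda>v. a *\<^sub>C cr True v + b *\<^sub>C cr False v)" for a b
    unfolding q_creation_def
  proof (rule the_equality)
    have lin: "T ((a *s letter lam True + b *s letter lam False) # v) = a *\<^sub>C T (letter lam True # v) + b *\<^sub>C T (letter lam False # v)" for v
      using fock_multilinear[OF T, of "[]"] by simp
    show bc: "bounded_clinear (\<lambda>v. a *\<^sub>C cr True v + b *\<^sub>C cr False v) \<and>
        (\<forall>\<xi>s. a *\<^sub>C cr True (T \<xi>s) + b *\<^sub>C cr False (T \<xi>s) = T ((a *s letter lam True + b *s letter lam False) # \<xi>s))"
      by (auto simp: crT lin intro!: bounded_clinear_plus bounded_clinear_cmult)
    fix h assume "bounded_clinear h \<and> (\<forall>\<xi>s. h (T \<xi>s) = T ((a *s letter lam True + b *s letter lam False) # \<xi>s))"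
    then show "h = (\<lambda>v. a *\<^sub>C cr True v + b *\<^sub>C cr False v)"
      using bc by (intro bcl_eqI) (auto simp: lin)
  qed
  define be where "be \<xi> = (complex_of_real (\<xi> $ 1) - \<i> * complex_of_real (\<xi> $ 2)) / (2 * complex_of_real c)" for \<xi> :: "real^2"
  have gauss: "q_gaussian T (\<chi> i. complex_of_real (\<xi> $ i)) = (\<lambda>v. cnj (be \<xi>) *\<^sub>C yl v + be \<xi> *\<^sub>C ys v)" for \<xi> :: "real^2"
  proof -
    define x :: "complex^2" where "x = (\<chi> i. complex_of_real (\<xi> $ i))"
    let ?a = "complex_of_real (sqrt lam) * cnj (be \<xi>)"
    have x: "x = ?a *s letter lam True + be \<xi> *s letter lam False"
      using letter_decomposition[OF lam(1), of x] by (simp add: x_def be_def c_def)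
    have bc: "bounded_clinear (\<lambda>v. ?a *\<^sub>C cr True v)" "bounded_clinear (\<lambda>v. be \<xi> *\<^sub>C cr False v)"
      by (auto intro!: bounded_clinear_cmult)
    have "q_gaussian T x = (\<lambda>v. (?a *\<^sub>C cr True v + be \<xi> *\<^sub>C cr False v) + (cnj ?a *\<^sub>C an True v + cnj (be \<xi>) *\<^sub>C an False v))"
      unfolding q_gaussian_def x creation cadjoint_plus[OF bc] by (simp add: cadjoint_cmult an_def)
    also have "\<dots> = (\<lambda>v. cnj (be \<xi>) *\<^sub>C yl v + be \<xi> *\<^sub>C ys v)"
      by (rule ext) (simp add: yl_def ys_def scaleC_add_right scaleC_of_real[symmetric] scaleC_scaleC mult.commute)
    finally show ?thesis unfolding x_def .
  qed
  let ?G = "range (\<lambda>\<xi>::real^2. q_gaussian T (\<chi> i. complex_of_real (\<xi> $ i)))"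
  have "commutant ?G = commutant {yl, ys}"
  proof (intro set_eqI iffI)
    fix z assume z: "z \<in> commutant {yl, ys}"
    have bz: "bounded_clinear z" by (rule commutant_bcl[OF z])
    show "z \<in> commutant ?G"
      by (rule commutantI[OF bz]) (auto simp: gauss fun_eq_iff bcl_simps[OF bz] commutantD'[OF z])
  next
    fix z assume z: "z \<in> commutant ?G"
    have bz: "bounded_clinear z" by (rule commutant_bcl[OF z])
    have zg: "z (cnj (be \<xi>) *\<^sub>C yl v + be \<xi> *\<^sub>C ys v) = cnj (be \<xi>) *\<^sub>C yl (z v) + be \<xi> *\<^sub>C ys (z v)" for \<xi> v
      using commutantD'[OF z, of "q_gaussian T (\<chi> i. complex_of_real (\<xi> $ i))" v] by (simp add: gauss)
    \<comment> \<open>These two real vectors produce the sum of the generators and i times their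
      difference.\<close>
    have b1: "be (vector [2 * c, 0]) = 1" "be (vector [0, 2 * c]) = - \<i>" using c0 by (simp_all add: be_def)
    have p: "z (yl v) + z (ys v) = yl (z v) + ys (z v)" for v
      using zg[of "vector [2 * c, 0]" v] by (simp add: b1 bcl_simps[OF bz])
    have "\<i> *\<^sub>C (z (yl v) - z (ys v)) = \<i> *\<^sub>C (yl (z v) - ys (z v))" for v
      using zg[of "vector [0, 2 * c]" v] by (simp add: b1 bcl_simps[OF bz] scaleC.minus_left scaleC.diff_right)
    then have m: "z (yl v) - z (ys v) = yl (z v) - ys (z v)" for v by simp
    have "z (yl v) = yl (z v)" "z (ys v) = ys (z v)" for v
    proof -
      have "2 *\<^sub>R z (yl v) = 2 *\<^sub>R yl (z v)"
        using arg_cong2[OF p[of v] m[of v], of "(+)"] by (simp add: scaleR_2)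
      then show "z (yl v) = yl (z v)" by simp
      then show "z (ys v) = ys (z v)" using p[of v] by simp
    qed
    then show "z \<in> commutant {yl, ys}" by (intro commutantI bz) (auto simp: fun_eq_iff)
  qed
  then show ?thesis by (simp add: q_araki_woods_def Malg_def)
qed

theorem theorem4p2:
  fixes q lam :: real
    and T :: "(complex^2) list \<Rightarrow> 'h::complex_hilbert"
  assumes q: "- 1 < q" "q < 1" "q \<noteq> 0"
    and lam: "0 < lam" "lam < 1"
    and fock: "is_q_fock_space q (rotation_group lam) T"
    and pos: "q > 0 \<Longrightarrow> lam < (1 + C_const q / d_inf q) powi (-2)"
    and neg: "q < 0 \<Longrightarrow> lam < (1 + (C_const q * (1 - q))\<^sup>2 * D_const q / d_inf q) powi (-2)"
  shows "commutant (vacuum_centralizer T) \<inter> q_araki_woods T = scalar_operators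
    \<and> factor (vacuum_centralizer T) \<and> factor (q_araki_woods T)"
proof -
  interpret q_aw q "\<lambda>w. T (map (letter lam) w)" "sqrt lam" by (rule q_aw_letters[OF fock lam q(1,2)])
  have "(C_const q)\<^sup>2 * (U_bound q * sqrt (U_bound q)) * (sqrt lam / (1 - sqrt lam)) < 1"
    using small_pos[OF q(1,2) _ lam pos] small_neg[OF q(1,2) _ lam neg] q(3) by linarith
  from factor_centralizer[OF this] show ?thesis
    by (simp add: vacuum_centralizer_def q_araki_woods_eq[OF fock lam q(1,2)])
qed

end
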